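(* Let $m\geq 2$, $s\geq 1$, let $w$ be a preregular $m$-linear form on $\mathbb K^{s+1}$ with components $W_{\lambda_1\dots\lambda_m}$ and let $\tilde w$ be an $m$-linear form on the dual of $\mathbb K^{s+1}$ with components $\tilde W^{\lambda_1\dots\lambda_m}$ such that $\tilde W^{\alpha\gamma_1\dots\gamma_{m-1}}W_{\gamma_1\dots\gamma_{m-1}\beta}=\delta^\alpha_\beta$ for all $\alpha,\beta\in\{0,\dots,s\}$. Let $\mathcal H(w,\tilde w)$ be the unital associative algebra generated by the $(s+1)^2$ elements $u^\alpha_\beta$ $(\alpha,\beta\in\{0,\dots,s\})$ with the relations $$W_{\alpha_1\dots\alpha_m}u^{\alpha_1}_{\beta_1}\cdots u^{\alpha_m}_{\beta_m}=W_{\beta_1\dots\beta_m}\mathbf 1,\qquad \tilde W^{\beta_1\dots\beta_m}u^{\alpha_1}_{\beta_1}\cdots u^{\alpha_m}_{\beta_m}=\tilde W^{\alpha_1\dots\alpha_m}\mathbf 1$$ (for all values of the free indices). Then there is a unique structure of Hopf algebra on $\mathcal H(w,\tilde w)$, whose product and unit are those of $\mathcal H(w,\tilde w)$, with coproduct $\Delta$, counit $\varepsilon$ and antipode $S$ such that $$\Delta(u^\mu_\nu)=u^\mu_\lambda\otimes u^\lambda_\nu,\qquad \varepsilon(u^\mu_\nu)=\delta^\mu_\nu,\qquad S(u^\mu_\nu)=\tilde W^{\mu\lambda_1\dots\lambda_{m-1}}u^{\rho_1}_{\lambda_1}\cdots u^{\rho_{m-1}}_{\lambda_{m-1}}W_{\rho_1\dots\rho_{m-1}\nu}$$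 for $\mu,\nu\in\{0,\dots,s\}$.
   Context: $\mathbb K$ is an algebraically closed field of characteristic zero; $\otimes=\otimes_{\mathbb K}$; repeated up-down indices are summed over $\{0,\dots,s\}$. Components of $w$ are $W_{\lambda_1\dots\lambda_m}=w(e_{\lambda_1},\dots,e_{\lambda_m})$ in the canonical basis $(e_\lambda)$ of $\mathbb K^{s+1}$; components of $\tilde w$ are taken in the dual basis of $(e_\lambda)$. Preregular: an $m$-linear form $w$ on a vector space $V$ ($\dim V\geq 2$, $m\geq 2$) is preregular if (i) $w(X,X_1,\dots,X_{m-1})=0$ for all $X_1,\dots,X_{m-1}\in V$ implies $X=0$, and (ii) there is $Q_w\in GL(V)$ with $w(X_1,\dots,X_m)=w(Q_wX_m,X_1,\dots,X_{m-1})$ for all $X_i\in V$. For preregular $w$ at least one such $\tilde w$ exists. $\mathbf 1$ is the unit of $\mathcal H(w,\tilde w)$. *)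

theory Defs
  imports "Jordan_Normal_Form.VS_Connect" "HOL-Algebra.QuotRing" "HOL-Library.Poly_Mapping"
begin

(* The ground field is a type of class field, turned into a HOL-Algebra ring by class_ring.
   Algebras over it are HOL-Algebra module records.  The library locale algebra requires a
   commutative multiplication, hence the separate locale assoc_algebra. *)

definition ground_algebra :: "('k::field, 'k) module" where
  "ground_algebra =
     \<lparr>carrier = UNIV, mult = (*), one = 1, zero = 0, add = (+), smult = (*)\<rparr>"

locale assoc_algebra =
  fixes A :: "('k::field, 'a) module" (structure)
  assumes ring: "ring A"
    and module: "module class_ring A"
    and smult_mult_left:
      "\<And>c x y. \<lbrakk>x \<in> carrier A; y \<in> carrier A\<rbrakk> \<Longrightarrow> (c \<odot> x) \<otimes> y = c \<odot> (x \<otimes> y)"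
    and smult_mult_right:
      "\<And>c x y. \<lbrakk>x \<in> carrier A; y \<in> carrier A\<rbrakk> \<Longrightarrow> x \<otimes> (c \<odot> y) = c \<odot> (x \<otimes> y)"

abbreviation lin_hom :: "('k::field, 'a) module \<Rightarrow> ('k, 'b) module \<Rightarrow> ('a \<Rightarrow> 'b) set" where
  "lin_hom V W \<equiv> LinearCombinations.module_hom class_ring V W"

definition algebra_hom :: "('k::field, 'a) module \<Rightarrow> ('k, 'b) module \<Rightarrow> ('a \<Rightarrow> 'b) set" where
  "algebra_hom A B = Ring.ring_hom A B \<inter> lin_hom A B"


section \<open>Multilinear forms\<close>

(* An m-linear form on V is a function on lists, relevant only on lists of length m over V. *)

definition multilinear_form :: "nat \<Rightarrow> ('k::field, 'v) module \<Rightarrow> ('v list \<Rightarrow> 'k) \<Rightarrow> bool" where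
  "multilinear_form m V w \<longleftrightarrow>
     (\<forall>i<m. \<forall>xs. length xs = m \<and> set xs \<subseteq> carrier V \<longrightarrow>
        (\<lambda>x. w (xs[i := x])) \<in> lin_hom V ground_algebra)"

definition preregular :: "nat \<Rightarrow> ('k::field, 'v) module \<Rightarrow> ('v list \<Rightarrow> 'k) \<Rightarrow> bool" where
  "preregular m V w \<longleftrightarrow>
     multilinear_form m V w \<and>
     (\<forall>x\<in>carrier V.
        (\<forall>xs. length xs = m - 1 \<and> set xs \<subseteq> carrier V \<longrightarrow> w (x # xs) = 0) \<longrightarrow> x = \<zero>\<^bsub>V\<^esub>) \<and>
     (\<exists>Q \<in> lin_hom V V. bij_betw Q (carrier V) (carrier V) \<and>
        (\<forall>xs. \<forall>y\<in>carrier V. length xs = m - 1 \<and> set xs \<subseteq> carrier V \<longrightarrow>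
           w (xs @ [y]) = w (Q y # xs)))"

(* Functionals are made extensional so that equality in the dual is equality on V.
   The fields mult and one play no role, as in module_vec. *)

definition dual_space :: "('k::field, 'v) module \<Rightarrow> ('k, 'v \<Rightarrow> 'k) module" where
  "dual_space V =
     \<lparr>carrier = lin_hom V ground_algebra \<inter> extensional (carrier V),
      mult = undefined, one = undefined,
      zero = (\<lambda>v\<in>carrier V. 0),
      add = (\<lambda>f g. \<lambda>v\<in>carrier V. f v + g v),
      smult = (\<lambda>c f. \<lambda>v\<in>carrier V. c * f v)\<rparr>"

definition dual_unit_vec :: "nat \<Rightarrow> nat \<Rightarrow> ('k::field vec \<Rightarrow> 'k)" where
  "dual_unit_vec n i = (\<lambda>v\<in>carrier_vec n. v $ i)"

definition multi_indices :: "nat \<Rightarrow> nat \<Rightarrow> nat list set" where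
  "multi_indices s k = {is. length is = k \<and> set is \<subseteq> {0..s}}"


section \<open>Monoid algebras, quotients, presentations\<close>

definition monoid_algebra :: "('g, 'r) monoid_scheme \<Rightarrow> ('k::field, 'g \<Rightarrow>\<^sub>0 'k) module" where
  "monoid_algebra G =
     \<lparr>carrier = {p. Poly_Mapping.keys p \<subseteq> carrier G},
      mult = (\<lambda>p q. \<Sum>x\<in>Poly_Mapping.keys p. \<Sum>y\<in>Poly_Mapping.keys q.
                Poly_Mapping.single (x \<otimes>\<^bsub>G\<^esub> y) (Poly_Mapping.lookup p x * Poly_Mapping.lookup q y)),
      one = Poly_Mapping.single \<one>\<^bsub>G\<^esub> 1,
      zero = 0,
      add = (+),
      smult = (\<lambda>c p. Poly_Mapping.map ((*) c) p)\<rparr>"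

definition quotient_algebra :: "('k, 'a) module \<Rightarrow> 'a set \<Rightarrow> ('k, 'a set) module" where
  "quotient_algebra A I =
     \<lparr>carrier = carrier (A Quot I), mult = mult (A Quot I), one = one (A Quot I),
      zero = zero (A Quot I), add = add (A Quot I),
      smult = (\<lambda>c X. \<Union>x\<in>X. I +>\<^bsub>A\<^esub> (c \<odot>\<^bsub>A\<^esub> x))\<rparr>"

definition free_monoid :: "'x set \<Rightarrow> 'x list monoid" where
  "free_monoid X = \<lparr>carrier = lists X, mult = (@), one = []\<rparr>"

definition free_algebra :: "'x set \<Rightarrow> ('k::field, 'x list \<Rightarrow>\<^sub>0 'k) module" where
  "free_algebra X = monoid_algebra (free_monoid X)"

definition presented_algebra ::
  "'x set \<Rightarrow> ('x list \<Rightarrow>\<^sub>0 'k) set \<Rightarrow> ('k::field, ('x list \<Rightarrow>\<^sub>0 'k) set) module" where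
  "presented_algebra X R = quotient_algebra (free_algebra X) (Idl\<^bsub>free_algebra X\<^esub> R)"

definition presented_gen ::
  "'x set \<Rightarrow> ('x list \<Rightarrow>\<^sub>0 'k::field) set \<Rightarrow> 'x \<Rightarrow> ('x list \<Rightarrow>\<^sub>0 'k) set" where
  "presented_gen X R x =
     (Idl\<^bsub>free_algebra X\<^esub> R) +>\<^bsub>free_algebra X\<^esub> Poly_Mapping.single [x] 1"


section \<open>Tensor products of algebras\<close>

(* The free vector space on A x B carries the product (a,b)(a',b') = (aa',bb'), i.e. it is the
   monoid algebra of the product of the multiplicative monoids.  The tensor product is its quotient
   by the linear span of the bilinearity relators, with the induced product
   (a \<otimes> b)(a' \<otimes> b') = aa' \<otimes> bb'. *)

definition tensor_relators ::
  "('k::field, 'a) module \<Rightarrow> ('k, 'b) module \<Rightarrow> ('a \<times> 'b \<Rightarrow>\<^sub>0 'k) set" where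
  "tensor_relators A B =
     {Poly_Mapping.single (a \<oplus>\<^bsub>A\<^esub> a', b) 1 - Poly_Mapping.single (a, b) 1
        - Poly_Mapping.single (a', b) 1 | a a' b.
        a \<in> carrier A \<and> a' \<in> carrier A \<and> b \<in> carrier B} \<union>
     {Poly_Mapping.single (a, b \<oplus>\<^bsub>B\<^esub> b') 1 - Poly_Mapping.single (a, b) 1
        - Poly_Mapping.single (a, b') 1 | a b b'.
        a \<in> carrier A \<and> b \<in> carrier B \<and> b' \<in> carrier B} \<union>
     {Poly_Mapping.single (c \<odot>\<^bsub>A\<^esub> a, b) 1 - Poly_Mapping.single (a, b) c | c a b.
        a \<in> carrier A \<and> b \<in> carrier B} \<union>
     {Poly_Mapping.single (a, c \<odot>\<^bsub>B\<^esub> b) 1 - Poly_Mapping.single (a, b) c | c a b.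
        a \<in> carrier A \<and> b \<in> carrier B}"

definition tensor_kernel ::
  "('k::field, 'a) module \<Rightarrow> ('k, 'b) module \<Rightarrow> ('a \<times> 'b \<Rightarrow>\<^sub>0 'k) set" where
  "tensor_kernel A B = LinearCombinations.module.span class_ring (monoid_algebra (A \<times>\<times> B)) (tensor_relators A B)"

definition tensor_algebra ::
  "('k::field, 'a) module \<Rightarrow> ('k, 'b) module \<Rightarrow> ('k, ('a \<times> 'b \<Rightarrow>\<^sub>0 'k) set) module" where
  "tensor_algebra A B = quotient_algebra (monoid_algebra (A \<times>\<times> B)) (tensor_kernel A B)"

definition pure_tensor ::
  "('k::field, 'a) module \<Rightarrow> ('k, 'b) module \<Rightarrow> 'a \<Rightarrow> 'b \<Rightarrow> ('a \<times> 'b \<Rightarrow>\<^sub>0 'k) set" where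
  "pure_tensor A B a b =
     tensor_kernel A B +>\<^bsub>monoid_algebra (A \<times>\<times> B)\<^esub> Poly_Mapping.single (a, b) 1"

(* The linear map into C with a \<otimes> b \<mapsto> \<phi> a b, for bilinear \<phi>; the image below is then a singleton. *)

definition tensor_lift ::
  "('k::field, 'c) module \<Rightarrow> ('a \<Rightarrow> 'b \<Rightarrow> 'c) \<Rightarrow> ('a \<times> 'b \<Rightarrow>\<^sub>0 'k) set \<Rightarrow> 'c" where
  "tensor_lift C \<phi> X =
     the_elem ((\<lambda>p. \<Oplus>\<^bsub>C\<^esub>z\<in>Poly_Mapping.keys p. Poly_Mapping.lookup p z \<odot>\<^bsub>C\<^esub> \<phi> (fst z) (snd z)) ` X)"

definition tensor_map ::
  "('k::field, 'c) module \<Rightarrow> ('k, 'd) module \<Rightarrow> ('a \<Rightarrow> 'c) \<Rightarrow> ('b \<Rightarrow> 'd) \<Rightarrow>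
   ('a \<times> 'b \<Rightarrow>\<^sub>0 'k) set \<Rightarrow> ('c \<times> 'd \<Rightarrow>\<^sub>0 'k) set" where
  "tensor_map C D f g = tensor_lift (tensor_algebra C D) (\<lambda>a b. pure_tensor C D (f a) (g b))"

definition tensor_assoc ::
  "('k::field, 'a) module \<Rightarrow> ('k, 'b) module \<Rightarrow> ('k, 'c) module \<Rightarrow>
   (('a \<times> 'b \<Rightarrow>\<^sub>0 'k) set \<times> 'c \<Rightarrow>\<^sub>0 'k) set \<Rightarrow> ('a \<times> ('b \<times> 'c \<Rightarrow>\<^sub>0 'k) set \<Rightarrow>\<^sub>0 'k) set" where
  "tensor_assoc A B C =
     tensor_lift (tensor_algebra A (tensor_algebra B C))
       (\<lambda>x c. tensor_lift (tensor_algebra A (tensor_algebra B C))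
          (\<lambda>a b. pure_tensor A (tensor_algebra B C) a (pure_tensor B C b c)) x)"


section \<open>Hopf algebras\<close>

definition coalgebra ::
  "('k::field, 'a) module \<Rightarrow> ('a \<Rightarrow> ('a \<times> 'a \<Rightarrow>\<^sub>0 'k) set) \<Rightarrow> ('a \<Rightarrow> 'k) \<Rightarrow> bool" where
  "coalgebra A \<Delta> \<epsilon> \<longleftrightarrow>
     \<Delta> \<in> lin_hom A (tensor_algebra A A) \<and>
     \<epsilon> \<in> lin_hom A ground_algebra \<and>
     (\<forall>x\<in>carrier A.
        tensor_assoc A A A (tensor_map (tensor_algebra A A) A \<Delta> (\<lambda>a. a) (\<Delta> x))
          = tensor_map A (tensor_algebra A A) (\<lambda>a. a) \<Delta> (\<Delta> x) \<and>
        tensor_map ground_algebra A \<epsilon> (\<lambda>a. a) (\<Delta> x) = pure_tensor ground_algebra A 1 x \<and>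
        tensor_map A ground_algebra (\<lambda>a. a) \<epsilon> (\<Delta> x) = pure_tensor A ground_algebra x 1)"

definition bialgebra ::
  "('k::field, 'a) module \<Rightarrow> ('a \<Rightarrow> ('a \<times> 'a \<Rightarrow>\<^sub>0 'k) set) \<Rightarrow> ('a \<Rightarrow> 'k) \<Rightarrow> bool" where
  "bialgebra A \<Delta> \<epsilon> \<longleftrightarrow>
     assoc_algebra A \<and> coalgebra A \<Delta> \<epsilon> \<and>
     \<Delta> \<in> algebra_hom A (tensor_algebra A A) \<and> \<epsilon> \<in> algebra_hom A ground_algebra"

definition hopf_algebra ::
  "('k::field, 'a) module \<Rightarrow> ('a \<Rightarrow> ('a \<times> 'a \<Rightarrow>\<^sub>0 'k) set) \<Rightarrow> ('a \<Rightarrow> 'k) \<Rightarrow> ('a \<Rightarrow> 'a) \<Rightarrow> bool" where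
  "hopf_algebra A \<Delta> \<epsilon> S \<longleftrightarrow>
     bialgebra A \<Delta> \<epsilon> \<and> S \<in> lin_hom A A \<and>
     (\<forall>x\<in>carrier A.
        tensor_lift A (mult A) (tensor_map A A S (\<lambda>a. a) (\<Delta> x)) = \<epsilon> x \<odot>\<^bsub>A\<^esub> \<one>\<^bsub>A\<^esub> \<and>
        tensor_lift A (mult A) (tensor_map A A (\<lambda>a. a) S (\<Delta> x)) = \<epsilon> x \<odot>\<^bsub>A\<^esub> \<one>\<^bsub>A\<^esub>)"


section \<open>The algebra of a pair of multilinear forms\<close>

(* x \<alpha> \<beta> stands for the element with upper index \<alpha> and lower index \<beta>;
   the result is the product of the x \<alpha>\<^sub>i \<beta>\<^sub>i in the order of the lists. *)

definition index_word ::
  "('k, 'a) module \<Rightarrow> (nat \<Rightarrow> nat \<Rightarrow> 'a) \<Rightarrow> nat list \<Rightarrow> nat list \<Rightarrow> 'a" where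
  "index_word A x \<alpha>s \<beta>s = foldr (mult A) (map2 x \<alpha>s \<beta>s) \<one>\<^bsub>A\<^esub>"

definition form_gens :: "nat \<Rightarrow> (nat \<times> nat) set" where
  "form_gens s = {0..s} \<times> {0..s}"

definition form_relators ::
  "nat \<Rightarrow> nat \<Rightarrow> (nat list \<Rightarrow> 'k::field) \<Rightarrow> (nat list \<Rightarrow> 'k) \<Rightarrow> ((nat \<times> nat) list \<Rightarrow>\<^sub>0 'k) set" where
  "form_relators s m W W' =
     (let F = free_algebra (form_gens s); x = (\<lambda>\<alpha> \<beta>. Poly_Mapping.single [(\<alpha>, \<beta>)] 1) in
       {(\<Oplus>\<^bsub>F\<^esub>\<alpha>s\<in>multi_indices s m. W \<alpha>s \<odot>\<^bsub>F\<^esub> index_word F x \<alpha>s \<beta>s)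
          \<ominus>\<^bsub>F\<^esub> W \<beta>s \<odot>\<^bsub>F\<^esub> \<one>\<^bsub>F\<^esub> | \<beta>s. \<beta>s \<in> multi_indices s m} \<union>
       {(\<Oplus>\<^bsub>F\<^esub>\<beta>s\<in>multi_indices s m. W' \<beta>s \<odot>\<^bsub>F\<^esub> index_word F x \<alpha>s \<beta>s)
          \<ominus>\<^bsub>F\<^esub> W' \<alpha>s \<odot>\<^bsub>F\<^esub> \<one>\<^bsub>F\<^esub> | \<alpha>s. \<alpha>s \<in> multi_indices s m})"

definition form_algebra ::
  "nat \<Rightarrow> nat \<Rightarrow> (nat list \<Rightarrow> 'k::field) \<Rightarrow> (nat list \<Rightarrow> 'k) \<Rightarrow>
   ('k, ((nat \<times> nat) list \<Rightarrow>\<^sub>0 'k) set) module" where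
  "form_algebra s m W W' = presented_algebra (form_gens s) (form_relators s m W W')"

definition form_gen ::
  "nat \<Rightarrow> nat \<Rightarrow> (nat list \<Rightarrow> 'k::field) \<Rightarrow> (nat list \<Rightarrow> 'k) \<Rightarrow>
   nat \<Rightarrow> nat \<Rightarrow> ((nat \<times> nat) list \<Rightarrow>\<^sub>0 'k) set" where
  "form_gen s m W W' \<alpha> \<beta> = presented_gen (form_gens s) (form_relators s m W W') (\<alpha>, \<beta>)"

end

(* The matrix v of prospective antipode values is a two-sided inverse of the matrix u of generators:
   v u = 1 uses the relations of W, u v = 1 those of W', and both use the duality of W and W'.  Hence
   the matrix P of words of length n in u has the inverse Q of words in v with the factors reversed,
   and W P = W, P W' = W' turn into W Q = W, Q W' = W', so u |-> v respects the defining relations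
   in the opposite algebra.  All Hopf algebra axioms are linear in their argument and the words span
   the algebra, so it suffices to check them on P, where they read Delta(P) = P (x) P,
   epsilon(P) = 1, S(P) = Q.  The antipode is unique because S(P) P = 1 forces S(P) = Q. *)

theory Submission
  imports Defs
begin

text \<open>The axioms ask an antipode only to be linear, and \<open>tensor_map\<close> and
  \<open>tensor_assoc\<close> are shown only to be linear, so agreement on generators would not give
  agreement on the algebra. This is why words of every length n are treated together: for fixed n
  they form one matrix \<open>P\<close>, and the entries of these matrices span. The three structure
  maps come from the universal property of the presentation, applied to three matrices that satisfy
  the defining relations: \<open>\<Delta>gen\<close> over the tensor square, the identity matrix
  over the ground field, and \<open>v\<close> over the opposite algebra. The formula for
  \<open>v\<close> is forced by the relations: splitting the last factor u off the words in W P = W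
  and contracting with W' leaves v u = 1 by duality. The same expression, multiplied by u from the
  left, meets the relation of W' instead. A separate obstacle is the tensor product. It is a
  quotient by a linear span, so this span has to be shown to be an ideal before the product of the
  tensor algebra can be used at all.\<close>

section \<open>Linear algebra\<close>

text \<open>Scalars range over a whole type, so wrapping \<open>module class_ring V\<close> strips
  all carrier conditions on scalars from the module laws.\<close>

locale k_module =
  fixes V :: "('k::field, 'v) module" (structure)
  assumes is_module: "module class_ring V"
begin

sublocale abelian_group V
  using is_module by (simp add: Module.module_def)

lemma smult_closed [simp, intro]: "x \<in> carrier V \<Longrightarrow> c \<odot> x \<in> carrier V"
  using module.smult_closed[OF is_module] by simp

lemma smult_l_distr: "x \<in> carrier V \<Longrightarrow> (a + b) \<odot> x = a \<odot> x \<oplus> b \<odot> x"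
  using module.smult_l_distr[OF is_module] by simp

lemma smult_r_distr:
  "\<lbrakk>x \<in> carrier V; y \<in> carrier V\<rbrakk> \<Longrightarrow> a \<odot> (x \<oplus> y) = a \<odot> x \<oplus> a \<odot> y"
  using module.smult_r_distr[OF is_module] by simp

lemma smult_smult: "x \<in> carrier V \<Longrightarrow> a \<odot> (b \<odot> x) = (a * b) \<odot> x"
  using module.smult_assoc1[OF is_module] by simp

lemma smult_one [simp]: "x \<in> carrier V \<Longrightarrow> 1 \<odot> x = x"
  using module.smult_one[OF is_module] by simp

lemma smult_zero_left [simp]: "x \<in> carrier V \<Longrightarrow> 0 \<odot> x = \<zero>"
  using module.smult_l_null[OF is_module] by simp

lemma smult_zero_right [simp]: "c \<odot> \<zero> = \<zero>"
  using module.smult_r_null[OF is_module] by simp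

lemma smult_minus_one: "x \<in> carrier V \<Longrightarrow> (- 1) \<odot> x = \<ominus> x"
  using smult_l_distr[of x "- 1" 1] by (simp add: minus_equality[symmetric])

lemma smult_finsum:
  assumes "f \<in> A \<rightarrow> carrier V"
  shows "c \<odot> (\<Oplus>i\<in>A. f i) = (\<Oplus>i\<in>A. c \<odot> f i)"
  using assms
proof (induction A rule: infinite_finite_induct)
  case (insert x A)
  then show ?case by (simp add: Pi_def smult_r_distr)
qed simp_all

lemma finsum_smult:
  assumes "x \<in> carrier V"
  shows "(\<Oplus>i\<in>A. c i \<odot> x) = (\<Sum>i\<in>A. c i) \<odot> x"
proof (induction A rule: infinite_finite_induct)
  case (insert a A)
  then show ?case using assms by (simp add: Pi_def smult_l_distr)
qed (use assms in simp_all)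

lemma finsum_swap:
  assumes "finite A" "finite B" "\<And>i j. i \<in> A \<Longrightarrow> j \<in> B \<Longrightarrow> f i j \<in> carrier V"
  shows "(\<Oplus>i\<in>A. \<Oplus>j\<in>B. f i j) = (\<Oplus>j\<in>B. \<Oplus>i\<in>A. f i j)"
  using assms(1,3)
proof (induction A)
  case (insert a A)
  have "(\<Oplus>i\<in>insert a A. \<Oplus>j\<in>B. f i j) = (\<Oplus>j\<in>B. f a j) \<oplus> (\<Oplus>j\<in>B. \<Oplus>i\<in>A. f i j)"
    using insert by (simp add: Pi_def)
  also have "\<dots> = (\<Oplus>j\<in>B. f a j \<oplus> (\<Oplus>i\<in>A. f i j))"
    by (rule finsum_addf[symmetric]) (use insert in \<open>auto simp: Pi_def intro!: finsum_closed\<close>)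
  also have "\<dots> = (\<Oplus>j\<in>B. \<Oplus>i\<in>insert a A. f i j)"
    by (rule finsum_cong') (use insert in \<open>auto simp: Pi_def intro!: finsum_closed\<close>)
  finally show ?case .
qed simp

text \<open>The Kronecker delta stands in the scalar because the inverse matrix identities and the
  counit produce it in this shape.\<close>

lemma finsum_delta:
  assumes "finite A" "a \<in> A" "f \<in> A \<rightarrow> carrier V"
  shows "(\<Oplus>i\<in>A. (if i = a then 1 else 0) \<odot> f i) = f a"
proof -
  have "(\<Oplus>i\<in>A. (if i = a then 1 else 0) \<odot> f i) = (\<Oplus>i\<in>A. if a = i then f i else \<zero>)"
    by (rule finsum_cong') (use assms in \<open>auto simp: Pi_def\<close>)
  then show ?thesis using assms add.finprod_singleton[of a A f] by simp
qed

lemma finsum_product: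
  assumes "finite A" "finite B" "f \<in> A \<times> B \<rightarrow> carrier V"
  shows "(\<Oplus>i\<in>A. \<Oplus>j\<in>B. f (i, j)) = (\<Oplus>z\<in>A \<times> B. f z)"
  using assms(1,3)
proof (induction A)
  case (insert a A)
  have eq: "insert a A \<times> B = Pair a ` B \<union> A \<times> B" by auto
  have "(\<Oplus>z\<in>insert a A \<times> B. f z) = (\<Oplus>z\<in>Pair a ` B. f z) \<oplus> (\<Oplus>z\<in>A \<times> B. f z)"
    unfolding eq by (rule finsum_Un_disjoint) (use insert assms in auto)
  also have "(\<Oplus>z\<in>Pair a ` B. f z) = (\<Oplus>j\<in>B. f (a, j))"
    by (rule finsum_reindex) (use insert in \<open>auto simp: inj_on_def\<close>)
  finally show ?case using insert assms(2) by (auto simp: Pi_def finsum_closed)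
qed simp

end

lemma lin_homI:
  assumes "\<And>x. x \<in> carrier V \<Longrightarrow> f x \<in> carrier W"
    and "\<And>x y. \<lbrakk>x \<in> carrier V; y \<in> carrier V\<rbrakk> \<Longrightarrow> f (x \<oplus>\<^bsub>V\<^esub> y) = f x \<oplus>\<^bsub>W\<^esub> f y"
    and "\<And>c x. x \<in> carrier V \<Longrightarrow> f (c \<odot>\<^bsub>V\<^esub> x) = c \<odot>\<^bsub>W\<^esub> f x"
  shows "f \<in> lin_hom V W"
  using assms by (auto simp: LinearCombinations.module_hom_def)

lemma lin_hom_closed: "\<lbrakk>f \<in> lin_hom V W; x \<in> carrier V\<rbrakk> \<Longrightarrow> f x \<in> carrier W"
  by (auto simp: LinearCombinations.module_hom_def)

lemma lin_hom_add:
  "\<lbrakk>f \<in> lin_hom V W; x \<in> carrier V; y \<in> carrier V\<rbrakk> \<Longrightarrow> f (x \<oplus>\<^bsub>V\<^esub> y) = f x \<oplus>\<^bsub>W\<^esub> f y"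
  by (auto simp: LinearCombinations.module_hom_def)

lemma lin_hom_smult: "\<lbrakk>f \<in> lin_hom V W; x \<in> carrier V\<rbrakk> \<Longrightarrow> f (c \<odot>\<^bsub>V\<^esub> x) = c \<odot>\<^bsub>W\<^esub> f x"
  by (auto simp: LinearCombinations.module_hom_def)

lemma lin_hom_zero:
  assumes "k_module V" "k_module W" "f \<in> lin_hom V W"
  shows "f \<zero>\<^bsub>V\<^esub> = \<zero>\<^bsub>W\<^esub>"
proof -
  interpret V: k_module V by fact
  interpret W: k_module W by fact
  have "f (0 \<odot>\<^bsub>V\<^esub> \<zero>\<^bsub>V\<^esub>) = 0 \<odot>\<^bsub>W\<^esub> f \<zero>\<^bsub>V\<^esub>" by (rule lin_hom_smult) (use assms in auto)
  then show ?thesis using lin_hom_closed[OF assms(3)] by simp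
qed

lemma lin_hom_finsum:
  assumes "k_module V" "k_module W" "f \<in> lin_hom V W" "g \<in> A \<rightarrow> carrier V"
  shows "f (\<Oplus>\<^bsub>V\<^esub>i\<in>A. g i) = (\<Oplus>\<^bsub>W\<^esub>i\<in>A. f (g i))"
proof -
  interpret V: k_module V by fact
  interpret W: k_module W by fact
  show ?thesis using assms(4)
  proof (induction A rule: infinite_finite_induct)
    case (insert a A)
    then show ?case
      using lin_hom_closed[OF assms(3)]
      by (simp add: Pi_def lin_hom_add[OF assms(3)])
  qed (simp_all add: lin_hom_zero[OF assms(1,2,3)])
qed

lemma lin_hom_id: "(\<lambda>x. x) \<in> lin_hom V V"
  by (simp add: LinearCombinations.module_hom_def)

lemma lin_hom_comp: "\<lbrakk>f \<in> lin_hom V W; g \<in> lin_hom U V\<rbrakk> \<Longrightarrow> (\<lambda>x. f (g x)) \<in> lin_hom U W"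
  by (rule lin_homI) (simp_all add: lin_hom_closed lin_hom_add lin_hom_smult)

text \<open>Linearity looks only at the carrier. This permits replacing a map by its restriction, or
  by a formula valid on the carrier alone.\<close>

lemma lin_hom_cong:
  assumes "k_module V" "f \<in> lin_hom V W" "\<And>x. x \<in> carrier V \<Longrightarrow> f x = g x"
  shows "g \<in> lin_hom V W"
proof -
  interpret V: k_module V by fact
  show ?thesis
    by (rule lin_homI)
      (use assms(2) in \<open>simp_all add: assms(3)[symmetric] lin_hom_closed lin_hom_add lin_hom_smult\<close>)
qed

lemma finsum_lin_hom:
  assumes "k_module V" "k_module W" "\<And>i. i \<in> A \<Longrightarrow> f i \<in> lin_hom V W"
  shows "(\<lambda>x. \<Oplus>\<^bsub>W\<^esub>i\<in>A. f i x) \<in> lin_hom V W"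
proof -
  interpret V: k_module V by fact
  interpret W: k_module W by fact
  have [simp]: "(\<lambda>i. f i x) \<in> A \<rightarrow> carrier W" if "x \<in> carrier V" for x
    using lin_hom_closed[OF assms(3) that] by simp
  show ?thesis
  proof (rule lin_homI)
    fix x y assume xy: "x \<in> carrier V" "y \<in> carrier V"
    have "(\<Oplus>\<^bsub>W\<^esub>i\<in>A. f i (x \<oplus>\<^bsub>V\<^esub> y)) = (\<Oplus>\<^bsub>W\<^esub>i\<in>A. f i x \<oplus>\<^bsub>W\<^esub> f i y)"
      by (rule W.finsum_cong') (use xy lin_hom_closed[OF assms(3)] lin_hom_add[OF assms(3)] in auto)
    then show "(\<Oplus>\<^bsub>W\<^esub>i\<in>A. f i (x \<oplus>\<^bsub>V\<^esub> y)) = (\<Oplus>\<^bsub>W\<^esub>i\<in>A. f i x) \<oplus>\<^bsub>W\<^esub> (\<Oplus>\<^bsub>W\<^esub>i\<in>A. f i y)"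
      using xy by (simp add: W.finsum_addf)
  next
    fix c x assume x: "x \<in> carrier V"
    have "(\<Oplus>\<^bsub>W\<^esub>i\<in>A. f i (c \<odot>\<^bsub>V\<^esub> x)) = (\<Oplus>\<^bsub>W\<^esub>i\<in>A. c \<odot>\<^bsub>W\<^esub> f i x)"
      by (rule W.finsum_cong') (use x lin_hom_closed[OF assms(3)] lin_hom_smult[OF assms(3)] in auto)
    then show "(\<Oplus>\<^bsub>W\<^esub>i\<in>A. f i (c \<odot>\<^bsub>V\<^esub> x)) = c \<odot>\<^bsub>W\<^esub> (\<Oplus>\<^bsub>W\<^esub>i\<in>A. f i x)"
      using x by (simp add: W.smult_finsum)
  qed simp
qed

lemma smult_lin_hom:
  assumes "k_module W" "f \<in> lin_hom V W"
  shows "(\<lambda>x. c \<odot>\<^bsub>W\<^esub> f x) \<in> lin_hom V W"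
proof -
  interpret W: k_module W by fact
  show ?thesis
    by (rule lin_homI)
      (use assms(2) in \<open>auto simp: lin_hom_closed lin_hom_add lin_hom_smult W.smult_r_distr
        W.smult_smult mult.commute\<close>)
qed

section \<open>Bilinear maps\<close>

definition bilinear_map ::
  "('k::field, 'a) module \<Rightarrow> ('k, 'b) module \<Rightarrow> ('k, 'c) module \<Rightarrow> ('a \<Rightarrow> 'b \<Rightarrow> 'c) \<Rightarrow> bool" where
  "bilinear_map A B C \<phi> \<longleftrightarrow>
     (\<forall>a\<in>carrier A. \<phi> a \<in> lin_hom B C) \<and> (\<forall>b\<in>carrier B. (\<lambda>a. \<phi> a b) \<in> lin_hom A C)"

lemma bilinear_mapI:
  assumes "\<And>a. a \<in> carrier A \<Longrightarrow> (\<lambda>b. \<phi> a b) \<in> lin_hom B C"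
    and "\<And>b. b \<in> carrier B \<Longrightarrow> (\<lambda>a. \<phi> a b) \<in> lin_hom A C"
  shows "bilinear_map A B C \<phi>"
  using assms by (simp add: bilinear_map_def)

lemma bilinear_map_right: "\<lbrakk>bilinear_map A B C \<phi>; a \<in> carrier A\<rbrakk> \<Longrightarrow> (\<lambda>b. \<phi> a b) \<in> lin_hom B C"
  by (simp add: bilinear_map_def)

lemma bilinear_map_left: "\<lbrakk>bilinear_map A B C \<phi>; b \<in> carrier B\<rbrakk> \<Longrightarrow> (\<lambda>a. \<phi> a b) \<in> lin_hom A C"
  by (simp add: bilinear_map_def)

lemma bilinear_map_closed:
  "\<lbrakk>bilinear_map A B C \<phi>; a \<in> carrier A; b \<in> carrier B\<rbrakk> \<Longrightarrow> \<phi> a b \<in> carrier C"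
  by (metis bilinear_map_left lin_hom_closed)

lemma bilinear_map_comp:
  assumes "bilinear_map A B C \<phi>" "f \<in> lin_hom A' A" "g \<in> lin_hom B' B"
  shows "bilinear_map A' B' C (\<lambda>a b. \<phi> (f a) (g b))"
proof (rule bilinear_mapI)
  show "(\<lambda>b. \<phi> (f a) (g b)) \<in> lin_hom B' C" if "a \<in> carrier A'" for a
    by (rule lin_hom_comp[OF bilinear_map_right[OF assms(1)] assms(3)])
      (use lin_hom_closed[OF assms(2) that] in simp)
  show "(\<lambda>a. \<phi> (f a) (g b)) \<in> lin_hom A' C" if "b \<in> carrier B'" for b
    by (rule lin_hom_comp[OF bilinear_map_left[OF assms(1)] assms(2)])
      (use lin_hom_closed[OF assms(3) that] in simp)
qed

lemma lin_hom_bilinear_map: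
  assumes "bilinear_map A B C \<phi>" "f \<in> lin_hom C D"
  shows "bilinear_map A B D (\<lambda>a b. f (\<phi> a b))"
  by (rule bilinear_mapI; rule lin_hom_comp[OF assms(2)])
    (use assms(1) in \<open>auto intro: bilinear_map_left bilinear_map_right\<close>)

section \<open>Associative algebras and their homomorphisms\<close>

lemma (in assoc_algebra) k_module: "k_module A"
  by (rule k_module.intro) (rule module)

sublocale assoc_algebra \<subseteq> ring A
  by (rule ring)

sublocale assoc_algebra \<subseteq> k_module A
  by (rule k_module)

lemma (in assoc_algebra) bilinear_mult: "bilinear_map A A A (\<otimes>)"
  by (rule bilinear_mapI; rule lin_homI)
    (auto simp: l_distr r_distr smult_mult_left smult_mult_right)

lemma algebra_homI:
  assumes "f \<in> lin_hom A B"
    and "\<And>x y. \<lbrakk>x \<in> carrier A; y \<in> carrier A\<rbrakk> \<Longrightarrow> f (x \<otimes>\<^bsub>A\<^esub> y) = f x \<otimes>\<^bsub>B\<^esub> f y"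
    and "f \<one>\<^bsub>A\<^esub> = \<one>\<^bsub>B\<^esub>"
  shows "f \<in> algebra_hom A B"
  unfolding algebra_hom_def using assms
  by (auto intro!: ring_hom_memI simp: lin_hom_closed lin_hom_add)

lemma algebra_hom_lin: "f \<in> algebra_hom A B \<Longrightarrow> f \<in> lin_hom A B"
  by (simp add: algebra_hom_def)

lemma algebra_hom_mult:
  "\<lbrakk>f \<in> algebra_hom A B; x \<in> carrier A; y \<in> carrier A\<rbrakk> \<Longrightarrow> f (x \<otimes>\<^bsub>A\<^esub> y) = f x \<otimes>\<^bsub>B\<^esub> f y"
  by (simp add: algebra_hom_def ring_hom_mult)

lemma algebra_hom_one: "f \<in> algebra_hom A B \<Longrightarrow> f \<one>\<^bsub>A\<^esub> = \<one>\<^bsub>B\<^esub>"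
  by (simp add: algebra_hom_def ring_hom_one)

lemma algebra_hom_cong:
  assumes "assoc_algebra A" "f \<in> algebra_hom A B" "\<And>x. x \<in> carrier A \<Longrightarrow> f x = g x"
  shows "g \<in> algebra_hom A B"
proof -
  interpret A: assoc_algebra A by fact
  show ?thesis
    by (rule algebra_homI[OF lin_hom_cong[OF A.k_module algebra_hom_lin[OF assms(2)] assms(3)]])
      (use assms(2) in \<open>simp_all add: assms(3)[symmetric] algebra_hom_mult algebra_hom_one\<close>)
qed

section \<open>The ground field as an algebra over itself\<close>

lemma ground_algebra_sel [simp]:
  "carrier ground_algebra = UNIV" "mult ground_algebra = (*)" "one ground_algebra = 1"
  "zero ground_algebra = 0" "add ground_algebra = (+)" "smult ground_algebra = (*)"
  by (simp_all add: ground_algebra_def)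

lemma assoc_algebra_ground: "assoc_algebra (ground_algebra :: ('k::field, 'k) module)"
proof -
  have ab: "abelian_group (ground_algebra :: ('k, 'k) module)"
    by (rule abelian_groupI) (auto simp: ac_simps add_eq_0_iff)
  show ?thesis
  proof (rule assoc_algebra.intro)
    have "monoid (ground_algebra :: ('k, 'k) module)"
      by (rule monoidI) (auto simp: mult.assoc)
    with ab show "ring (ground_algebra :: ('k, 'k) module)"
      by (intro ringI) (auto simp: distrib_left distrib_right)
    show "Module.module class_ring (ground_algebra :: ('k, 'k) module)"
      by (intro moduleI class_cring.is_cring ab) (auto simp: distrib_left distrib_right mult.assoc)
  qed (auto simp: ac_simps)
qed

lemma finsum_ground: "finsum ground_algebra f A = sum f A"
proof -
  interpret assoc_algebra "ground_algebra :: ('a, 'a) module" by (rule assoc_algebra_ground)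
  show ?thesis
    by (induction A rule: infinite_finite_induct) (auto simp: Pi_def)
qed

section \<open>Monoid algebras\<close>

text \<open>\<open>Poly_Mapping.map\<close> applies its function on the support only; off the
  support both sides vanish.\<close>

lemma lookup_map_mult [simp]:
  "Poly_Mapping.lookup (Poly_Mapping.map ((*) (c::'k::field)) p) x = c * Poly_Mapping.lookup p x"
  by (auto simp: Poly_Mapping.map.rep_eq when_def)

lemma monoid_algebra_sel [simp]:
  "carrier (monoid_algebra G) = {p. Poly_Mapping.keys p \<subseteq> carrier G}"
  "one (monoid_algebra G) = Poly_Mapping.single \<one>\<^bsub>G\<^esub> 1"
  "zero (monoid_algebra G) = 0" "add (monoid_algebra G) = (+)"
  "smult (monoid_algebra G) c p = Poly_Mapping.map ((*) c) p"
  by (simp_all add: monoid_algebra_def)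

lemma abelian_group_monoid_algebra: "abelian_group (monoid_algebra G :: ('k::field, 'g \<Rightarrow>\<^sub>0 'k) module)"
proof (rule abelian_groupI)
  fix x y :: "'g \<Rightarrow>\<^sub>0 'k"
  assume "x \<in> carrier (monoid_algebra G)" "y \<in> carrier (monoid_algebra G)"
  then show "x \<oplus>\<^bsub>monoid_algebra G\<^esub> y \<in> carrier (monoid_algebra G)"
    using Poly_Mapping.keys_add[of x y] by auto
next
  fix x :: "'g \<Rightarrow>\<^sub>0 'k" assume "x \<in> carrier (monoid_algebra G)"
  then show "\<exists>y\<in>carrier (monoid_algebra G). y \<oplus>\<^bsub>monoid_algebra G\<^esub> x = \<zero>\<^bsub>monoid_algebra G\<^esub>"
    by (intro bexI[of _ "- x"]) auto
qed (auto simp: ac_simps)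

lemma k_module_monoid_algebra: "k_module (monoid_algebra G)"
  by (intro k_module.intro moduleI class_cring.is_cring abelian_group_monoid_algebra)
    (auto simp: in_keys_iff lookup_add distrib_left distrib_right mult.assoc intro!: poly_mapping_eqI)

lemma monoid_algebra_induct [consumes 1, case_names zero add]:
  assumes "p \<in> carrier (monoid_algebra G)" "P 0"
    and "\<And>g c q. \<lbrakk>g \<in> carrier G; q \<in> carrier (monoid_algebra G); P q\<rbrakk>
          \<Longrightarrow> P (Poly_Mapping.single g c + q)"
  shows "P p"
  using assms(1)
proof (induction p rule: Poly_Mapping.update_induct)
  case (update p a b)
  \<comment> \<open>The updated key lies outside the support of \<open>p\<close>, so the update is
    the addition of a monomial.\<close>
  have eq: "Poly_Mapping.update a b p = Poly_Mapping.single a b + p"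
    using update(1) by (intro poly_mapping_eqI)
      (auto simp: Poly_Mapping.lookup_update lookup_add lookup_single in_keys_iff when_def)
  have "insert a (Poly_Mapping.keys p) \<subseteq> carrier G"
    using update(2,4) by (simp add: Poly_Mapping.keys_update)
  then show ?case unfolding eq using assms(3) update(3) by auto
qed (rule assms(2))

lemma monoid_algebra_single_smult:
  "Poly_Mapping.single g c = c \<odot>\<^bsub>monoid_algebra G\<^esub> Poly_Mapping.single g 1"
  by (simp add: Poly_Mapping.map_single)

lemma single_closed [simp]:
  "g \<in> carrier G \<Longrightarrow> Poly_Mapping.single g c \<in> carrier (monoid_algebra G)"
  by (auto simp: Poly_Mapping.keys_single)

text \<open>Monomials with coefficient 1 span. Multilinear identities are reduced to basis elements
  by applying this to one argument at a time.\<close>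

lemma lin_hom_monoid_algebra_eqI:
  assumes "k_module C" "f \<in> lin_hom (monoid_algebra G) C" "f' \<in> lin_hom (monoid_algebra G) C"
    and "\<And>g. g \<in> carrier G \<Longrightarrow> f (Poly_Mapping.single g 1) = f' (Poly_Mapping.single g 1)"
    and "p \<in> carrier (monoid_algebra G)"
  shows "f p = f' p"
  using assms(5)
proof (induction p rule: monoid_algebra_induct)
  case zero
  show ?case
    using lin_hom_zero[OF k_module_monoid_algebra assms(1,2)]
      lin_hom_zero[OF k_module_monoid_algebra assms(1,3)] by simp
next
  case (add g c q)
  have *: "h (Poly_Mapping.single g c + q) = c \<odot>\<^bsub>C\<^esub> h (Poly_Mapping.single g 1) \<oplus>\<^bsub>C\<^esub> h q"
    if "h \<in> lin_hom (monoid_algebra G) C" for h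
    using lin_hom_add[OF that single_closed[OF add(1), of c] add(2)]
      lin_hom_smult[OF that single_closed[OF add(1), of 1], of c]
    by (simp add: Poly_Mapping.map_single)
  show ?case unfolding *[OF assms(2)] *[OF assms(3)] using assms(4) add by simp
qed

text \<open>Linear extension of a map given on the basis. The sum over the support repeats the one
  inside \<open>tensor_lift\<close>, so maps out of tensor products become instances.\<close>

definition lin_ext :: "('k::field, 'c) module \<Rightarrow> ('g \<Rightarrow> 'c) \<Rightarrow> ('g \<Rightarrow>\<^sub>0 'k) \<Rightarrow> 'c" where
  "lin_ext C f p = (\<Oplus>\<^bsub>C\<^esub>g\<in>Poly_Mapping.keys p. Poly_Mapping.lookup p g \<odot>\<^bsub>C\<^esub> f g)"

text \<open>Supports change under addition and scaling. Padding with zero coefficients to a common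
  finite index set makes linearity a termwise matter.\<close>

lemma (in k_module) lin_ext_superset:
  assumes "finite K" "Poly_Mapping.keys p \<subseteq> K" "f \<in> K \<rightarrow> carrier V"
  shows "lin_ext V f p = (\<Oplus>g\<in>K. Poly_Mapping.lookup p g \<odot> f g)"
proof -
  have "(\<Oplus>g\<in>K. Poly_Mapping.lookup p g \<odot> f g)
      = (\<Oplus>g\<in>Poly_Mapping.keys p \<union> (K - Poly_Mapping.keys p). Poly_Mapping.lookup p g \<odot> f g)"
    using assms(2) by (simp add: Un_absorb1)
  also have "\<dots> = lin_ext V f p \<oplus> (\<Oplus>g\<in>K - Poly_Mapping.keys p. Poly_Mapping.lookup p g \<odot> f g)"
    unfolding lin_ext_def by (rule finsum_Un_disjoint) (use assms in auto)
  also have "(\<Oplus>g\<in>K - Poly_Mapping.keys p. Poly_Mapping.lookup p g \<odot> f g) = (\<Oplus>g\<in>K - Poly_Mapping.keys p. \<zero>)"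
    by (rule finsum_cong') (use assms in \<open>auto simp: in_keys_iff Pi_def\<close>)
  also have "lin_ext V f p \<in> carrier V"
    unfolding lin_ext_def by (rule finsum_closed) (use assms in auto)
  then have "lin_ext V f p \<oplus> (\<Oplus>g\<in>K - Poly_Mapping.keys p. \<zero>) = lin_ext V f p"
    by simp
  finally show ?thesis by simp
qed

lemma (in k_module) lin_ext_single:
  assumes "f g \<in> carrier V"
  shows "lin_ext V f (Poly_Mapping.single g c) = c \<odot> f g"
  using assms by (subst lin_ext_superset[of "{g}"]) auto

lemma (in k_module) lin_ext_lin_hom:
  fixes G :: "('g, 'm) monoid_scheme"
  assumes "f \<in> carrier G \<rightarrow> carrier V"
  shows "lin_ext V f \<in> lin_hom (monoid_algebra G) V"
proof (rule lin_homI)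
  fix p :: "'g \<Rightarrow>\<^sub>0 'k" assume p: "p \<in> carrier (monoid_algebra G)"
  then show "lin_ext V f p \<in> carrier V"
    unfolding lin_ext_def using assms by (intro finsum_closed) auto
  fix c
  have "lin_ext V f (c \<odot>\<^bsub>monoid_algebra G\<^esub> p)
      = (\<Oplus>g\<in>Poly_Mapping.keys p. c \<odot> (Poly_Mapping.lookup p g \<odot> f g))"
    using p assms
    by (subst lin_ext_superset[of "Poly_Mapping.keys p"])
      (auto simp: in_keys_iff Pi_def smult_smult intro!: finsum_cong')
  then show "lin_ext V f (c \<odot>\<^bsub>monoid_algebra G\<^esub> p) = c \<odot> lin_ext V f p"
    unfolding lin_ext_def using p assms by (subst smult_finsum) auto
next
  fix p q :: "'g \<Rightarrow>\<^sub>0 'k"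
  assume pq: "p \<in> carrier (monoid_algebra G)" "q \<in> carrier (monoid_algebra G)"
  let ?K = "Poly_Mapping.keys p \<union> Poly_Mapping.keys q"
  have f: "f \<in> ?K \<rightarrow> carrier V" using pq assms by auto
  have "lin_ext V f (p + q) = (\<Oplus>g\<in>?K. Poly_Mapping.lookup p g \<odot> f g \<oplus> Poly_Mapping.lookup q g \<odot> f g)"
    using f Poly_Mapping.keys_add[of p q]
    by (subst lin_ext_superset[of ?K])
      (simp_all, auto simp del: finsum_addf simp: lookup_add smult_l_distr Pi_def intro!: finsum_cong')
  also have "\<dots> = lin_ext V f p \<oplus> lin_ext V f q"
    using f by (subst finsum_addf) (auto simp: Pi_def lin_ext_superset[of ?K])
  finally show "lin_ext V f (p \<oplus>\<^bsub>monoid_algebra G\<^esub> q) = lin_ext V f p \<oplus> lin_ext V f q" by simp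
qed

text \<open>The same padding for the product, so that distributivity can be checked on sums with
  equal index sets.\<close>

lemma monoid_algebra_mult_superset:
  assumes "finite K" "finite L" "Poly_Mapping.keys p \<subseteq> K" "Poly_Mapping.keys q \<subseteq> L"
  shows "p \<otimes>\<^bsub>monoid_algebra G\<^esub> q = (\<Sum>x\<in>K. \<Sum>y\<in>L.
    Poly_Mapping.single (x \<otimes>\<^bsub>G\<^esub> y) (Poly_Mapping.lookup p x * Poly_Mapping.lookup q y))"
proof -
  have "p \<otimes>\<^bsub>monoid_algebra G\<^esub> q = (\<Sum>x\<in>Poly_Mapping.keys p. \<Sum>y\<in>L.
    Poly_Mapping.single (x \<otimes>\<^bsub>G\<^esub> y) (Poly_Mapping.lookup p x * Poly_Mapping.lookup q y))"
    unfolding monoid_algebra_def module.simps monoid.simps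
    by (intro sum.cong sum.mono_neutral_left) (use assms in \<open>auto simp: in_keys_iff\<close>)
  also have "\<dots> = (\<Sum>x\<in>K. \<Sum>y\<in>L.
    Poly_Mapping.single (x \<otimes>\<^bsub>G\<^esub> y) (Poly_Mapping.lookup p x * Poly_Mapping.lookup q y))"
    by (intro sum.mono_neutral_left) (use assms in \<open>auto simp: in_keys_iff\<close>)
  finally show ?thesis .
qed

lemma monoid_algebra_mult_single:
  "Poly_Mapping.single g a \<otimes>\<^bsub>monoid_algebra G\<^esub> Poly_Mapping.single h b
    = Poly_Mapping.single (g \<otimes>\<^bsub>G\<^esub> h) (a * b)"
  by (subst monoid_algebra_mult_superset[of "{g}" "{h}"]) auto

lemma map_mult_sum:
  "Poly_Mapping.map ((*) (c::'k::field)) (sum f A) = (\<Sum>i\<in>A. Poly_Mapping.map ((*) c) (f i))"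
  by (rule poly_mapping_eqI) (simp add: lookup_sum sum_distrib_left)

lemma bilinear_monoid_algebra_mult:
  assumes "monoid G"
  shows "bilinear_map (monoid_algebra G) (monoid_algebra G) (monoid_algebra G :: ('k::field, 'g \<Rightarrow>\<^sub>0 'k) module)
    (\<otimes>\<^bsub>monoid_algebra G\<^esub>)"
proof -
  interpret monoid G by fact
  let ?M = "monoid_algebra G :: ('k, 'g \<Rightarrow>\<^sub>0 'k) module"
  have closed: "p \<otimes>\<^bsub>?M\<^esub> q \<in> carrier ?M" if "p \<in> carrier ?M" "q \<in> carrier ?M" for p q
  proof -
    have "Poly_Mapping.keys (p \<otimes>\<^bsub>?M\<^esub> q) \<subseteq> (\<Union>x\<in>Poly_Mapping.keys p. \<Union>y\<in>Poly_Mapping.keys q.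
      Poly_Mapping.keys (Poly_Mapping.single (x \<otimes>\<^bsub>G\<^esub> y) (Poly_Mapping.lookup p x * Poly_Mapping.lookup q y)))"
      unfolding monoid_algebra_def module.simps monoid.simps
      by (rule order_trans[OF Poly_Mapping.keys_sum] UN_mono order_refl Poly_Mapping.keys_sum)+
    also have "\<dots> \<subseteq> carrier G" using that by (auto simp: subset_iff split: if_splits)
    finally show ?thesis by simp
  qed
  have smult_single: "Poly_Mapping.map ((*) c) (Poly_Mapping.single g a) = Poly_Mapping.single g (c * a)"
    for c a :: 'k and g :: 'g
    by (rule poly_mapping_eqI) (simp only: lookup_map_mult, simp add: lookup_single when_def)
  show ?thesis
  proof (rule bilinear_mapI; rule lin_homI)
    fix p q r assume *: "p \<in> carrier ?M" "q \<in> carrier ?M" "r \<in> carrier ?M"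
    let ?K = "Poly_Mapping.keys p" and ?L = "Poly_Mapping.keys q \<union> Poly_Mapping.keys r"
    show "p \<otimes>\<^bsub>?M\<^esub> (q \<oplus>\<^bsub>?M\<^esub> r) = p \<otimes>\<^bsub>?M\<^esub> q \<oplus>\<^bsub>?M\<^esub> p \<otimes>\<^bsub>?M\<^esub> r"
      using Poly_Mapping.keys_add[of q r]
      by (simp add: monoid_algebra_mult_superset[of ?K ?L] lookup_add distrib_left single_add sum.distrib)
    show "(q \<oplus>\<^bsub>?M\<^esub> r) \<otimes>\<^bsub>?M\<^esub> p = q \<otimes>\<^bsub>?M\<^esub> p \<oplus>\<^bsub>?M\<^esub> r \<otimes>\<^bsub>?M\<^esub> p"
      using Poly_Mapping.keys_add[of q r]
      by (simp add: monoid_algebra_mult_superset[of ?L ?K] lookup_add distrib_right single_add sum.distrib)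
  next
    fix p q c assume *: "p \<in> carrier ?M" "q \<in> carrier ?M"
    let ?K = "Poly_Mapping.keys p" and ?L = "Poly_Mapping.keys q"
    have L: "Poly_Mapping.keys (Poly_Mapping.map ((*) c) q) \<subseteq> ?L" by (auto simp: in_keys_iff)
    show "p \<otimes>\<^bsub>?M\<^esub> (c \<odot>\<^bsub>?M\<^esub> q) = c \<odot>\<^bsub>?M\<^esub> (p \<otimes>\<^bsub>?M\<^esub> q)"
      using L by (simp add: monoid_algebra_mult_superset[of ?K ?L] map_mult_sum smult_single mult.left_commute)
    show "(c \<odot>\<^bsub>?M\<^esub> q) \<otimes>\<^bsub>?M\<^esub> p = c \<odot>\<^bsub>?M\<^esub> (q \<otimes>\<^bsub>?M\<^esub> p)"
      using L by (simp add: monoid_algebra_mult_superset[of ?L ?K] map_mult_sum smult_single mult.assoc)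
  qed (rule closed; assumption)+
qed

lemma assoc_algebra_monoid_algebra:
  assumes "monoid G"
  shows "assoc_algebra (monoid_algebra G :: ('k::field, 'g \<Rightarrow>\<^sub>0 'k) module)"
proof -
  interpret G: monoid G by fact
  let ?M = "monoid_algebra G :: ('k, 'g \<Rightarrow>\<^sub>0 'k) module"
  interpret M: k_module ?M by (rule k_module_monoid_algebra)
  note bil = bilinear_monoid_algebra_mult[OF assms, where ?'k = 'k]
  note left = bilinear_map_left[OF bil] and right = bilinear_map_right[OF bil]
  note closed = bilinear_map_closed[OF bil]
  note eqI = lin_hom_monoid_algebra_eqI[OF M.k_module_axioms]
  \<comment> \<open>Both sides are linear in each of the three arguments, which leaves monomials,
    where associativity is that of \<open>G\<close>.\<close>
  have assoc: "(p \<otimes>\<^bsub>?M\<^esub> q) \<otimes>\<^bsub>?M\<^esub> r = p \<otimes>\<^bsub>?M\<^esub> (q \<otimes>\<^bsub>?M\<^esub> r)"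
    if "p \<in> carrier ?M" "q \<in> carrier ?M" "r \<in> carrier ?M" for p q r
  proof (rule eqI[OF lin_hom_comp[OF left left] left _ that(1)])
    fix g assume g: "g \<in> carrier G"
    note sg = single_closed[OF g, of "1::'k"]
    show "(Poly_Mapping.single g 1 \<otimes>\<^bsub>?M\<^esub> q) \<otimes>\<^bsub>?M\<^esub> r = Poly_Mapping.single g 1 \<otimes>\<^bsub>?M\<^esub> (q \<otimes>\<^bsub>?M\<^esub> r)"
    proof (rule eqI[OF lin_hom_comp[OF left right] lin_hom_comp[OF right left] _ that(2)])
      fix h assume h: "h \<in> carrier G"
      note sh = single_closed[OF h, of "1::'k"]
      show "(Poly_Mapping.single g 1 \<otimes>\<^bsub>?M\<^esub> Poly_Mapping.single h 1) \<otimes>\<^bsub>?M\<^esub> r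
        = Poly_Mapping.single g 1 \<otimes>\<^bsub>?M\<^esub> (Poly_Mapping.single h 1 \<otimes>\<^bsub>?M\<^esub> r)"
      proof (rule eqI[OF right lin_hom_comp[OF right right] _ that(3)])
        fix k assume k: "k \<in> carrier G"
        show "(Poly_Mapping.single g 1 \<otimes>\<^bsub>?M\<^esub> Poly_Mapping.single h 1) \<otimes>\<^bsub>?M\<^esub> Poly_Mapping.single k 1
          = Poly_Mapping.single g 1 \<otimes>\<^bsub>?M\<^esub> (Poly_Mapping.single h 1 \<otimes>\<^bsub>?M\<^esub> Poly_Mapping.single k (1::'k))"
          using g h k by (simp add: monoid_algebra_mult_single G.m_assoc)
      qed (use sg sh closed in blast)+
    qed (use sg that closed in blast)+
  qed (use that closed in blast)+
  have one: "Poly_Mapping.single \<one>\<^bsub>G\<^esub> 1 \<in> carrier ?M" by (rule single_closed) simp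
  have l_one: "\<one>\<^bsub>?M\<^esub> \<otimes>\<^bsub>?M\<^esub> p = p" if "p \<in> carrier ?M" for p
    by (rule eqI[OF right lin_hom_id _ that]) (use one in \<open>simp_all add: monoid_algebra_mult_single\<close>)
  have r_one: "p \<otimes>\<^bsub>?M\<^esub> \<one>\<^bsub>?M\<^esub> = p" if "p \<in> carrier ?M" for p
    by (rule eqI[OF left lin_hom_id _ that]) (use one in \<open>simp_all add: monoid_algebra_mult_single\<close>)
  show ?thesis
  proof (rule assoc_algebra.intro)
    show "ring ?M"
    proof (rule ringI)
      show "monoid ?M"
        by (rule monoidI) (use closed one assoc l_one r_one in \<open>simp_all del: monoid_algebra_sel(1)\<close>)
    qed (use lin_hom_add[OF left] lin_hom_add[OF right] M.abelian_group_axioms in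
        \<open>simp_all del: monoid_algebra_sel\<close>)
  qed (use M.is_module lin_hom_smult[OF left] lin_hom_smult[OF right] in
      \<open>simp_all del: monoid_algebra_sel\<close>)
qed

text \<open>Both sides of multiplicativity are bilinear in the two factors, so the assumption on
  pairs of monoid elements is enough.\<close>

lemma lin_ext_algebra_hom:
  fixes B :: "('k::field, 'b) module" and f :: "'g \<Rightarrow> 'b"
  assumes "monoid G" "assoc_algebra B" "f \<in> carrier G \<rightarrow> carrier B"
    and mult: "\<And>g h. \<lbrakk>g \<in> carrier G; h \<in> carrier G\<rbrakk> \<Longrightarrow> f (g \<otimes>\<^bsub>G\<^esub> h) = f g \<otimes>\<^bsub>B\<^esub> f h"
    and one: "f \<one>\<^bsub>G\<^esub> = \<one>\<^bsub>B\<^esub>"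
  shows "lin_ext B f \<in> algebra_hom (monoid_algebra G) B"
proof -
  interpret G: monoid G by fact
  interpret B: assoc_algebra B by fact
  let ?M = "monoid_algebra G :: ('k, 'g \<Rightarrow>\<^sub>0 'k) module"
  note lin = B.lin_ext_lin_hom[OF assms(3)]
  note bil = lin_hom_bilinear_map[OF bilinear_monoid_algebra_mult[OF assms(1)] lin]
  note bil' = bilinear_map_comp[OF B.bilinear_mult lin lin]
  have single: "lin_ext B f (Poly_Mapping.single g 1) = f g" if "g \<in> carrier G" for g
    using that assms(3) by (subst B.lin_ext_single) (auto simp: Pi_def)
  show ?thesis
  proof (rule algebra_homI[OF lin])
    fix p q assume p: "p \<in> carrier ?M" and q: "q \<in> carrier ?M"
    show "lin_ext B f (p \<otimes>\<^bsub>?M\<^esub> q) = lin_ext B f p \<otimes>\<^bsub>B\<^esub> lin_ext B f q"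
    proof (rule lin_hom_monoid_algebra_eqI[OF B.k_module
          bilinear_map_left[OF bil q] bilinear_map_left[OF bil' q] _ p])
      fix g assume g: "g \<in> carrier G"
      note sg = single_closed[OF g, of 1]
      show "lin_ext B f (Poly_Mapping.single g 1 \<otimes>\<^bsub>?M\<^esub> q)
          = lin_ext B f (Poly_Mapping.single g 1) \<otimes>\<^bsub>B\<^esub> lin_ext B f q"
        by (rule lin_hom_monoid_algebra_eqI[OF B.k_module
              bilinear_map_right[OF bil sg] bilinear_map_right[OF bil' sg] _ q])
          (simp add: g monoid_algebra_mult_single single mult)
    qed
  qed (simp add: single one)
qed

section \<open>Quotients and presentations\<close>

text \<open>\<open>quotient_algebra\<close> copies the fields of the factor ring into a module
  record, a different record type, so the ring laws have to be transported field by field.\<close>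

lemma ring_cong:
  assumes "ring R" "carrier S = carrier R" "mult S = mult R" "one S = one R"
    "zero S = zero R" "add S = add R"
  shows "ring S"
proof -
  interpret R: ring R by fact
  have "abelian_group S"
  proof (rule abelian_groupI)
    show "\<exists>y\<in>carrier S. y \<oplus>\<^bsub>S\<^esub> x = \<zero>\<^bsub>S\<^esub>" if "x \<in> carrier S" for x
      using that R.l_neg[of x] R.a_inv_closed[of x] unfolding assms(2-) by blast
  qed (simp_all add: assms(2-) R.a_ac)
  moreover have "monoid S"
    by (rule monoidI) (auto simp: assms(2-) R.m_assoc)
  ultimately show ?thesis
    by (rule ringI) (auto simp: assms(2-) R.l_distr R.r_distr)
qed

text \<open>The map induced on cosets. The image of a coset is a singleton when \<open>h\<close> is
  additive and vanishes on the ideal, in parallel to the definition of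
  \<open>tensor_lift\<close>.\<close>

definition quotient_lift :: "('a \<Rightarrow> 'c) \<Rightarrow> 'a set \<Rightarrow> 'c" where
  "quotient_lift h X = the_elem (h ` X)"

locale algebra_ideal = assoc_algebra A + ideal I A
  for A :: "('k::field, 'a) module" (structure) and I
begin

lemma coset_eqI:
  assumes "a \<in> carrier A" "b \<in> carrier A" "a \<ominus> b \<in> I"
  shows "I +> a = I +> b"
  using assms quotient_eq_iff_same_a_r_cos[OF is_ideal] by blast

lemma coset_minus_mem:
  assumes "a \<in> carrier A" "x \<in> I +> a"
  shows "x \<in> carrier A" "x \<ominus> a \<in> I"
proof -
  show x: "x \<in> carrier A" using assms a_elemrcos_carrier by blast
  show "x \<ominus> a \<in> I" using a_rcos_module_minus[OF ring_axioms assms(1) x] assms(2) by simp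
qed

text \<open>Scaling by c is multiplication by the element c times the unit, so a ring ideal is
  automatically a subspace.\<close>

lemma smult_ideal: "x \<in> I \<Longrightarrow> c \<odot> x \<in> I"
  using smult_mult_left[of \<one> x c] I_l_closed[of x "c \<odot> \<one>"] by (simp add: Icarr)

lemma quotient_sel:
  "carrier (quotient_algebra A I) = (\<lambda>x. I +> x) ` carrier A"
  "one (quotient_algebra A I) = I +> \<one>" "zero (quotient_algebra A I) = I"
  by (auto simp: quotient_algebra_def FactRing_def A_RCOSETS_def')

lemma quotient_mult:
  "\<lbrakk>a \<in> carrier A; b \<in> carrier A\<rbrakk>
    \<Longrightarrow> (I +> a) \<otimes>\<^bsub>quotient_algebra A I\<^esub> (I +> b) = I +> (a \<otimes> b)"
  by (simp add: quotient_algebra_def FactRing_def rcoset_mult_add)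

lemma quotient_add:
  "\<lbrakk>a \<in> carrier A; b \<in> carrier A\<rbrakk>
    \<Longrightarrow> (I +> a) \<oplus>\<^bsub>quotient_algebra A I\<^esub> (I +> b) = I +> (a \<oplus> b)"
  by (simp add: quotient_algebra_def FactRing_def a_rcos_sum)

lemma quotient_smult:
  assumes "a \<in> carrier A"
  shows "c \<odot>\<^bsub>quotient_algebra A I\<^esub> (I +> a) = I +> (c \<odot> a)"
proof -
  \<comment> \<open>Every representative gives the same coset, so the union in the definition of the
    scalar action collapses to a single one.\<close>
  have "I +> (c \<odot> x) = I +> (c \<odot> a)" if "x \<in> I +> a" for x
  proof (rule coset_eqI)
    note x = coset_minus_mem[OF assms that]
    show "c \<odot> x \<in> carrier A" "c \<odot> a \<in> carrier A" using x assms by auto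
    have "c \<odot> (x \<ominus> a) = c \<odot> x \<ominus> c \<odot> a"
      using x(1) assms
      by (simp add: minus_eq smult_r_distr smult_minus_one[symmetric] smult_smult mult.commute)
    then show "c \<odot> x \<ominus> c \<odot> a \<in> I" using smult_ideal[OF x(2), of c] by simp
  qed
  then have "(\<Union>x\<in>I +> a. I +> (c \<odot> x)) = (\<Union>x\<in>I +> a. I +> (c \<odot> a))"
    by simp
  moreover have "I +> a \<noteq> {}" using a_rcos_self[OF assms] by blast
  ultimately show ?thesis by (simp add: quotient_algebra_def)
qed

lemma assoc_algebra_quotient: "assoc_algebra (quotient_algebra A I)"
proof -
  let ?Q = "quotient_algebra A I"
  have ring: "ring ?Q"
    by (rule ring_cong[OF quotient_is_ring]) (simp_all add: quotient_algebra_def)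
  interpret Q: ring ?Q by (rule ring)
  show ?thesis
  proof (rule assoc_algebra.intro)
    show "Module.module class_ring ?Q"
      by (intro moduleI class_cring.is_cring Q.is_abelian_group)
        (auto simp: quotient_sel quotient_add quotient_smult smult_l_distr smult_r_distr smult_smult)
  qed (use ring in \<open>auto simp: quotient_sel quotient_mult quotient_smult smult_mult_left smult_mult_right\<close>)
qed

lemma quotient_hom: "(\<lambda>x. I +> x) \<in> algebra_hom A (quotient_algebra A I)"
  by (intro algebra_homI lin_homI)
    (auto simp: quotient_sel quotient_mult quotient_smult quotient_add)

lemma quotient_lift_coset:
  assumes "k_module C" "h \<in> lin_hom A C" "\<And>x. x \<in> I \<Longrightarrow> h x = \<zero>\<^bsub>C\<^esub>" "a \<in> carrier A"
  shows "quotient_lift h (I +> a) = h a"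
proof -
  interpret C: k_module C by fact
  have "h x = h a" if "x \<in> I +> a" for x
  proof -
    note x = coset_minus_mem[OF assms(4) that]
    have "x = (x \<ominus> a) \<oplus> a"
      using x(1) assms(4) by (simp add: minus_eq a_assoc l_neg)
    then have "h x = h (x \<ominus> a) \<oplus>\<^bsub>C\<^esub> h a"
      using lin_hom_add[OF assms(2), of "x \<ominus> a" a] x(1) assms(4) by simp
    then show ?thesis using assms(3)[OF x(2)] lin_hom_closed[OF assms(2,4)] by simp
  qed
  then have "h ` (I +> a) = (\<lambda>_. h a) ` (I +> a)" by (rule image_cong[OF refl])
  also have "\<dots> = {h a}" using a_rcos_self[OF assms(4)] by blast
  finally have "h ` (I +> a) = {h a}" .
  then show ?thesis by (simp add: quotient_lift_def)
qed

lemma quotient_lift_lin_hom: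
  assumes "k_module C" "h \<in> lin_hom A C" "\<And>x. x \<in> I \<Longrightarrow> h x = \<zero>\<^bsub>C\<^esub>"
  shows "quotient_lift h \<in> lin_hom (quotient_algebra A I) C"
  by (rule lin_homI)
    (auto simp: quotient_sel quotient_add quotient_smult quotient_lift_coset[OF assms]
      lin_hom_closed[OF assms(2)] lin_hom_add[OF assms(2)] lin_hom_smult[OF assms(2)])

lemma quotient_lift_algebra_hom:
  assumes "k_module C" "h \<in> algebra_hom A C" "\<And>x. x \<in> I \<Longrightarrow> h x = \<zero>\<^bsub>C\<^esub>"
  shows "quotient_lift h \<in> algebra_hom (quotient_algebra A I) C"
  by (rule algebra_homI[OF quotient_lift_lin_hom[OF assms(1) algebra_hom_lin[OF assms(2)] assms(3)]])
    (auto simp: quotient_sel quotient_mult quotient_lift_coset[OF assms(1) algebra_hom_lin[OF assms(2)] assms(3)]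
      algebra_hom_mult[OF assms(2)] algebra_hom_one[OF assms(2)])

end

lemma algebra_hom_foldr:
  assumes "assoc_algebra A" "h \<in> algebra_hom A B" "set xs \<subseteq> carrier A"
  shows "h (foldr (\<otimes>\<^bsub>A\<^esub>) xs \<one>\<^bsub>A\<^esub>) = foldr (\<otimes>\<^bsub>B\<^esub>) (map h xs) \<one>\<^bsub>B\<^esub>"
proof -
  interpret A: assoc_algebra A by fact
  have "foldr (\<otimes>\<^bsub>A\<^esub>) xs \<one>\<^bsub>A\<^esub> \<in> carrier A \<and> h (foldr (\<otimes>\<^bsub>A\<^esub>) xs \<one>\<^bsub>A\<^esub>) = foldr (\<otimes>\<^bsub>B\<^esub>) (map h xs) \<one>\<^bsub>B\<^esub>"
    using assms(3) by (induction xs) (auto simp: algebra_hom_mult[OF assms(2)] algebra_hom_one[OF assms(2)])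
  then show ?thesis ..
qed

section \<open>Free algebras and presentations\<close>

lemma free_monoid_sel [simp]:
  "carrier (free_monoid X) = lists X" "mult (free_monoid X) = (@)" "one (free_monoid X) = []"
  by (simp_all add: free_monoid_def)

lemma monoid_free_monoid: "monoid (free_monoid X)"
  by (rule monoidI) auto

lemma assoc_algebra_free: "assoc_algebra (free_algebra X)"
  unfolding free_algebra_def by (rule assoc_algebra_monoid_algebra[OF monoid_free_monoid])

text \<open>Evaluation of noncommutative polynomials at the family \<open>x\<close>.\<close>

definition free_lift :: "('k::field, 'b) module \<Rightarrow> ('x \<Rightarrow> 'b) \<Rightarrow> ('x list \<Rightarrow>\<^sub>0 'k) \<Rightarrow> 'b" where
  "free_lift B x = lin_ext B (\<lambda>w. foldr (\<otimes>\<^bsub>B\<^esub>) (map x w) \<one>\<^bsub>B\<^esub>)"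

context assoc_algebra
begin

lemma foldr_mult_closed: "set xs \<subseteq> carrier A \<Longrightarrow> foldr (\<otimes>) xs \<one> \<in> carrier A"
  by (induction xs) auto

lemma foldr_mult_append:
  assumes "set xs \<subseteq> carrier A" "set ys \<subseteq> carrier A"
  shows "foldr (\<otimes>) (xs @ ys) \<one> = foldr (\<otimes>) xs \<one> \<otimes> foldr (\<otimes>) ys \<one>"
  using assms(1)
proof (induction xs)
  case (Cons x xs)
  then show ?case
    using m_assoc[of x "foldr (\<otimes>) xs \<one>" "foldr (\<otimes>) ys \<one>"] foldr_mult_closed assms(2) by auto
qed (use foldr_mult_closed[OF assms(2)] in simp)

lemma free_lift_algebra_hom:
  assumes "x \<in> X \<rightarrow> carrier A"
  shows "free_lift A x \<in> algebra_hom (free_algebra X) A"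
  unfolding free_lift_def free_algebra_def
proof (rule lin_ext_algebra_hom[OF monoid_free_monoid])
  have sub: "set (map x w) \<subseteq> carrier A" if "w \<in> lists X" for w
    using that assms by (auto simp: lists_eq_set)
  then show "(\<lambda>w. foldr (\<otimes>) (map x w) \<one>) \<in> carrier (free_monoid X) \<rightarrow> carrier A"
    using foldr_mult_closed by auto
  fix g h assume "g \<in> carrier (free_monoid X)" "h \<in> carrier (free_monoid X)"
  then show "foldr (\<otimes>) (map x (g \<otimes>\<^bsub>free_monoid X\<^esub> h)) \<one>
    = foldr (\<otimes>) (map x g) \<one> \<otimes> foldr (\<otimes>) (map x h) \<one>"
    using sub[of g] sub[of h] foldr_mult_append[of "map x g" "map x h"] by simp
qed (simp_all add: assoc_algebra_axioms)

lemma free_lift_gen: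
  assumes "x a \<in> carrier A"
  shows "free_lift A x (Poly_Mapping.single [a] 1) = x a"
  unfolding free_lift_def using assms by (subst lin_ext_single) simp_all

end

lemma free_algebra_single_closed:
  "w \<in> lists X \<Longrightarrow> Poly_Mapping.single w c \<in> carrier (free_algebra X)"
  unfolding free_algebra_def by (rule single_closed) simp

text \<open>Writing a basis word as the product of its letters lets any algebra homomorphism be
  computed on it.\<close>

lemma free_algebra_single_foldr:
  "w \<in> lists X \<Longrightarrow> Poly_Mapping.single w (1::'k::field) =
    foldr (\<otimes>\<^bsub>free_algebra X\<^esub>) (map (\<lambda>a. Poly_Mapping.single [a] 1) w) \<one>\<^bsub>free_algebra X\<^esub>"
proof (induction w)
  case Nil
  then show ?case by (simp add: free_algebra_def)
next
  case (Cons a w)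
  have "Poly_Mapping.single (a # w) (1::'k) =
      Poly_Mapping.single [a] 1 \<otimes>\<^bsub>free_algebra X\<^esub> Poly_Mapping.single w 1"
    by (simp add: free_algebra_def monoid_algebra_mult_single)
  then show ?case using Cons by simp
qed

locale presentation =
  fixes X :: "'x set" and R :: "('x list \<Rightarrow>\<^sub>0 'k::field) set"
  assumes relators_closed: "R \<subseteq> carrier (free_algebra X)"
begin

sublocale free: assoc_algebra "free_algebra X :: ('k, 'x list \<Rightarrow>\<^sub>0 'k) module"
  by (rule assoc_algebra_free)

sublocale kernel: algebra_ideal "free_algebra X :: ('k, 'x list \<Rightarrow>\<^sub>0 'k) module" "Idl\<^bsub>free_algebra X\<^esub> R"
  by (rule algebra_ideal.intro[OF free.assoc_algebra_axioms free.genideal_ideal[OF relators_closed]])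

sublocale assoc_algebra "presented_algebra X R"
  unfolding presented_algebra_def by (rule kernel.assoc_algebra_quotient)

abbreviation "pres_proj p \<equiv> Idl\<^bsub>free_algebra X\<^esub> R +>\<^bsub>free_algebra X\<^esub> p"

lemma presented_proj_hom: "(\<lambda>p. pres_proj p) \<in> algebra_hom (free_algebra X) (presented_algebra X R)"
  unfolding presented_algebra_def by (rule kernel.quotient_hom)

lemma presented_gen_closed: "a \<in> X \<Longrightarrow> presented_gen X R a \<in> carrier (presented_algebra X R)"
  unfolding presented_gen_def
  by (rule lin_hom_closed[OF algebra_hom_lin[OF presented_proj_hom]])
    (simp add: free_algebra_single_closed)

lemma presented_proj_relator:
  assumes "r \<in> R"
  shows "pres_proj r = \<zero>\<^bsub>presented_algebra X R\<^esub>"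
  using kernel.a_rcos_const assms free.genideal_self[OF relators_closed]
  by (auto simp: presented_algebra_def kernel.quotient_sel)

lemma presented_proj_single:
  assumes "w \<in> lists X"
  shows "pres_proj (Poly_Mapping.single w 1) =
    foldr (\<otimes>\<^bsub>presented_algebra X R\<^esub>) (map (presented_gen X R) w) \<one>\<^bsub>presented_algebra X R\<^esub>"
  unfolding free_algebra_single_foldr[OF assms]
  by (subst algebra_hom_foldr[OF free.assoc_algebra_axioms presented_proj_hom])
    (use assms in \<open>auto simp: presented_gen_def[abs_def] comp_def lists_eq_set free_algebra_single_closed\<close>)

text \<open>The projection is onto and words span the free algebra. The maps are merely linear,
  hence the test on all products of generators.\<close>

lemma lin_hom_presented_eqI:
  assumes "k_module C" "f \<in> lin_hom (presented_algebra X R) C" "g \<in> lin_hom (presented_algebra X R) C"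
    and eq: "\<And>w. w \<in> lists X \<Longrightarrow>
      f (foldr (\<otimes>\<^bsub>presented_algebra X R\<^esub>) (map (presented_gen X R) w) \<one>\<^bsub>presented_algebra X R\<^esub>)
      = g (foldr (\<otimes>\<^bsub>presented_algebra X R\<^esub>) (map (presented_gen X R) w) \<one>\<^bsub>presented_algebra X R\<^esub>)"
    and "y \<in> carrier (presented_algebra X R)"
  shows "f y = g y"
proof -
  obtain p where p: "p \<in> carrier (free_algebra X)" and y: "y = pres_proj p"
    using assms(5) by (auto simp: presented_algebra_def kernel.quotient_sel)
  note lin = algebra_hom_lin[OF presented_proj_hom]
  show ?thesis unfolding y
  proof (rule lin_hom_monoid_algebra_eqI[OF assms(1), where G = "free_monoid X"])
    show "(\<lambda>p. f (pres_proj p)) \<in> lin_hom (monoid_algebra (free_monoid X)) C"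
      "(\<lambda>p. g (pres_proj p)) \<in> lin_hom (monoid_algebra (free_monoid X)) C"
      using lin_hom_comp[OF assms(2) lin] lin_hom_comp[OF assms(3) lin]
      by (simp_all add: free_algebra_def)
    show "p \<in> carrier (monoid_algebra (free_monoid X))"
      using p by (simp add: free_algebra_def)
  qed (simp add: presented_proj_single eq)
qed

text \<open>Universal property of the presentation: the kernel of the evaluation is an ideal that
  contains the relators, hence the ideal generated by them.\<close>

lemma presented_hom_exists:
  assumes "assoc_algebra B" "x \<in> X \<rightarrow> carrier B" "\<And>r. r \<in> R \<Longrightarrow> free_lift B x r = \<zero>\<^bsub>B\<^esub>"
  obtains h where "h \<in> algebra_hom (presented_algebra X R) B" "\<And>a. a \<in> X \<Longrightarrow> h (presented_gen X R a) = x a"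
proof -
  interpret B: assoc_algebra B by fact
  let ?h = "free_lift B x"
  have hom: "?h \<in> algebra_hom (free_algebra X) B"
    by (rule B.free_lift_algebra_hom[OF assms(2)])
  then have "?h \<in> Ring.ring_hom (free_algebra X) B"
    by (simp add: algebra_hom_def)
  note ker = ring_hom_ring.kernel_is_ideal[OF ring_hom_ringI2[OF free.ring_axioms B.ring_axioms this]]
  have "Idl\<^bsub>free_algebra X\<^esub> R \<subseteq> a_kernel (free_algebra X) B ?h"
    by (rule free.genideal_minimal[OF ker])
      (use assms(3) relators_closed in \<open>auto simp: a_kernel_def'\<close>)
  then have zero: "?h p = \<zero>\<^bsub>B\<^esub>" if "p \<in> Idl\<^bsub>free_algebra X\<^esub> R" for p
    using that by (auto simp: a_kernel_def')
  show thesis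
  proof (rule that)
    show "quotient_lift ?h \<in> algebra_hom (presented_algebra X R) B"
      unfolding presented_algebra_def
      by (rule kernel.quotient_lift_algebra_hom[OF B.k_module hom zero])
    show "quotient_lift ?h (presented_gen X R a) = x a" if "a \<in> X" for a
      unfolding presented_gen_def
      by (subst kernel.quotient_lift_coset[OF B.k_module algebra_hom_lin[OF hom] zero])
        (use that assms(2) in \<open>auto simp: free_algebra_single_closed B.free_lift_gen Pi_def\<close>)
  qed
qed

end

section \<open>Tensor products\<close>

text \<open>A linear combination is built up one term at a time, so a linear property of the
  spanning set passes to the span.\<close>

lemma (in k_module) span_induct [consumes 2, case_names zero add]:
  assumes "x \<in> LinearCombinations.module.span class_ring V S" "S \<subseteq> carrier V"
    and "P \<zero>" "\<And>c s y. \<lbrakk>s \<in> S; y \<in> carrier V; P y\<rbrakk> \<Longrightarrow> P (c \<odot> s \<oplus> y)"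
  shows "P x"
proof -
  obtain c F where F: "finite F" "F \<subseteq> S" and x: "x = (\<Oplus>v\<in>F. c v \<odot> v)"
    using assms(1) LinearCombinations.module.span_def[OF is_module]
      LinearCombinations.module.lincomb_def[OF is_module] by auto
  have "P (\<Oplus>v\<in>F. c v \<odot> v)" using F
  proof (induction F)
    case (insert s F)
    have mem: "s \<in> carrier V" "F \<subseteq> carrier V" using insert(4) assms(2) by auto
    then have "(\<Oplus>v\<in>insert s F. c v \<odot> v) = c s \<odot> s \<oplus> (\<Oplus>v\<in>F. c v \<odot> v)"
      using insert(1,2) by (intro finsum_insert) auto
    moreover have "(\<Oplus>v\<in>F. c v \<odot> v) \<in> carrier V"
      using mem by (intro finsum_closed) auto
    ultimately show ?case using assms(4)[of s] insert by simp
  qed (simp add: assms(3))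
  then show ?thesis by (simp add: x)
qed

lemma monoid_algebra_diff_closed:
  "\<lbrakk>p \<in> carrier (monoid_algebra G); q \<in> carrier (monoid_algebra G)\<rbrakk> \<Longrightarrow> p - q \<in> carrier (monoid_algebra G)"
  using Poly_Mapping.keys_diff[of p q] by auto

lemma monoid_algebra_minus:
  assumes "p \<in> carrier (monoid_algebra G)" "q \<in> carrier (monoid_algebra G)"
  shows "p \<ominus>\<^bsub>monoid_algebra G\<^esub> q = p - q"
proof -
  interpret M: k_module "monoid_algebra G" by (rule k_module_monoid_algebra)
  have "\<ominus>\<^bsub>monoid_algebra G\<^esub> q = - q"
    using assms by (intro M.minus_equality) auto
  then show ?thesis by (simp add: M.minus_eq)
qed

lemma lin_hom_monoid_algebra_diff:
  assumes "k_module C" "f \<in> lin_hom (monoid_algebra G) C"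
    and "p \<in> carrier (monoid_algebra G)" "q \<in> carrier (monoid_algebra G)"
  shows "f (p - q) = f p \<ominus>\<^bsub>C\<^esub> f q"
proof -
  interpret C: k_module C by fact
  note closed = monoid_algebra_diff_closed[OF assms(3,4)]
  note C = lin_hom_closed[OF assms(2)]
  have "f p = f (p - q) \<oplus>\<^bsub>C\<^esub> f q"
    using lin_hom_add[OF assms(2) closed assms(4)] by simp
  then show ?thesis using C[OF closed] C[OF assms(3)] C[OF assms(4)]
    by (simp add: C.minus_eq C.a_assoc C.r_neg)
qed

locale tensor_pair = A: assoc_algebra A + B: assoc_algebra B
  for A :: "('k::field, 'a) module" and B :: "('k, 'b) module"
begin

abbreviation pairs :: "('k, 'a \<times> 'b \<Rightarrow>\<^sub>0 'k) module" where
  "pairs \<equiv> monoid_algebra (A \<times>\<times> B)"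

abbreviation sg :: "'a \<Rightarrow> 'b \<Rightarrow> 'a \<times> 'b \<Rightarrow>\<^sub>0 'k" where
  "sg a b \<equiv> Poly_Mapping.single (a, b) 1"

lemma monoid_pairs: "monoid (A \<times>\<times> B)"
  by (rule DirProd_monoid) (rule A.monoid_axioms B.monoid_axioms)+

sublocale pairs: assoc_algebra pairs
  by (rule assoc_algebra_monoid_algebra[OF monoid_pairs])

lemma sg_closed: "\<lbrakk>a \<in> carrier A; b \<in> carrier B\<rbrakk> \<Longrightarrow> Poly_Mapping.single (a, b) c \<in> carrier pairs"
  by (rule single_closed) simp

lemma tensor_relators_cases [consumes 1, case_names add_left add_right smult_left smult_right]:
  assumes "r \<in> tensor_relators A B"
  obtains
    (add_left) a a' b where "a \<in> carrier A" "a' \<in> carrier A" "b \<in> carrier B"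
      "r = sg (a \<oplus>\<^bsub>A\<^esub> a') b - sg a b - sg a' b"
  | (add_right) a b b' where "a \<in> carrier A" "b \<in> carrier B" "b' \<in> carrier B"
      "r = sg a (b \<oplus>\<^bsub>B\<^esub> b') - sg a b - sg a b'"
  | (smult_left) c a b where "a \<in> carrier A" "b \<in> carrier B"
      "r = sg (c \<odot>\<^bsub>A\<^esub> a) b - Poly_Mapping.single (a, b) c"
  | (smult_right) c a b where "a \<in> carrier A" "b \<in> carrier B"
      "r = sg a (c \<odot>\<^bsub>B\<^esub> b) - Poly_Mapping.single (a, b) c"
  using assms unfolding tensor_relators_def Un_iff mem_Collect_eq
  by - (elim disjE exE conjE; (rule that; assumption))

lemma tensor_relatorsI:
  "\<lbrakk>a \<in> carrier A; a' \<in> carrier A; b \<in> carrier B\<rbrakk>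
    \<Longrightarrow> sg (a \<oplus>\<^bsub>A\<^esub> a') b - sg a b - sg a' b \<in> tensor_relators A B"
  "\<lbrakk>a \<in> carrier A; b \<in> carrier B; b' \<in> carrier B\<rbrakk>
    \<Longrightarrow> sg a (b \<oplus>\<^bsub>B\<^esub> b') - sg a b - sg a b' \<in> tensor_relators A B"
  "\<lbrakk>a \<in> carrier A; b \<in> carrier B\<rbrakk>
    \<Longrightarrow> sg (c \<odot>\<^bsub>A\<^esub> a) b - Poly_Mapping.single (a, b) c \<in> tensor_relators A B"
  "\<lbrakk>a \<in> carrier A; b \<in> carrier B\<rbrakk>
    \<Longrightarrow> sg a (c \<odot>\<^bsub>B\<^esub> b) - Poly_Mapping.single (a, b) c \<in> tensor_relators A B"
  unfolding tensor_relators_def by blast+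

lemma tensor_relators_closed: "tensor_relators A B \<subseteq> carrier pairs"
proof
  fix r assume "r \<in> tensor_relators A B"
  then show "r \<in> carrier pairs"
    by (cases rule: tensor_relators_cases) (simp_all only: monoid_algebra_diff_closed sg_closed
      A.a_closed B.a_closed A.smult_closed B.smult_closed)
qed

lemma tensor_kernel_submodule: "LinearCombinations.submodule class_ring (tensor_kernel A B) pairs"
  unfolding tensor_kernel_def
  by (rule LinearCombinations.module.span_is_submodule[OF pairs.is_module tensor_relators_closed])

lemma kernel_subset: "tensor_kernel A B \<subseteq> carrier pairs"
  by (rule LinearCombinations.submodule.subset[OF tensor_kernel_submodule])

lemma kernel_zero: "0 \<in> tensor_kernel A B"
  using LinearCombinations.submodule.zero_closed[OF tensor_kernel_submodule] by simp

lemma kernel_linear: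
  "\<lbrakk>k \<in> tensor_kernel A B; k' \<in> tensor_kernel A B\<rbrakk>
    \<Longrightarrow> c \<odot>\<^bsub>pairs\<^esub> k \<oplus>\<^bsub>pairs\<^esub> k' \<in> tensor_kernel A B"
  using LinearCombinations.submodule.smult_closed[OF tensor_kernel_submodule]
    LinearCombinations.submodule.m_closed[OF tensor_kernel_submodule] by simp

lemma tensor_relators_kernel: "tensor_relators A B \<subseteq> tensor_kernel A B"
  unfolding tensor_kernel_def
  by (rule LinearCombinations.module.in_own_span[OF pairs.is_module tensor_relators_closed])

text \<open>First reduction towards the ideal property: for a linear map such as multiplication by a
  fixed element, only relators need testing.\<close>

lemma kernel_lin_hom:
  assumes f: "f \<in> lin_hom pairs pairs"
    and r: "\<And>r. r \<in> tensor_relators A B \<Longrightarrow> f r \<in> tensor_kernel A B"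
    and k: "k \<in> tensor_kernel A B"
  shows "f k \<in> tensor_kernel A B"
  using k[unfolded tensor_kernel_def] tensor_relators_closed
proof (induction k rule: pairs.span_induct)
  case zero
  then show ?case
    using lin_hom_zero[OF pairs.k_module_axioms pairs.k_module_axioms f] kernel_zero by simp
next
  case (add c r k)
  have "r \<in> carrier pairs" using add(1) tensor_relators_closed by blast
  then show ?case
    using kernel_linear[OF r[OF add(1)] add(3), of c] add(2)
    by (simp only: lin_hom_add[OF f] lin_hom_smult[OF f] pairs.smult_closed)
qed

lemma pairs_mult_diff:
  assumes "p \<in> carrier pairs" "q \<in> carrier pairs" "r \<in> carrier pairs"
  shows "p \<otimes>\<^bsub>pairs\<^esub> (q - r) = p \<otimes>\<^bsub>pairs\<^esub> q - p \<otimes>\<^bsub>pairs\<^esub> r"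
    and "(q - r) \<otimes>\<^bsub>pairs\<^esub> p = q \<otimes>\<^bsub>pairs\<^esub> p - r \<otimes>\<^bsub>pairs\<^esub> p"
  using lin_hom_monoid_algebra_diff[OF pairs.k_module_axioms
      bilinear_map_right[OF pairs.bilinear_mult assms(1)] assms(2,3)]
    lin_hom_monoid_algebra_diff[OF pairs.k_module_axioms
      bilinear_map_left[OF pairs.bilinear_mult assms(1)] assms(2,3)]
    monoid_algebra_minus[OF pairs.m_closed pairs.m_closed] assms
  by metis+

lemma sg_mult:
  "Poly_Mapping.single (a, b) c \<otimes>\<^bsub>pairs\<^esub> Poly_Mapping.single (a', b') c'
    = Poly_Mapping.single (a \<otimes>\<^bsub>A\<^esub> a', b \<otimes>\<^bsub>B\<^esub> b') (c * c')"
  by (simp add: monoid_algebra_mult_single)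

text \<open>Multiplication in each leg is bilinear, so a basis pair times a relator is a relator of
  the same kind.\<close>

lemma sg_mult_relator:
  assumes "a \<in> carrier A" "b \<in> carrier B" "r \<in> tensor_relators A B"
  shows "sg a b \<otimes>\<^bsub>pairs\<^esub> r \<in> tensor_relators A B"
  using assms(3)
  by (cases rule: tensor_relators_cases)
    (use assms(1,2) in \<open>simp_all only: pairs_mult_diff(1) monoid_algebra_diff_closed sg_closed sg_mult
      A.a_closed B.a_closed A.smult_closed B.smult_closed A.r_distr B.r_distr mult_1
      A.smult_mult_right B.smult_mult_right tensor_relatorsI A.m_closed B.m_closed\<close>)

lemma relator_mult_sg:
  assumes "a \<in> carrier A" "b \<in> carrier B" "r \<in> tensor_relators A B"
  shows "r \<otimes>\<^bsub>pairs\<^esub> sg a b \<in> tensor_relators A B"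
  using assms(3)
  by (cases rule: tensor_relators_cases)
    (use assms(1,2) in \<open>simp_all only: pairs_mult_diff(2) monoid_algebra_diff_closed sg_closed sg_mult
      A.a_closed B.a_closed A.smult_closed B.smult_closed A.l_distr B.l_distr mult_1_right
      A.smult_mult_left B.smult_mult_left tensor_relatorsI A.m_closed B.m_closed\<close>)

text \<open>Second reduction towards the ideal property: the arbitrary factor \<open>p\<close> is
  replaced by basis pairs.\<close>

lemma kernel_if_single:
  assumes "f \<in> lin_hom pairs pairs" "p \<in> carrier pairs"
    and "\<And>a b. \<lbrakk>a \<in> carrier A; b \<in> carrier B\<rbrakk> \<Longrightarrow> f (sg a b) \<in> tensor_kernel A B"
  shows "f p \<in> tensor_kernel A B"
  using assms(2)
proof (induction p rule: monoid_algebra_induct)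
  case zero
  then show ?case
    using lin_hom_zero[OF pairs.k_module_axioms pairs.k_module_axioms assms(1)] kernel_zero by simp
next
  case (add g c q)
  obtain a b where g: "g = (a, b)" "a \<in> carrier A" "b \<in> carrier B" using add(1) by auto
  have "f (c \<odot>\<^bsub>pairs\<^esub> sg a b \<oplus>\<^bsub>pairs\<^esub> q) \<in> tensor_kernel A B"
    using kernel_linear[OF assms(3)[OF g(2,3)] add(3), of c] add(2) sg_closed[OF g(2,3), of 1]
    by (simp only: lin_hom_add[OF assms(1)] lin_hom_smult[OF assms(1)] pairs.smult_closed)
  then show ?case
    using monoid_algebra_single_smult[of g c "A \<times>\<times> B"] by (simp add: g)
qed

text \<open>A linear span need not absorb products. Here linearity in both factors reduces to a
  basis pair times a relator, which is again a relator.\<close>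

lemma tensor_kernel_ideal: "ideal (tensor_kernel A B) pairs"
proof (rule idealI)
  note left = bilinear_map_left[OF pairs.bilinear_mult]
  note right = bilinear_map_right[OF pairs.bilinear_mult]
  show "subgroup (tensor_kernel A B) (add_monoid pairs)"
  proof (rule pairs.add.subgroupI)
    fix k l assume k: "k \<in> tensor_kernel A B" and l: "l \<in> tensor_kernel A B"
    have "\<ominus>\<^bsub>pairs\<^esub> k = (- 1) \<odot>\<^bsub>pairs\<^esub> k"
      using k kernel_subset by (intro pairs.smult_minus_one[symmetric]) blast
    then show "\<ominus>\<^bsub>pairs\<^esub> k \<in> tensor_kernel A B"
      using kernel_linear[OF k kernel_zero, of "- 1"] by simp
    show "k \<oplus>\<^bsub>pairs\<^esub> l \<in> tensor_kernel A B"
      using kernel_linear[OF k l, of 1] k kernel_subset pairs.smult_one[of k]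
      by (auto simp del: monoid_algebra_sel)
  qed (use kernel_zero kernel_subset in auto)
  fix k p assume k: "k \<in> tensor_kernel A B" and p: "p \<in> carrier pairs"
  have kc: "k \<in> carrier pairs" using k kernel_subset by blast
  show "p \<otimes>\<^bsub>pairs\<^esub> k \<in> tensor_kernel A B"
  proof (rule kernel_if_single[OF left[OF kc] p])
    fix a b assume ab: "a \<in> carrier A" "b \<in> carrier B"
    show "sg a b \<otimes>\<^bsub>pairs\<^esub> k \<in> tensor_kernel A B"
      by (rule kernel_lin_hom[OF right[OF sg_closed[OF ab]] _ k])
        (use sg_mult_relator[OF ab] tensor_relators_kernel in blast)
  qed
  show "k \<otimes>\<^bsub>pairs\<^esub> p \<in> tensor_kernel A B"
  proof (rule kernel_if_single[OF right[OF kc] p])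
    fix a b assume ab: "a \<in> carrier A" "b \<in> carrier B"
    show "k \<otimes>\<^bsub>pairs\<^esub> sg a b \<in> tensor_kernel A B"
      by (rule kernel_lin_hom[OF left[OF sg_closed[OF ab]] _ k])
        (use relator_mult_sg[OF ab] tensor_relators_kernel in blast)
  qed
qed (rule pairs.ring_axioms)

sublocale kernel: algebra_ideal pairs "tensor_kernel A B"
  by (rule algebra_ideal.intro[OF pairs.assoc_algebra_axioms tensor_kernel_ideal])

lemma assoc_algebra_tensor: "assoc_algebra (tensor_algebra A B)"
  unfolding tensor_algebra_def by (rule kernel.assoc_algebra_quotient)

lemma pure_tensor_closed:
  "\<lbrakk>a \<in> carrier A; b \<in> carrier B\<rbrakk> \<Longrightarrow> pure_tensor A B a b \<in> carrier (tensor_algebra A B)"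
  unfolding tensor_algebra_def pure_tensor_def kernel.quotient_sel
  by (rule imageI) (rule sg_closed)

lemma tensor_relator_coset:
  assumes "p \<in> carrier pairs" "q \<in> carrier pairs" "p - q \<in> tensor_relators A B"
  shows "tensor_kernel A B +>\<^bsub>pairs\<^esub> p = tensor_kernel A B +>\<^bsub>pairs\<^esub> q"
  using assms tensor_relators_kernel
  by (intro kernel.coset_eqI) (auto simp only: monoid_algebra_minus)

lemma bilinear_pure_tensor: "bilinear_map A B (tensor_algebra A B) (pure_tensor A B)"
proof (rule bilinear_mapI; rule lin_homI)
  fix a b b' assume *: "a \<in> carrier A" "b \<in> carrier B" "b' \<in> carrier B"
  \<comment> \<open>Regrouping shows the relator as a difference of two representatives, which is
    what equates their cosets.\<close>
  have "sg a (b \<oplus>\<^bsub>B\<^esub> b') - (sg a b + sg a b') \<in> tensor_relators A B"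
    using tensor_relatorsI(2)[OF *] by (simp add: algebra_simps)
  from tensor_relator_coset[OF _ _ this]
  show "pure_tensor A B a (b \<oplus>\<^bsub>B\<^esub> b')
      = pure_tensor A B a b \<oplus>\<^bsub>tensor_algebra A B\<^esub> pure_tensor A B a b'"
    using * pairs.a_closed[OF sg_closed sg_closed, of a b a b' 1 1]
    by (simp add: pure_tensor_def tensor_algebra_def kernel.quotient_add sg_closed
      del: monoid_algebra_sel(1))
next
  fix b a a' assume *: "b \<in> carrier B" "a \<in> carrier A" "a' \<in> carrier A"
  have "sg (a \<oplus>\<^bsub>A\<^esub> a') b - (sg a b + sg a' b) \<in> tensor_relators A B"
    using tensor_relatorsI(1)[OF *(2,3,1)] by (simp add: algebra_simps)
  from tensor_relator_coset[OF _ _ this]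
  show "pure_tensor A B (a \<oplus>\<^bsub>A\<^esub> a') b
      = pure_tensor A B a b \<oplus>\<^bsub>tensor_algebra A B\<^esub> pure_tensor A B a' b"
    using * pairs.a_closed[OF sg_closed sg_closed, of a b a' b 1 1]
    by (simp add: pure_tensor_def tensor_algebra_def kernel.quotient_add sg_closed
      del: monoid_algebra_sel(1))
next
  fix a b c assume *: "a \<in> carrier A" "b \<in> carrier B"
  \<comment> \<open>Folding moves the scalar into the coefficient of the monomial, where the
    homogeneity relators carry it.\<close>
  note sm = kernel.quotient_smult[OF sg_closed[OF *, of 1], of c,
      folded monoid_algebra_single_smult tensor_algebra_def]
  show "pure_tensor A B a (c \<odot>\<^bsub>B\<^esub> b) = c \<odot>\<^bsub>tensor_algebra A B\<^esub> pure_tensor A B a b"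
    unfolding pure_tensor_def sm
    by (rule tensor_relator_coset[OF _ _ tensor_relatorsI(4)[OF *]])
      (simp_all only: sg_closed * B.smult_closed)
  show "pure_tensor A B (c \<odot>\<^bsub>A\<^esub> a) b = c \<odot>\<^bsub>tensor_algebra A B\<^esub> pure_tensor A B a b"
    unfolding pure_tensor_def sm
    by (rule tensor_relator_coset[OF _ _ tensor_relatorsI(3)[OF *]])
      (simp_all only: sg_closed * A.smult_closed)
qed (rule pure_tensor_closed; assumption)+

lemma pure_tensor_mult:
  assumes "a \<in> carrier A" "a' \<in> carrier A" "b \<in> carrier B" "b' \<in> carrier B"
  shows "pure_tensor A B a b \<otimes>\<^bsub>tensor_algebra A B\<^esub> pure_tensor A B a' b'
    = pure_tensor A B (a \<otimes>\<^bsub>A\<^esub> a') (b \<otimes>\<^bsub>B\<^esub> b')"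
  unfolding pure_tensor_def tensor_algebra_def
  by (subst kernel.quotient_mult) (simp_all only: assms sg_closed sg_mult mult_1)

lemma tensor_one: "\<one>\<^bsub>tensor_algebra A B\<^esub> = pure_tensor A B \<one>\<^bsub>A\<^esub> \<one>\<^bsub>B\<^esub>"
  by (simp add: pure_tensor_def tensor_algebra_def kernel.quotient_sel)

text \<open>Both sides unfold to the same expression. The universal property of the tensor product
  thereby splits into linear extension from the basis pairs and descent to the quotient.\<close>

lemma tensor_lift_eq:
  "tensor_lift C \<phi> = quotient_lift (lin_ext C (\<lambda>z. \<phi> (fst z) (snd z)))"
  by (simp add: tensor_lift_def quotient_lift_def lin_ext_def fun_eq_iff)

context
  fixes C :: "('k, 'c) module" and \<phi>
  assumes C: "k_module C" and bil: "bilinear_map A B C \<phi>"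
begin

interpretation C: k_module C by (rule C)

lemma lin_ext_pairs: "lin_ext C (\<lambda>z. \<phi> (fst z) (snd z)) \<in> lin_hom pairs C"
  by (rule C.lin_ext_lin_hom) (use bilinear_map_closed[OF bil] in auto)

lemma lin_ext_pairs_sg:
  "\<lbrakk>a \<in> carrier A; b \<in> carrier B\<rbrakk>
    \<Longrightarrow> lin_ext C (\<lambda>z. \<phi> (fst z) (snd z)) (Poly_Mapping.single (a, b) c) = c \<odot>\<^bsub>C\<^esub> \<phi> a b"
  by (subst C.lin_ext_single) (use bilinear_map_closed[OF bil] in auto)

lemma lin_ext_relator:
  assumes "r \<in> tensor_relators A B"
  shows "lin_ext C (\<lambda>z. \<phi> (fst z) (snd z)) r = \<zero>\<^bsub>C\<^esub>"
proof -
  \<comment> \<open>Additivity relators are sent to x + y - x - y, homogeneity relators to x -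
    x.\<close>
  have cancel: "x \<oplus>\<^bsub>C\<^esub> y \<ominus>\<^bsub>C\<^esub> x \<ominus>\<^bsub>C\<^esub> y = \<zero>\<^bsub>C\<^esub>" "x \<ominus>\<^bsub>C\<^esub> x = \<zero>\<^bsub>C\<^esub>"
    if "x \<in> carrier C" "y \<in> carrier C" for x y
  proof -
    have "x \<oplus>\<^bsub>C\<^esub> y \<ominus>\<^bsub>C\<^esub> x \<ominus>\<^bsub>C\<^esub> y = x \<oplus>\<^bsub>C\<^esub> y \<oplus>\<^bsub>C\<^esub> \<ominus>\<^bsub>C\<^esub> (x \<oplus>\<^bsub>C\<^esub> y)"
      using that by (simp add: C.minus_eq C.a_assoc C.minus_add)
    then show "x \<oplus>\<^bsub>C\<^esub> y \<ominus>\<^bsub>C\<^esub> x \<ominus>\<^bsub>C\<^esub> y = \<zero>\<^bsub>C\<^esub>" using that by (simp add: C.r_neg)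
    show "x \<ominus>\<^bsub>C\<^esub> x = \<zero>\<^bsub>C\<^esub>" using that by (simp add: C.minus_eq C.r_neg)
  qed
  note closed = bilinear_map_closed[OF bil]
  note diff = lin_hom_monoid_algebra_diff[OF C lin_ext_pairs]
  note carr = sg_closed monoid_algebra_diff_closed A.a_closed B.a_closed A.smult_closed B.smult_closed
  show ?thesis using assms
  proof (cases rule: tensor_relators_cases)
    case (add_left a a' b)
    then show ?thesis
      using lin_hom_add[OF bilinear_map_left[OF bil add_left(3)] add_left(1,2)] cancel closed
      by (simp add: diff carr lin_ext_pairs_sg del: monoid_algebra_sel(1))
  next
    case (add_right a b b')
    then show ?thesis
      using lin_hom_add[OF bilinear_map_right[OF bil add_right(1)] add_right(2,3)] cancel closed
      by (simp add: diff carr lin_ext_pairs_sg del: monoid_algebra_sel(1))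
  next
    case (smult_left c a b)
    then show ?thesis
      using lin_hom_smult[OF bilinear_map_left[OF bil smult_left(2)] smult_left(1)] cancel closed
      by (simp add: diff carr lin_ext_pairs_sg del: monoid_algebra_sel(1))
  next
    case (smult_right c a b)
    then show ?thesis
      using lin_hom_smult[OF bilinear_map_right[OF bil smult_right(1)] smult_right(2)] cancel closed
      by (simp add: diff carr lin_ext_pairs_sg del: monoid_algebra_sel(1))
  qed
qed

lemma lin_ext_kernel:
  assumes "k \<in> tensor_kernel A B"
  shows "lin_ext C (\<lambda>z. \<phi> (fst z) (snd z)) k = \<zero>\<^bsub>C\<^esub>"
  using assms[unfolded tensor_kernel_def] tensor_relators_closed
proof (induction k rule: pairs.span_induct)
  case zero
  show ?case using lin_hom_zero[OF pairs.k_module_axioms C lin_ext_pairs] .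
next
  case (add c r k)
  have "r \<in> carrier pairs" using add(1) tensor_relators_closed by blast
  then show ?case
    using add(2,3) lin_ext_relator[OF add(1)]
    by (simp only: lin_hom_add[OF lin_ext_pairs] lin_hom_smult[OF lin_ext_pairs] pairs.smult_closed
      C.smult_zero_right C.l_zero C.zero_closed)
qed

lemma tensor_lift_coset:
  assumes "p \<in> carrier pairs"
  shows "tensor_lift C \<phi> (tensor_kernel A B +>\<^bsub>pairs\<^esub> p) = lin_ext C (\<lambda>z. \<phi> (fst z) (snd z)) p"
  unfolding tensor_lift_eq by (rule kernel.quotient_lift_coset[OF C lin_ext_pairs lin_ext_kernel assms])

lemma tensor_lift_lin_hom: "tensor_lift C \<phi> \<in> lin_hom (tensor_algebra A B) C"
  unfolding tensor_lift_eq tensor_algebra_def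
  by (rule kernel.quotient_lift_lin_hom[OF C lin_ext_pairs lin_ext_kernel])

lemma tensor_lift_pure:
  assumes "a \<in> carrier A" "b \<in> carrier B"
  shows "tensor_lift C \<phi> (pure_tensor A B a b) = \<phi> a b"
  unfolding pure_tensor_def using assms bilinear_map_closed[OF bil assms]
  by (simp add: tensor_lift_coset sg_closed lin_ext_pairs_sg del: monoid_algebra_sel(1))

end

end

section \<open>Tensor products of maps, and the associator\<close>

context
  fixes A :: "('k::field, 'a) module" and B :: "('k, 'b) module"
    and C :: "('k, 'c) module" and D :: "('k, 'd) module" and f g
  assumes AB: "tensor_pair A B" and CD: "tensor_pair C D"
    and f: "f \<in> lin_hom A C" and g: "g \<in> lin_hom B D"
begin

interpretation AB: tensor_pair A B by (rule AB)
interpretation CD: tensor_pair C D by (rule CD)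

lemma tensor_map_lin_hom: "tensor_map C D f g \<in> lin_hom (tensor_algebra A B) (tensor_algebra C D)"
  unfolding tensor_map_def
  by (rule AB.tensor_lift_lin_hom[OF assoc_algebra.k_module[OF CD.assoc_algebra_tensor]
        bilinear_map_comp[OF CD.bilinear_pure_tensor f g]])

lemma tensor_map_pure:
  "\<lbrakk>a \<in> carrier A; b \<in> carrier B\<rbrakk>
    \<Longrightarrow> tensor_map C D f g (pure_tensor A B a b) = pure_tensor C D (f a) (g b)"
  unfolding tensor_map_def
  by (rule AB.tensor_lift_pure[OF assoc_algebra.k_module[OF CD.assoc_algebra_tensor]
        bilinear_map_comp[OF CD.bilinear_pure_tensor f g]])

end

context
  fixes A :: "('k::field, 'a) module" and B :: "('k, 'b) module" and C :: "('k, 'c) module"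
  assumes A: "assoc_algebra A" and B: "assoc_algebra B" and C: "assoc_algebra C"
begin

interpretation AB: tensor_pair A B by (intro tensor_pair.intro A B)
interpretation BC: tensor_pair B C by (intro tensor_pair.intro B C)
interpretation A_BC: tensor_pair A "tensor_algebra B C"
  by (intro tensor_pair.intro A BC.assoc_algebra_tensor)
interpretation AB_C: tensor_pair "tensor_algebra A B" C
  by (intro tensor_pair.intro C AB.assoc_algebra_tensor)

private abbreviation "T \<equiv> tensor_algebra A (tensor_algebra B C)"

private abbreviation "\<psi> c a b \<equiv> pure_tensor A (tensor_algebra B C) a (pure_tensor B C b c)"

private lemma T_module: "k_module T"
  by (rule assoc_algebra.k_module[OF A_BC.assoc_algebra_tensor])

lemma tensor_assoc_inner:
  assumes "c \<in> carrier C"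
  shows "bilinear_map A B T (\<psi> c)"
  by (rule bilinear_map_comp[OF A_BC.bilinear_pure_tensor lin_hom_id
        bilinear_map_left[OF BC.bilinear_pure_tensor assms]])

text \<open>Linearity in \<open>c\<close> is not visible from the lift, since \<open>c\<close>
  occurs in the map being lifted. On a fixed representative of \<open>x\<close> the lift is a finite
  sum of terms, each linear in \<open>c\<close>.\<close>

lemma tensor_assoc_outer:
  "bilinear_map (tensor_algebra A B) C T (\<lambda>x c. tensor_lift T (\<psi> c) x)"
proof (rule bilinear_mapI)
  fix x assume "x \<in> carrier (tensor_algebra A B)"
  then obtain p where p: "p \<in> carrier AB.pairs" and x: "x = tensor_kernel A B +>\<^bsub>AB.pairs\<^esub> p"
    unfolding tensor_algebra_def AB.kernel.quotient_sel by blast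
  have "(\<lambda>c. lin_ext T (\<lambda>z. \<psi> c (fst z) (snd z)) p) \<in> lin_hom C T"
    unfolding lin_ext_def
  proof (intro finsum_lin_hom smult_lin_hom T_module C[THEN assoc_algebra.k_module])
    fix z assume "z \<in> Poly_Mapping.keys p"
    then have z: "fst z \<in> carrier A" "snd z \<in> carrier B" using p by auto
    show "(\<lambda>c. \<psi> c (fst z) (snd z)) \<in> lin_hom C T"
      by (rule lin_hom_comp[OF bilinear_map_right[OF A_BC.bilinear_pure_tensor z(1)]
            bilinear_map_right[OF BC.bilinear_pure_tensor z(2)]])
  qed
  then show "(\<lambda>c. tensor_lift T (\<psi> c) x) \<in> lin_hom C T"
    by (rule lin_hom_cong[OF C[THEN assoc_algebra.k_module]])
      (simp only: x AB.tensor_lift_coset[OF T_module tensor_assoc_inner p])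
qed (rule AB.tensor_lift_lin_hom[OF T_module tensor_assoc_inner])

lemma tensor_assoc_lin_hom:
  "tensor_assoc A B C \<in> lin_hom (tensor_algebra (tensor_algebra A B) C) T"
  unfolding tensor_assoc_def by (rule AB_C.tensor_lift_lin_hom[OF T_module tensor_assoc_outer])

lemma tensor_assoc_pure:
  assumes "a \<in> carrier A" "b \<in> carrier B" "c \<in> carrier C"
  shows "tensor_assoc A B C (pure_tensor (tensor_algebra A B) C (pure_tensor A B a b) c)
    = pure_tensor A (tensor_algebra B C) a (pure_tensor B C b c)"
  unfolding tensor_assoc_def
  using assms by (simp add: AB_C.tensor_lift_pure[OF T_module tensor_assoc_outer]
    AB.pure_tensor_closed AB.tensor_lift_pure[OF T_module tensor_assoc_inner])

end

section \<open>Words in matrix generators\<close>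

lemma finite_multi_indices [simp]: "finite (multi_indices s n)"
  unfolding multi_indices_def by (rule finite_subset[OF _ finite_lists_length_eq[of "{0..s}" n]]) auto

lemma multi_indices_0: "multi_indices s 0 = {[]}"
  by (auto simp: multi_indices_def)

text \<open>Written as an injective image of a product so that reindexing turns a sum over words
  into a double sum.\<close>

lemma multi_indices_Suc: "multi_indices s (Suc n) = (\<lambda>z. fst z # snd z) ` ({0..s} \<times> multi_indices s n)"
proof -
  have "xs \<in> (\<lambda>z. fst z # snd z) ` ({0..s} \<times> multi_indices s n)" if "xs \<in> multi_indices s (Suc n)" for xs
    using that by (cases xs) (auto simp: multi_indices_def intro!: image_eqI[of _ _ "(hd xs, tl xs)"])
  then show ?thesis by (auto simp: multi_indices_def)
qed

text \<open>Words are split at the front where u multiplies from the left, and at the back where it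
  multiplies from the right.\<close>

lemma multi_indices_snoc: "multi_indices s (Suc n) = (\<lambda>z. snd z @ [fst z]) ` ({0..s} \<times> multi_indices s n)"
proof -
  have "xs \<in> (\<lambda>z. snd z @ [fst z]) ` ({0..s} \<times> multi_indices s n)" if "xs \<in> multi_indices s (Suc n)" for xs
    using that
    by (cases xs rule: rev_cases) (auto simp: multi_indices_def intro!: image_eqI[of _ _ "(last xs, butlast xs)"])
  then show ?thesis by (auto simp: multi_indices_def)
qed

lemma Cons_multi_indices [simp]:
  "l # ls \<in> multi_indices s (Suc n) \<longleftrightarrow> l \<in> {0..s} \<and> ls \<in> multi_indices s n"
  by (auto simp: multi_indices_def)

lemma snoc_multi_indices [simp]:
  "ls @ [l] \<in> multi_indices s (Suc n) \<longleftrightarrow> l \<in> {0..s} \<and> ls \<in> multi_indices s n"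
  by (auto simp: multi_indices_def)

lemma (in k_module) finsum_multi_indices_Suc:
  assumes "f \<in> multi_indices s (Suc n) \<rightarrow> carrier V"
  shows "(\<Oplus>is\<in>multi_indices s (Suc n). f is) = (\<Oplus>l\<in>{0..s}. \<Oplus>ls\<in>multi_indices s n. f (l # ls))"
proof -
  have "(\<Oplus>is\<in>multi_indices s (Suc n). f is) = (\<Oplus>z\<in>{0..s} \<times> multi_indices s n. f (fst z # snd z))"
    unfolding multi_indices_Suc
    by (rule finsum_reindex) (use assms in \<open>auto simp: multi_indices_Suc inj_on_def\<close>)
  also have "\<dots> = (\<Oplus>l\<in>{0..s}. \<Oplus>ls\<in>multi_indices s n. f (fst (l, ls) # snd (l, ls)))"
    by (rule finsum_product[symmetric]) (use assms in auto)
  finally show ?thesis by simp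
qed

lemma (in k_module) finsum_multi_indices_snoc:
  assumes "f \<in> multi_indices s (Suc n) \<rightarrow> carrier V"
  shows "(\<Oplus>is\<in>multi_indices s (Suc n). f is) = (\<Oplus>l\<in>{0..s}. \<Oplus>ls\<in>multi_indices s n. f (ls @ [l]))"
proof -
  have "(\<Oplus>is\<in>multi_indices s (Suc n). f is) = (\<Oplus>z\<in>{0..s} \<times> multi_indices s n. f (snd z @ [fst z]))"
    unfolding multi_indices_snoc
    by (rule finsum_reindex) (use assms in \<open>auto simp: multi_indices_snoc inj_on_def\<close>)
  also have "\<dots> = (\<Oplus>l\<in>{0..s}. \<Oplus>ls\<in>multi_indices s n. f (snd (l, ls) @ [fst (l, ls)]))"
    by (rule finsum_product[symmetric]) (use assms in auto)
  finally show ?thesis by simp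
qed

section \<open>Products of matrix entries along two multi-indices\<close>

lemma index_word_Nil [simp]: "index_word A x [] bs = \<one>\<^bsub>A\<^esub>" "index_word A x as [] = \<one>\<^bsub>A\<^esub>"
  by (simp_all add: index_word_def)

lemma index_word_Cons [simp]:
  "index_word A x (a # as) (b # bs) = x a b \<otimes>\<^bsub>A\<^esub> index_word A x as bs"
  by (simp add: index_word_def)

text \<open>Both indices of a word have one common length, so the zip inside
  \<open>index_word\<close> never truncates and the two lists can be peeled together.\<close>

lemma multi_indices_induct2 [consumes 2, case_names Nil Cons]:
  assumes "as \<in> multi_indices s n" "bs \<in> multi_indices s n" "P 0 [] []"
    and "\<And>n a as b bs. \<lbrakk>a \<in> {0..s}; b \<in> {0..s}; as \<in> multi_indices s n; bs \<in> multi_indices s n; P n as bs\<rbrakk>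
          \<Longrightarrow> P (Suc n) (a # as) (b # bs)"
  shows "P n as bs"
  using assms(1,2)
proof (induction n arbitrary: as bs)
  case (Suc n)
  then obtain a as' b bs' where "as = a # as'" "bs = b # bs'"
    by (auto simp: multi_indices_Suc)
  then show ?case using Suc assms(4) by simp
qed (simp add: multi_indices_0 assms(3))

text \<open>Matrices are total functions on natural numbers; only the entries with indices up to
  \<open>s\<close> carry meaning.\<close>

definition matrix_in :: "nat \<Rightarrow> 'a set \<Rightarrow> (nat \<Rightarrow> nat \<Rightarrow> 'a) \<Rightarrow> bool" where
  "matrix_in s X x \<longleftrightarrow> (\<forall>a\<in>{0..s}. \<forall>b\<in>{0..s}. x a b \<in> X)"

lemma matrix_inD: "\<lbrakk>matrix_in s X x; a \<in> {0..s}; b \<in> {0..s}\<rbrakk> \<Longrightarrow> x a b \<in> X"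
  by (simp add: matrix_in_def)

lemma (in assoc_algebra) index_word_closed:
  assumes "matrix_in s (carrier A) x" "as \<in> multi_indices s n" "bs \<in> multi_indices s n"
  shows "index_word A x as bs \<in> carrier A"
  using assms(2,3) by (induction rule: multi_indices_induct2) (auto simp: matrix_inD[OF assms(1)])

text \<open>\<open>index_word\<close> folds from the right, so splitting off the last letter takes
  associativity.\<close>

lemma (in assoc_algebra) index_word_snoc:
  assumes "matrix_in s (carrier A) x" "as \<in> multi_indices s n" "bs \<in> multi_indices s n"
    "a \<in> {0..s}" "b \<in> {0..s}"
  shows "index_word A x (as @ [a]) (bs @ [b]) = index_word A x as bs \<otimes> x a b"
  using assms(2,3)
  by (induction rule: multi_indices_induct2)
    (use matrix_inD[OF assms(1)] assms(4,5) index_word_closed[OF assms(1)] in \<open>auto simp: m_assoc\<close>)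

lemma index_word_cong:
  assumes "as \<in> multi_indices s n" "bs \<in> multi_indices s n"
    "\<And>a b. \<lbrakk>a \<in> {0..s}; b \<in> {0..s}\<rbrakk> \<Longrightarrow> x a b = y a b"
  shows "index_word A x as bs = index_word A y as bs"
  using assms(1,2) by (induction rule: multi_indices_induct2) (auto simp: assms(3))

lemma algebra_hom_index_word:
  assumes "assoc_algebra A" "h \<in> algebra_hom A B" "matrix_in s (carrier A) x"
    and "as \<in> multi_indices s n" "bs \<in> multi_indices s n"
  shows "h (index_word A x as bs) = index_word B (\<lambda>a b. h (x a b)) as bs"
  using assms(4,5)
  by (induction rule: multi_indices_induct2)
    (simp_all add: algebra_hom_one[OF assms(2)] algebra_hom_mult[OF assms(2)]
      assoc_algebra.index_word_closed[OF assms(1,3)] matrix_inD[OF assms(3)])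

text \<open>A product of Kronecker deltas of letters is the Kronecker delta of the lists: the counit
  sends every word matrix to an identity matrix.\<close>

lemma index_word_ground:
  assumes "as \<in> multi_indices s n" "bs \<in> multi_indices s n"
  shows "index_word ground_algebra (\<lambda>a b. if a = b then 1 else 0) as bs = (if as = bs then 1 else 0)"
  using assms by (induction rule: multi_indices_induct2) auto

text \<open>It serves twice: words over it have their factors reversed, and an antipode is
  constructed as an algebra homomorphism into it. Only the product changes, so sums and linear maps
  are those of \<open>A\<close>.\<close>

definition opposite_algebra :: "('k, 'a) module \<Rightarrow> ('k, 'a) module" where
  "opposite_algebra A = A\<lparr>mult := \<lambda>x y. y \<otimes>\<^bsub>A\<^esub> x\<rparr>"

lemma opposite_algebra_sel [simp]:
  "carrier (opposite_algebra A) = carrier A" "one (opposite_algebra A) = one A"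
  "zero (opposite_algebra A) = zero A" "add (opposite_algebra A) = add A"
  "smult (opposite_algebra A) = smult A" "x \<otimes>\<^bsub>opposite_algebra A\<^esub> y = y \<otimes>\<^bsub>A\<^esub> x"
  by (simp_all add: opposite_algebra_def)

lemma finsum_opposite [simp]: "finsum (opposite_algebra A) f X = finsum A f X"
  by (simp add: finsum_def finprod_def)

lemma lin_hom_opposite [simp]: "lin_hom V (opposite_algebra A) = lin_hom V A"
  by (simp add: LinearCombinations.module_hom_def)

lemma (in assoc_algebra) assoc_algebra_opposite: "assoc_algebra (opposite_algebra A)"
proof -
  have ab: "abelian_group (opposite_algebra A)"
  proof (rule abelian_groupI)
    show "\<exists>y\<in>carrier (opposite_algebra A). y \<oplus>\<^bsub>opposite_algebra A\<^esub> x = \<zero>\<^bsub>opposite_algebra A\<^esub>"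
      if "x \<in> carrier (opposite_algebra A)" for x
      using that l_neg[of x] a_inv_closed[of x] unfolding opposite_algebra_sel by blast
  qed (simp_all add: a_ac)
  show ?thesis
  proof (rule assoc_algebra.intro)
    have "monoid (opposite_algebra A)"
      by (rule monoidI) (simp_all add: m_assoc)
    with ab show "ring (opposite_algebra A)"
      by (rule ringI) (simp_all add: l_distr r_distr)
    show "Module.module class_ring (opposite_algebra A)"
      by (rule moduleI[OF class_cring.is_cring ab])
        (simp_all add: smult_l_distr smult_r_distr smult_smult)
  qed (simp_all add: smult_mult_left smult_mult_right)
qed

context assoc_algebra
begin

lemma finsum_mult_finsum:
  assumes "finite I" "finite J" "f \<in> I \<rightarrow> carrier A" "g \<in> J \<rightarrow> carrier A"
  shows "(\<Oplus>i\<in>I. f i) \<otimes> (\<Oplus>j\<in>J. g j) = (\<Oplus>i\<in>I. \<Oplus>j\<in>J. f i \<otimes> g j)"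
proof -
  have "(\<Oplus>i\<in>I. f i) \<otimes> (\<Oplus>j\<in>J. g j) = (\<Oplus>i\<in>I. f i \<otimes> (\<Oplus>j\<in>J. g j))"
    using assms by (intro finsum_ldistr finsum_closed) auto
  also have "\<dots> = (\<Oplus>i\<in>I. \<Oplus>j\<in>J. f i \<otimes> g j)"
    by (rule finsum_cong')
      (use assms in \<open>auto intro!: finsum_rdistr finsum_closed simp: Pi_def\<close>)
  finally show ?thesis .
qed

text \<open>The inverse of the matrix of words in \<open>x\<close> reverses the order of the factors.\<close>

context
  fixes x v :: "nat \<Rightarrow> nat \<Rightarrow> 'a" and s :: nat
  assumes x: "matrix_in s (carrier A) x" and v: "matrix_in s (carrier A) v"
begin

private lemma v': "matrix_in s (carrier (opposite_algebra A)) v"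
  using v by simp

private lemmas closed = matrix_inD[OF x] matrix_inD[OF v] index_word_closed[OF x]
  assoc_algebra.index_word_closed[OF assoc_algebra_opposite v', simplified]

lemma word_right_inverse:
  assumes inv: "\<And>a b. \<lbrakk>a \<in> {0..s}; b \<in> {0..s}\<rbrakk>
      \<Longrightarrow> (\<Oplus>c\<in>{0..s}. x a c \<otimes> v c b) = (if a = b then 1 else 0) \<odot> \<one>"
    and "as \<in> multi_indices s n" "bs \<in> multi_indices s n"
  shows "(\<Oplus>cs\<in>multi_indices s n. index_word A x as cs \<otimes> index_word (opposite_algebra A) v cs bs)
    = (if as = bs then 1 else 0) \<odot> \<one>"
  using assms(2,3)
proof (induction rule: multi_indices_induct2)
  case (Cons n a as b bs)
  let ?P = "index_word A x" and ?Q = "index_word (opposite_algebra A) v"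
  have "(\<Oplus>cs\<in>multi_indices s (Suc n). ?P (a # as) cs \<otimes> ?Q cs (b # bs))
      = (\<Oplus>l\<in>{0..s}. \<Oplus>cs\<in>multi_indices s n. ?P (a # as) (l # cs) \<otimes> ?Q (l # cs) (b # bs))"
    by (rule finsum_multi_indices_Suc)
      (use Cons(1-4) in \<open>auto simp: multi_indices_Suc closed\<close>)
  also have "\<dots> = (\<Oplus>l\<in>{0..s}. (if as = bs then 1 else 0) \<odot> (x a l \<otimes> v l b))"
  proof (rule finsum_cong')
    fix l assume l: "l \<in> {0..s}"
    \<comment> \<open>With reversed factors the two inner words meet in the middle. Their sum over
      \<open>cs\<close> is a scalar by the induction hypothesis, which brings the letters
      \<open>x a l\<close> and \<open>v l b\<close> together.\<close>
    have "(\<Oplus>cs\<in>multi_indices s n. ?P (a # as) (l # cs) \<otimes> ?Q (l # cs) (b # bs))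
        = (\<Oplus>cs\<in>multi_indices s n. x a l \<otimes> (?P as cs \<otimes> ?Q cs bs) \<otimes> v l b)"
      by (rule finsum_cong') (use Cons(1-4) l in \<open>auto simp: closed m_assoc\<close>)
    also have "\<dots> = x a l \<otimes> (\<Oplus>cs\<in>multi_indices s n. ?P as cs \<otimes> ?Q cs bs) \<otimes> v l b"
      using Cons(1-4) l by (simp add: closed finsum_ldistr finsum_rdistr Pi_def)
    also have "\<dots> = (if as = bs then 1 else 0) \<odot> (x a l \<otimes> v l b)"
      using Cons(1,2) l unfolding Cons.IH by (simp add: closed smult_mult_left smult_mult_right)
    finally show "(\<Oplus>cs\<in>multi_indices s n. ?P (a # as) (l # cs) \<otimes> ?Q (l # cs) (b # bs))
      = (if as = bs then 1 else 0) \<odot> (x a l \<otimes> v l b)" .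
  qed (use Cons(1,2) in \<open>auto simp: closed\<close>)
  also have "\<dots> = (if as = bs then 1 else 0) \<odot> (\<Oplus>l\<in>{0..s}. x a l \<otimes> v l b)"
    by (rule smult_finsum[symmetric]) (use Cons(1,2) in \<open>auto simp: closed\<close>)
  also have "\<dots> = (if a # as = b # bs then 1 else 0) \<odot> \<one>"
    unfolding inv[OF Cons(1,2)] by (simp add: smult_smult)
  finally show ?case .
qed (simp add: multi_indices_0)

lemma word_left_inverse:
  assumes inv: "\<And>a b. \<lbrakk>a \<in> {0..s}; b \<in> {0..s}\<rbrakk>
      \<Longrightarrow> (\<Oplus>c\<in>{0..s}. v a c \<otimes> x c b) = (if a = b then 1 else 0) \<odot> \<one>"
    and "as \<in> multi_indices s n" "bs \<in> multi_indices s n"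
  shows "(\<Oplus>cs\<in>multi_indices s n. index_word (opposite_algebra A) v as cs \<otimes> index_word A x cs bs)
    = (if as = bs then 1 else 0) \<odot> \<one>"
  using assms(2,3)
proof (induction rule: multi_indices_induct2)
  case (Cons n a as b bs)
  let ?P = "index_word A x" and ?Q = "index_word (opposite_algebra A) v"
  have "(\<Oplus>cs\<in>multi_indices s (Suc n). ?Q (a # as) cs \<otimes> ?P cs (b # bs))
      = (\<Oplus>l\<in>{0..s}. \<Oplus>cs\<in>multi_indices s n. ?Q (a # as) (l # cs) \<otimes> ?P (l # cs) (b # bs))"
    by (rule finsum_multi_indices_Suc)
      (use Cons(1-4) in \<open>auto simp: multi_indices_Suc closed\<close>)
  \<comment> \<open>Here the single letters meet in the middle instead, so the sum over
    \<open>l\<close> has to become the inner one.\<close>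
  also have "\<dots> = (\<Oplus>cs\<in>multi_indices s n. \<Oplus>l\<in>{0..s}. ?Q (a # as) (l # cs) \<otimes> ?P (l # cs) (b # bs))"
    by (rule finsum_swap) (use Cons(1-4) in \<open>auto simp: closed\<close>)
  also have "\<dots> = (\<Oplus>cs\<in>multi_indices s n. (if a = b then 1 else 0) \<odot> (?Q as cs \<otimes> ?P cs bs))"
  proof (rule finsum_cong')
    fix cs assume cs: "cs \<in> multi_indices s n"
    have "(\<Oplus>l\<in>{0..s}. ?Q (a # as) (l # cs) \<otimes> ?P (l # cs) (b # bs))
        = (\<Oplus>l\<in>{0..s}. ?Q as cs \<otimes> (v a l \<otimes> x l b) \<otimes> ?P cs bs)"
      by (rule finsum_cong') (use Cons(1-4) cs in \<open>auto simp: closed m_assoc\<close>)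
    also have "\<dots> = ?Q as cs \<otimes> (\<Oplus>l\<in>{0..s}. v a l \<otimes> x l b) \<otimes> ?P cs bs"
      using Cons(1-4) cs by (simp add: closed finsum_ldistr finsum_rdistr Pi_def)
    also have "\<dots> = (if a = b then 1 else 0) \<odot> (?Q as cs \<otimes> ?P cs bs)"
      using Cons(3,4) cs unfolding inv[OF Cons(1,2)]
      by (simp add: closed smult_mult_left smult_mult_right)
    finally show "(\<Oplus>l\<in>{0..s}. ?Q (a # as) (l # cs) \<otimes> ?P (l # cs) (b # bs))
      = (if a = b then 1 else 0) \<odot> (?Q as cs \<otimes> ?P cs bs)" .
  qed (use Cons(3,4) in \<open>auto simp: closed\<close>)
  also have "\<dots> = (if a = b then 1 else 0) \<odot> (\<Oplus>cs\<in>multi_indices s n. ?Q as cs \<otimes> ?P cs bs)"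
    by (rule smult_finsum[symmetric]) (use Cons(3,4) in \<open>auto simp: closed\<close>)
  also have "\<dots> = (if a # as = b # bs then 1 else 0) \<odot> \<one>"
    unfolding Cons.IH by (simp add: smult_smult)
  finally show ?case .
qed (simp add: multi_indices_0)

end

text \<open>Products of pure tensors are taken leg by leg, so the middle letters of the factors
  concatenate to one middle multi-index \<open>cs\<close>.\<close>

lemma coproduct_word:
  assumes x: "matrix_in s (carrier A) x" and "as \<in> multi_indices s n" "bs \<in> multi_indices s n"
  shows "index_word (tensor_algebra A A) (\<lambda>a b. \<Oplus>\<^bsub>tensor_algebra A A\<^esub>l\<in>{0..s}. pure_tensor A A (x a l) (x l b)) as bs
    = (\<Oplus>\<^bsub>tensor_algebra A A\<^esub>cs\<in>multi_indices s n. pure_tensor A A (index_word A x as cs) (index_word A x cs bs))"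
  using assms(2,3)
proof (induction rule: multi_indices_induct2)
  interpret TP: tensor_pair A A by unfold_locales
  interpret T: assoc_algebra "tensor_algebra A A" by (rule TP.assoc_algebra_tensor)
  case Nil
  show ?case
    using T.one_closed by (simp add: multi_indices_0 TP.tensor_one)
next
  interpret TP: tensor_pair A A by unfold_locales
  interpret T: assoc_algebra "tensor_algebra A A" by (rule TP.assoc_algebra_tensor)
  note closed = matrix_inD[OF x] index_word_closed[OF x] TP.pure_tensor_closed
  case (Cons n a as b bs)
  let ?P = "index_word A x" and ?T = "tensor_algebra A A"
  let ?p = "\<lambda>l cs. pure_tensor A A (?P (a # as) (l # cs)) (?P (l # cs) (b # bs))"
  have "(\<Oplus>\<^bsub>?T\<^esub>l\<in>{0..s}. pure_tensor A A (x a l) (x l b))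
      \<otimes>\<^bsub>?T\<^esub> (\<Oplus>\<^bsub>?T\<^esub>cs\<in>multi_indices s n. pure_tensor A A (?P as cs) (?P cs bs))
    = (\<Oplus>\<^bsub>?T\<^esub>l\<in>{0..s}. \<Oplus>\<^bsub>?T\<^esub>cs\<in>multi_indices s n.
        pure_tensor A A (x a l) (x l b) \<otimes>\<^bsub>?T\<^esub> pure_tensor A A (?P as cs) (?P cs bs))"
    by (rule T.finsum_mult_finsum) (use Cons(1-4) in \<open>auto simp: closed\<close>)
  also have "\<dots> = (\<Oplus>\<^bsub>?T\<^esub>l\<in>{0..s}. \<Oplus>\<^bsub>?T\<^esub>cs\<in>multi_indices s n. ?p l cs)"
    using Cons(1-4) by (intro T.finsum_cong' T.finsum_closed)
      (auto simp: closed TP.pure_tensor_mult intro!: T.finsum_closed)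
  also have "\<dots> = (\<Oplus>\<^bsub>?T\<^esub>cs\<in>multi_indices s (Suc n). pure_tensor A A (?P (a # as) cs) (?P cs (b # bs)))"
    by (rule T.finsum_multi_indices_Suc[symmetric])
      (use Cons(1-4) in \<open>auto simp: multi_indices_Suc closed\<close>)
  finally show ?case unfolding index_word_Cons Cons.IH .
qed

end

text \<open>Associativity of contraction, (c P) Q = c (P Q), for an arbitrary bilinear pairing. It
  is applied with the product of the algebra and with the pure tensor.\<close>

lemma bilinear_sum_left:
  assumes "k_module A" "k_module C" "bilinear_map A B C \<phi>" "finite I" "finite J"
    and P: "\<And>i j. \<lbrakk>i \<in> I; j \<in> J\<rbrakk> \<Longrightarrow> P i j \<in> carrier A" and Q: "\<And>j. j \<in> J \<Longrightarrow> Q j \<in> carrier B"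
  shows "(\<Oplus>\<^bsub>C\<^esub>j\<in>J. \<phi> (\<Oplus>\<^bsub>A\<^esub>i\<in>I. c i \<odot>\<^bsub>A\<^esub> P i j) (Q j))
    = (\<Oplus>\<^bsub>C\<^esub>i\<in>I. c i \<odot>\<^bsub>C\<^esub> (\<Oplus>\<^bsub>C\<^esub>j\<in>J. \<phi> (P i j) (Q j)))"
proof -
  interpret A: k_module A by fact
  interpret C: k_module C by fact
  note closed = P Q bilinear_map_closed[OF assms(3)]
  have "(\<Oplus>\<^bsub>C\<^esub>j\<in>J. \<phi> (\<Oplus>\<^bsub>A\<^esub>i\<in>I. c i \<odot>\<^bsub>A\<^esub> P i j) (Q j)) = (\<Oplus>\<^bsub>C\<^esub>j\<in>J. \<Oplus>\<^bsub>C\<^esub>i\<in>I. c i \<odot>\<^bsub>C\<^esub> \<phi> (P i j) (Q j))"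
  proof (rule C.finsum_cong')
    fix j assume j: "j \<in> J"
    note lin = bilinear_map_left[OF assms(3) Q[OF j]]
    have "\<phi> (\<Oplus>\<^bsub>A\<^esub>i\<in>I. c i \<odot>\<^bsub>A\<^esub> P i j) (Q j) = (\<Oplus>\<^bsub>C\<^esub>i\<in>I. \<phi> (c i \<odot>\<^bsub>A\<^esub> P i j) (Q j))"
      by (rule lin_hom_finsum[OF assms(1,2) lin]) (use j P in auto)
    also have "\<dots> = (\<Oplus>\<^bsub>C\<^esub>i\<in>I. c i \<odot>\<^bsub>C\<^esub> \<phi> (P i j) (Q j))"
      by (rule C.finsum_cong') (use j closed lin_hom_smult[OF lin] in auto)
    finally show "\<phi> (\<Oplus>\<^bsub>A\<^esub>i\<in>I. c i \<odot>\<^bsub>A\<^esub> P i j) (Q j) = (\<Oplus>\<^bsub>C\<^esub>i\<in>I. c i \<odot>\<^bsub>C\<^esub> \<phi> (P i j) (Q j))" .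
  qed (use closed in \<open>auto intro!: C.finsum_closed\<close>)
  also have "\<dots> = (\<Oplus>\<^bsub>C\<^esub>i\<in>I. \<Oplus>\<^bsub>C\<^esub>j\<in>J. c i \<odot>\<^bsub>C\<^esub> \<phi> (P i j) (Q j))"
    by (rule C.finsum_swap) (use assms closed in auto)
  also have "\<dots> = (\<Oplus>\<^bsub>C\<^esub>i\<in>I. c i \<odot>\<^bsub>C\<^esub> (\<Oplus>\<^bsub>C\<^esub>j\<in>J. \<phi> (P i j) (Q j)))"
    by (rule C.finsum_cong') (use closed in \<open>auto intro!: C.finsum_closed C.smult_finsum[symmetric]\<close>)
  finally show ?thesis .
qed

lemma bilinear_sum_right:
  assumes "k_module B" "k_module C" "bilinear_map A B C \<phi>" "finite I" "finite J"
    and "\<And>j. j \<in> J \<Longrightarrow> P j \<in> carrier A" "\<And>i j. \<lbrakk>i \<in> I; j \<in> J\<rbrakk> \<Longrightarrow> Q j i \<in> carrier B"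
  shows "(\<Oplus>\<^bsub>C\<^esub>j\<in>J. \<phi> (P j) (\<Oplus>\<^bsub>B\<^esub>i\<in>I. c i \<odot>\<^bsub>B\<^esub> Q j i))
    = (\<Oplus>\<^bsub>C\<^esub>i\<in>I. c i \<odot>\<^bsub>C\<^esub> (\<Oplus>\<^bsub>C\<^esub>j\<in>J. \<phi> (P j) (Q j i)))"
proof (rule bilinear_sum_left[where \<phi> = "\<lambda>b a. \<phi> a b" and P = "\<lambda>i j. Q j i" and B = A, OF assms(1,2)])
  show "bilinear_map B A C (\<lambda>b a. \<phi> a b)"
    using assms(3) by (simp add: bilinear_map_def)
qed (use assms in auto)

lemma lin_hom_minus:
  assumes "k_module V" "k_module W" "f \<in> lin_hom V W" "x \<in> carrier V" "y \<in> carrier V"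
  shows "f (x \<ominus>\<^bsub>V\<^esub> y) = f x \<ominus>\<^bsub>W\<^esub> f y"
proof -
  interpret V: k_module V by fact
  interpret W: k_module W by fact
  show ?thesis
    using lin_hom_add[OF assms(3,4), of "(- 1) \<odot>\<^bsub>V\<^esub> y"] lin_hom_smult[OF assms(3,5), of "- 1"]
      lin_hom_closed[OF assms(3,5)] assms(5)
    by (simp add: V.minus_eq W.minus_eq V.smult_minus_one W.smult_minus_one)
qed

text \<open>The defining relations read at a matrix \<open>y\<close> over any algebra
  \<open>B\<close>. This is the condition under which sending generators to \<open>y\<close> defines
  a homomorphism.\<close>

definition form_relations ::
  "nat \<Rightarrow> nat \<Rightarrow> (nat list \<Rightarrow> 'k::field) \<Rightarrow> (nat list \<Rightarrow> 'k) \<Rightarrow> ('k, 'b) module \<Rightarrow> (nat \<Rightarrow> nat \<Rightarrow> 'b) \<Rightarrow> bool" where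
  "form_relations s m W W' B y \<longleftrightarrow>
     (\<forall>bs\<in>multi_indices s m.
        (\<Oplus>\<^bsub>B\<^esub>as\<in>multi_indices s m. W as \<odot>\<^bsub>B\<^esub> index_word B y as bs) = W bs \<odot>\<^bsub>B\<^esub> \<one>\<^bsub>B\<^esub>) \<and>
     (\<forall>as\<in>multi_indices s m.
        (\<Oplus>\<^bsub>B\<^esub>bs\<in>multi_indices s m. W' bs \<odot>\<^bsub>B\<^esub> index_word B y as bs) = W' as \<odot>\<^bsub>B\<^esub> \<one>\<^bsub>B\<^esub>)"

text \<open>The index maps \<open>f\<close> and \<open>g\<close> cover both families of relators:
  the summed multi-index stands in the upper place for \<open>W\<close> and in the lower place for
  \<open>W'\<close>, the other place being constant.\<close>

lemma algebra_hom_relator: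
  assumes "assoc_algebra A" "assoc_algebra B" "h \<in> algebra_hom A B" "matrix_in s (carrier A) x"
    and fg: "\<And>i. i \<in> I \<Longrightarrow> f i \<in> multi_indices s n" "\<And>i. i \<in> I \<Longrightarrow> g i \<in> multi_indices s n"
  shows "(\<Oplus>\<^bsub>A\<^esub>i\<in>I. c i \<odot>\<^bsub>A\<^esub> index_word A x (f i) (g i)) \<ominus>\<^bsub>A\<^esub> d \<odot>\<^bsub>A\<^esub> \<one>\<^bsub>A\<^esub> \<in> carrier A"
    and "h ((\<Oplus>\<^bsub>A\<^esub>i\<in>I. c i \<odot>\<^bsub>A\<^esub> index_word A x (f i) (g i)) \<ominus>\<^bsub>A\<^esub> d \<odot>\<^bsub>A\<^esub> \<one>\<^bsub>A\<^esub>)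
      = (\<Oplus>\<^bsub>B\<^esub>i\<in>I. c i \<odot>\<^bsub>B\<^esub> index_word B (\<lambda>a b. h (x a b)) (f i) (g i)) \<ominus>\<^bsub>B\<^esub> d \<odot>\<^bsub>B\<^esub> \<one>\<^bsub>B\<^esub>"
proof -
  interpret A: assoc_algebra A by fact
  interpret B: assoc_algebra B by fact
  note lin = algebra_hom_lin[OF assms(3)]
  note word = A.index_word_closed[OF assms(4) fg]
  have closed: "(\<Oplus>\<^bsub>A\<^esub>i\<in>I. c i \<odot>\<^bsub>A\<^esub> index_word A x (f i) (g i)) \<in> carrier A"
    using word by (intro A.finsum_closed) auto
  then show "(\<Oplus>\<^bsub>A\<^esub>i\<in>I. c i \<odot>\<^bsub>A\<^esub> index_word A x (f i) (g i)) \<ominus>\<^bsub>A\<^esub> d \<odot>\<^bsub>A\<^esub> \<one>\<^bsub>A\<^esub> \<in> carrier A"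
    by simp
  have "h (\<Oplus>\<^bsub>A\<^esub>i\<in>I. c i \<odot>\<^bsub>A\<^esub> index_word A x (f i) (g i))
      = (\<Oplus>\<^bsub>B\<^esub>i\<in>I. h (c i \<odot>\<^bsub>A\<^esub> index_word A x (f i) (g i)))"
    by (rule lin_hom_finsum[OF A.k_module B.k_module lin]) (use word in auto)
  also have "\<dots> = (\<Oplus>\<^bsub>B\<^esub>i\<in>I. c i \<odot>\<^bsub>B\<^esub> index_word B (\<lambda>a b. h (x a b)) (f i) (g i))"
    by (rule B.finsum_cong')
      (use word lin_hom_closed[OF lin] in \<open>auto simp: lin_hom_smult[OF lin]
        algebra_hom_index_word[OF assms(1,3,4) fg, symmetric]\<close>)
  finally show "h ((\<Oplus>\<^bsub>A\<^esub>i\<in>I. c i \<odot>\<^bsub>A\<^esub> index_word A x (f i) (g i)) \<ominus>\<^bsub>A\<^esub> d \<odot>\<^bsub>A\<^esub> \<one>\<^bsub>A\<^esub>)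
      = (\<Oplus>\<^bsub>B\<^esub>i\<in>I. c i \<odot>\<^bsub>B\<^esub> index_word B (\<lambda>a b. h (x a b)) (f i) (g i)) \<ominus>\<^bsub>B\<^esub> d \<odot>\<^bsub>B\<^esub> \<one>\<^bsub>B\<^esub>"
    using closed
    by (simp add: lin_hom_minus[OF A.k_module B.k_module lin] lin_hom_smult[OF lin]
      algebra_hom_one[OF assms(3)])
qed

lemma free_gen_matrix:
  "matrix_in s (carrier (free_algebra (form_gens s))) (\<lambda>a b. Poly_Mapping.single [(a, b)] 1)"
  by (simp add: matrix_in_def free_algebra_single_closed form_gens_def)

lemma form_relators_cases:
  assumes "r \<in> form_relators s m W W'"
  obtains (W) bs where "bs \<in> multi_indices s m"
      "r = (\<Oplus>\<^bsub>free_algebra (form_gens s)\<^esub>as\<in>multi_indices s m. W as \<odot>\<^bsub>free_algebra (form_gens s)\<^esub>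
          index_word (free_algebra (form_gens s)) (\<lambda>a b. Poly_Mapping.single [(a, b)] 1) as bs)
        \<ominus>\<^bsub>free_algebra (form_gens s)\<^esub> W bs \<odot>\<^bsub>free_algebra (form_gens s)\<^esub> \<one>\<^bsub>free_algebra (form_gens s)\<^esub>"
  | (W') as where "as \<in> multi_indices s m"
      "r = (\<Oplus>\<^bsub>free_algebra (form_gens s)\<^esub>bs\<in>multi_indices s m. W' bs \<odot>\<^bsub>free_algebra (form_gens s)\<^esub>
          index_word (free_algebra (form_gens s)) (\<lambda>a b. Poly_Mapping.single [(a, b)] 1) as bs)
        \<ominus>\<^bsub>free_algebra (form_gens s)\<^esub> W' as \<odot>\<^bsub>free_algebra (form_gens s)\<^esub> \<one>\<^bsub>free_algebra (form_gens s)\<^esub>"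
  using assms unfolding form_relators_def Let_def Un_iff mem_Collect_eq
  by - (elim disjE exE conjE; (rule that; assumption))

lemma form_relatorsI:
  fixes s m :: nat and W W' :: "nat list \<Rightarrow> 'k::field"
  defines "F \<equiv> free_algebra (form_gens s) :: ('k, (nat \<times> nat) list \<Rightarrow>\<^sub>0 'k) module"
    and "x \<equiv> \<lambda>a b. Poly_Mapping.single [(a, b)] 1"
  shows "bs \<in> multi_indices s m \<Longrightarrow>
      (\<Oplus>\<^bsub>F\<^esub>as\<in>multi_indices s m. W as \<odot>\<^bsub>F\<^esub> index_word F x as bs) \<ominus>\<^bsub>F\<^esub> W bs \<odot>\<^bsub>F\<^esub> \<one>\<^bsub>F\<^esub>
        \<in> form_relators s m W W'"
    and "as \<in> multi_indices s m \<Longrightarrow>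
      (\<Oplus>\<^bsub>F\<^esub>bs\<in>multi_indices s m. W' bs \<odot>\<^bsub>F\<^esub> index_word F x as bs) \<ominus>\<^bsub>F\<^esub> W' as \<odot>\<^bsub>F\<^esub> \<one>\<^bsub>F\<^esub>
        \<in> form_relators s m W W'"
  unfolding form_relators_def Let_def F_def x_def by blast+

lemma form_relators_closed: "form_relators s m W W' \<subseteq> carrier (free_algebra (form_gens s))"
proof
  fix r assume "r \<in> form_relators s m W W'"
  then show "r \<in> carrier (free_algebra (form_gens s))"
  proof (cases rule: form_relators_cases)
    case (W bs)
    show ?thesis unfolding W(2)
      \<comment> \<open>Membership in the carrier involves one algebra only, so the identity serves
        as the homomorphism.\<close>
      by (rule algebra_hom_relator(1)[OF assoc_algebra_free assoc_algebra_free _ free_gen_matrix, of "\<lambda>x. x"])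
        (use W(1) in \<open>auto intro: algebra_homI lin_hom_id\<close>)
  next
    case (W' as)
    show ?thesis unfolding W'(2)
      by (rule algebra_hom_relator(1)[OF assoc_algebra_free assoc_algebra_free _ free_gen_matrix, of "\<lambda>x. x"])
        (use W'(1) in \<open>auto intro: algebra_homI lin_hom_id\<close>)
  qed
qed

section \<open>The algebra of a pair of component families and its universal property\<close>

locale form_algebra_setup =
  fixes s m :: nat and W W' :: "nat list \<Rightarrow> 'k::field"
begin

abbreviation "H \<equiv> form_algebra s m W W'"
abbreviation "u \<equiv> form_gen s m W W'"
abbreviation "I \<equiv> multi_indices s"
abbreviation "P \<equiv> index_word H u"

sublocale pres: presentation "form_gens s" "form_relators s m W W'"
  by (rule presentation.intro[OF form_relators_closed])

sublocale H: assoc_algebra H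
  unfolding form_algebra_def by (rule pres.assoc_algebra_axioms)

lemma gen_closed: "matrix_in s (carrier H) u"
  unfolding matrix_in_def form_gen_def form_algebra_def
  by (intro ballI pres.presented_gen_closed) (simp add: form_gens_def)

lemmas word_closed = H.index_word_closed[OF gen_closed]

text \<open>A word in pairs of indices becomes an entry of a word matrix, with upper indices as the
  row and lower indices as the column.\<close>

lemma foldr_gens:
  "foldr (\<otimes>\<^bsub>H\<^esub>) (map (presented_gen (form_gens s) (form_relators s m W W')) w) \<one>\<^bsub>H\<^esub> = P (map fst w) (map snd w)"
  by (induction w) (simp_all add: form_gen_def)

text \<open>The entries of the matrices \<open>P\<close> of all lengths span \<open>H\<close>. Every
  axiom that is linear but not evidently multiplicative is verified by this rule.\<close>

lemma lin_hom_form_eqI: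
  assumes "k_module C" "f \<in> lin_hom H C" "g \<in> lin_hom H C"
    and "\<And>n as bs. \<lbrakk>as \<in> I n; bs \<in> I n\<rbrakk> \<Longrightarrow> f (P as bs) = g (P as bs)"
    and "x \<in> carrier H"
  shows "f x = g x"
proof (rule pres.lin_hom_presented_eqI[folded form_algebra_def, OF assms(1-3) _ assms(5)])
  fix w assume "w \<in> lists (form_gens s)"
  then have "map fst w \<in> I (length w)" "map snd w \<in> I (length w)"
    by (auto simp: multi_indices_def form_gens_def lists_eq_set subset_iff)
  then show "f (foldr (\<otimes>\<^bsub>H\<^esub>) (map (presented_gen (form_gens s) (form_relators s m W W')) w) \<one>\<^bsub>H\<^esub>)
      = g (foldr (\<otimes>\<^bsub>H\<^esub>) (map (presented_gen (form_gens s) (form_relators s m W W')) w) \<one>\<^bsub>H\<^esub>)"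
    unfolding foldr_gens by (rule assms(4))
qed

lemma algebra_hom_form_eqI:
  assumes "assoc_algebra B" "f \<in> algebra_hom H B" "g \<in> algebra_hom H B"
    and "\<And>a b. \<lbrakk>a \<in> {0..s}; b \<in> {0..s}\<rbrakk> \<Longrightarrow> f (u a b) = g (u a b)" "x \<in> carrier H"
  shows "f x = g x"
proof (rule lin_hom_form_eqI[OF assoc_algebra.k_module[OF assms(1)] algebra_hom_lin[OF assms(2)]
        algebra_hom_lin[OF assms(3)] _ assms(5)])
  fix n as bs assume *: "as \<in> I n" "bs \<in> I n"
  note word = algebra_hom_index_word[OF H.assoc_algebra_axioms _ gen_closed *]
  show "f (P as bs) = g (P as bs)"
    unfolding word[OF assms(2)] word[OF assms(3)] by (rule index_word_cong[OF * assms(4)])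
qed

text \<open>The projection from the free algebra kills the relators, which are differences of the
  two sides.\<close>

lemma form_relations_gen: "form_relations s m W W' H u"
proof -
  note hom = pres.presented_proj_hom[folded form_algebra_def]
  have u: "u a b = pres.pres_proj (Poly_Mapping.single [(a, b)] 1)" for a b
    by (simp add: form_gen_def presented_gen_def)
  note rel = algebra_hom_relator(2)[OF assoc_algebra_free H.assoc_algebra_axioms hom free_gen_matrix, folded u]
  have cancel: "x = y" if "x \<ominus>\<^bsub>H\<^esub> y = \<zero>\<^bsub>H\<^esub>" "x \<in> carrier H" "y \<in> carrier H" for x y
    using that by (simp add: H.minus_eq H.minus_equality[symmetric] H.add.inv_solve_right')
  have zero: "pres.pres_proj r = \<zero>\<^bsub>H\<^esub>" if "r \<in> form_relators s m W W'" for r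
    using pres.presented_proj_relator[OF that] by (simp add: form_algebra_def)
  show ?thesis unfolding form_relations_def
  proof (intro conjI ballI; rule cancel)
    fix bs assume bs: "bs \<in> I m"
    show "(\<Oplus>\<^bsub>H\<^esub>as\<in>I m. W as \<odot>\<^bsub>H\<^esub> P as bs) \<ominus>\<^bsub>H\<^esub> W bs \<odot>\<^bsub>H\<^esub> \<one>\<^bsub>H\<^esub> = \<zero>\<^bsub>H\<^esub>"
      by (subst rel[symmetric]) (use bs in \<open>simp_all add: zero form_relatorsI\<close>)
    show "(\<Oplus>\<^bsub>H\<^esub>as\<in>I m. W' as \<odot>\<^bsub>H\<^esub> P bs as) \<ominus>\<^bsub>H\<^esub> W' bs \<odot>\<^bsub>H\<^esub> \<one>\<^bsub>H\<^esub> = \<zero>\<^bsub>H\<^esub>"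
      by (subst rel[symmetric]) (use bs in \<open>simp_all add: zero form_relatorsI\<close>)
  qed (auto intro!: H.finsum_closed simp: word_closed)
qed

lemma form_hom_exists:
  assumes "assoc_algebra B" "matrix_in s (carrier B) y" "form_relations s m W W' B y"
  obtains h where "h \<in> algebra_hom H B" "\<And>a b. \<lbrakk>a \<in> {0..s}; b \<in> {0..s}\<rbrakk> \<Longrightarrow> h (u a b) = y a b"
proof -
  interpret B: assoc_algebra B by fact
  let ?x = "\<lambda>z. y (fst z) (snd z)"
  have x: "?x \<in> form_gens s \<rightarrow> carrier B"
    using assms(2) by (auto simp: form_gens_def matrix_in_def)
  note rel = algebra_hom_relator(2)[OF assoc_algebra_free assms(1) B.free_lift_algebra_hom[OF x] free_gen_matrix]
  have gen: "free_lift B ?x (Poly_Mapping.single [(a, b)] 1) = y a b" if "a \<in> {0..s}" "b \<in> {0..s}" for a b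
    using matrix_inD[OF assms(2) that] by (subst B.free_lift_gen) auto
  have word: "index_word B (\<lambda>a b. free_lift B ?x (Poly_Mapping.single [(a, b)] 1)) as bs = index_word B y as bs"
    if "as \<in> I n" "bs \<in> I n" for as bs n
    by (rule index_word_cong[OF that gen])
  have zero: "z \<ominus>\<^bsub>B\<^esub> z = \<zero>\<^bsub>B\<^esub>" if "z \<in> carrier B" for z
    using that by (simp add: B.minus_eq B.r_neg)
  have relator: "free_lift B ?x r = \<zero>\<^bsub>B\<^esub>" if "r \<in> form_relators s m W W'" for r
    using that
  proof (cases rule: form_relators_cases)
    case (W bs)
    have "(\<Oplus>\<^bsub>B\<^esub>as\<in>I m. W as \<odot>\<^bsub>B\<^esub> index_word B (\<lambda>a b. free_lift B ?x (Poly_Mapping.single [(a, b)] 1)) as bs)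
        = (\<Oplus>\<^bsub>B\<^esub>as\<in>I m. W as \<odot>\<^bsub>B\<^esub> index_word B y as bs)"
      by (rule B.finsum_cong') (use W(1) B.index_word_closed[OF assms(2)] word in auto)
    then show ?thesis
      unfolding W(2) using assms(3) W(1)
      by (subst rel) (auto simp: form_relations_def zero)
  next
    case (W' as)
    have "(\<Oplus>\<^bsub>B\<^esub>bs\<in>I m. W' bs \<odot>\<^bsub>B\<^esub> index_word B (\<lambda>a b. free_lift B ?x (Poly_Mapping.single [(a, b)] 1)) as bs)
        = (\<Oplus>\<^bsub>B\<^esub>bs\<in>I m. W' bs \<odot>\<^bsub>B\<^esub> index_word B y as bs)"
      by (rule B.finsum_cong') (use W'(1) B.index_word_closed[OF assms(2)] word in auto)
    then show ?thesis
      unfolding W'(2) using assms(3) W'(1)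
      by (subst rel) (auto simp: form_relations_def zero)
  qed
  obtain h where "h \<in> algebra_hom (presented_algebra (form_gens s) (form_relators s m W W')) B"
    and h: "\<And>z. z \<in> form_gens s \<Longrightarrow> h (presented_gen (form_gens s) (form_relators s m W W') z) = ?x z"
    using pres.presented_hom_exists[OF assms(1) x relator] by blast
  then show thesis
    by (intro that[of h]) (auto simp: form_algebra_def form_gen_def form_gens_def)
qed

end

section \<open>The Hopf algebra structure\<close>

text \<open>Positivity of \<open>m\<close> makes \<open>m - 1\<close> a true predecessor, as
  splitting one index off a multi-index of length \<open>m\<close> requires.\<close>

locale form_pair = form_algebra_setup s m W W'
  for s m :: nat and W W' :: "nat list \<Rightarrow> 'k::field" +
  assumes m_pos: "0 < m"
    and duality: "\<And>a b. \<lbrakk>a \<in> {0..s}; b \<in> {0..s}\<rbrakk> \<Longrightarrow>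
      (\<Sum>cs\<in>multi_indices s (m - 1). W' (a # cs) * W (cs @ [b])) = (if a = b then 1 else 0)"
begin

section \<open>The candidate antipode as the inverse of the generator matrix\<close>

definition v :: "nat \<Rightarrow> nat \<Rightarrow> ((nat \<times> nat) list \<Rightarrow>\<^sub>0 'k) set" where
  "v a b = (\<Oplus>\<^bsub>H\<^esub>ls\<in>I (m - 1). \<Oplus>\<^bsub>H\<^esub>rs\<in>I (m - 1). (W' (a # ls) * W (rs @ [b])) \<odot>\<^bsub>H\<^esub> P rs ls)"

abbreviation "Q \<equiv> index_word (opposite_algebra H) v"
abbreviation "T \<equiv> tensor_algebra H H"

sublocale HH: tensor_pair H H
  by unfold_locales

sublocale T: assoc_algebra T
  by (rule HH.assoc_algebra_tensor)

lemma v_closed: "matrix_in s (carrier H) v"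
  unfolding matrix_in_def v_def by (auto intro!: H.finsum_closed simp: word_closed)

lemmas opp = H.assoc_algebra_opposite

lemma v_closed_opp: "matrix_in s (carrier (opposite_algebra H)) v"
  using v_closed by simp

lemmas Q_closed = assoc_algebra.index_word_closed[OF opp v_closed_opp, simplified]

lemma m_Suc: "Suc (m - 1) = m"
  using m_pos by simp

lemma relation_W: "bs \<in> I m \<Longrightarrow> (\<Oplus>\<^bsub>H\<^esub>as\<in>I m. W as \<odot>\<^bsub>H\<^esub> P as bs) = W bs \<odot>\<^bsub>H\<^esub> \<one>\<^bsub>H\<^esub>"
  and relation_W': "as \<in> I m \<Longrightarrow> (\<Oplus>\<^bsub>H\<^esub>bs\<in>I m. W' bs \<odot>\<^bsub>H\<^esub> P as bs) = W' as \<odot>\<^bsub>H\<^esub> \<one>\<^bsub>H\<^esub>"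
  using form_relations_gen unfolding form_relations_def by blast+

lemma duality_one:
  assumes "a \<in> {0..s}" "b \<in> {0..s}"
  shows "(\<Oplus>\<^bsub>H\<^esub>cs\<in>I (m - 1). (W' (a # cs) * W (cs @ [b])) \<odot>\<^bsub>H\<^esub> \<one>\<^bsub>H\<^esub>) = (if a = b then 1 else 0) \<odot>\<^bsub>H\<^esub> \<one>\<^bsub>H\<^esub>"
  by (subst H.finsum_smult) (simp_all only: H.one_closed duality[OF assms])

text \<open>The factor \<open>u c b\<close> completes \<open>P rs ls\<close> to a word of length
  \<open>m\<close> whose upper index \<open>rs @ [c]\<close> is contracted with \<open>W\<close>.
  The relation of \<open>W\<close> replaces this by \<open>W (ls @ [b])\<close>, and the remaining
  sum is the duality condition.\<close>

lemma v_u: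
  assumes "a \<in> {0..s}" "b \<in> {0..s}"
  shows "(\<Oplus>\<^bsub>H\<^esub>c\<in>{0..s}. v a c \<otimes>\<^bsub>H\<^esub> u c b) = (if a = b then 1 else 0) \<odot>\<^bsub>H\<^esub> \<one>\<^bsub>H\<^esub>"
proof -
  let ?J = "I (m - 1)"
  note closed = word_closed matrix_inD[OF gen_closed]
  have word: "P (rs @ [c]) (ls @ [b]) = P rs ls \<otimes>\<^bsub>H\<^esub> u c b" "P (rs @ [c]) (ls @ [b]) \<in> carrier H"
    if "rs \<in> ?J" "ls \<in> ?J" "c \<in> {0..s}" for rs ls c
    using that assms H.index_word_snoc[OF gen_closed that(1,2,3) assms(2)] by (auto simp: closed)
  have "(\<Oplus>\<^bsub>H\<^esub>c\<in>{0..s}. v a c \<otimes>\<^bsub>H\<^esub> u c b)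
      = (\<Oplus>\<^bsub>H\<^esub>c\<in>{0..s}. \<Oplus>\<^bsub>H\<^esub>ls\<in>?J. W' (a # ls) \<odot>\<^bsub>H\<^esub> (\<Oplus>\<^bsub>H\<^esub>rs\<in>?J. W (rs @ [c]) \<odot>\<^bsub>H\<^esub> P (rs @ [c]) (ls @ [b])))"
  proof (rule H.finsum_cong')
    fix c assume c: "c \<in> {0..s}"
    have "v a c \<otimes>\<^bsub>H\<^esub> u c b = (\<Oplus>\<^bsub>H\<^esub>ls\<in>?J. (\<Oplus>\<^bsub>H\<^esub>rs\<in>?J. (W' (a # ls) * W (rs @ [c])) \<odot>\<^bsub>H\<^esub> P rs ls) \<otimes>\<^bsub>H\<^esub> u c b)"
      unfolding v_def
      by (rule H.finsum_ldistr) (use c assms in \<open>auto intro!: H.finsum_closed simp: closed\<close>)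
    also have "\<dots> = (\<Oplus>\<^bsub>H\<^esub>ls\<in>?J. W' (a # ls) \<odot>\<^bsub>H\<^esub> (\<Oplus>\<^bsub>H\<^esub>rs\<in>?J. W (rs @ [c]) \<odot>\<^bsub>H\<^esub> P (rs @ [c]) (ls @ [b])))"
    proof (rule H.finsum_cong')
      fix ls assume ls: "ls \<in> ?J"
      have "(\<Oplus>\<^bsub>H\<^esub>rs\<in>?J. (W' (a # ls) * W (rs @ [c])) \<odot>\<^bsub>H\<^esub> P rs ls) \<otimes>\<^bsub>H\<^esub> u c b
          = (\<Oplus>\<^bsub>H\<^esub>rs\<in>?J. ((W' (a # ls) * W (rs @ [c])) \<odot>\<^bsub>H\<^esub> P rs ls) \<otimes>\<^bsub>H\<^esub> u c b)"
        by (rule H.finsum_ldistr) (use c ls assms in \<open>auto simp: closed\<close>)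
      also have "\<dots> = (\<Oplus>\<^bsub>H\<^esub>rs\<in>?J. W' (a # ls) \<odot>\<^bsub>H\<^esub> (W (rs @ [c]) \<odot>\<^bsub>H\<^esub> P (rs @ [c]) (ls @ [b])))"
        by (rule H.finsum_cong')
          (use c ls assms in \<open>auto simp: closed word H.smult_smult H.smult_mult_left\<close>)
      also have "\<dots> = W' (a # ls) \<odot>\<^bsub>H\<^esub> (\<Oplus>\<^bsub>H\<^esub>rs\<in>?J. W (rs @ [c]) \<odot>\<^bsub>H\<^esub> P (rs @ [c]) (ls @ [b]))"
        by (rule H.smult_finsum[symmetric]) (use c ls in \<open>auto simp: word(2)\<close>)
      finally show "(\<Oplus>\<^bsub>H\<^esub>rs\<in>?J. (W' (a # ls) * W (rs @ [c])) \<odot>\<^bsub>H\<^esub> P rs ls) \<otimes>\<^bsub>H\<^esub> u c b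
        = W' (a # ls) \<odot>\<^bsub>H\<^esub> (\<Oplus>\<^bsub>H\<^esub>rs\<in>?J. W (rs @ [c]) \<odot>\<^bsub>H\<^esub> P (rs @ [c]) (ls @ [b]))" .
    qed (use c in \<open>auto intro!: H.finsum_closed simp: word(2)\<close>)
    finally show "v a c \<otimes>\<^bsub>H\<^esub> u c b
      = (\<Oplus>\<^bsub>H\<^esub>ls\<in>?J. W' (a # ls) \<odot>\<^bsub>H\<^esub> (\<Oplus>\<^bsub>H\<^esub>rs\<in>?J. W (rs @ [c]) \<odot>\<^bsub>H\<^esub> P (rs @ [c]) (ls @ [b])))" .
  qed (auto intro!: H.finsum_closed simp: word(2))
  \<comment> \<open>The index \<open>c\<close> is summed before \<open>ls\<close>, because
    \<open>c\<close> and \<open>rs\<close> together make up the index contracted with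
    \<open>W\<close>.\<close>
  also have "\<dots> = (\<Oplus>\<^bsub>H\<^esub>ls\<in>?J. \<Oplus>\<^bsub>H\<^esub>c\<in>{0..s}. W' (a # ls) \<odot>\<^bsub>H\<^esub> (\<Oplus>\<^bsub>H\<^esub>rs\<in>?J. W (rs @ [c]) \<odot>\<^bsub>H\<^esub> P (rs @ [c]) (ls @ [b])))"
    by (rule H.finsum_swap) (auto intro!: H.finsum_closed simp: word(2))
  also have "\<dots> = (\<Oplus>\<^bsub>H\<^esub>ls\<in>?J. (W' (a # ls) * W (ls @ [b])) \<odot>\<^bsub>H\<^esub> \<one>\<^bsub>H\<^esub>)"
  proof (rule H.finsum_cong')
    fix ls assume ls: "ls \<in> ?J"
    \<comment> \<open>The relation of \<open>W\<close> speaks of multi-indices of length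
      \<open>m\<close>, while the sums run over length \<open>m - 1\<close>; \<open>m_Suc\<close>
      bridges the two.\<close>
    have lsb: "ls @ [b] \<in> I m" using ls assms(2) snoc_multi_indices[of ls b s "m - 1", unfolded m_Suc] by simp
    have "(\<Oplus>\<^bsub>H\<^esub>c\<in>{0..s}. \<Oplus>\<^bsub>H\<^esub>rs\<in>?J. W (rs @ [c]) \<odot>\<^bsub>H\<^esub> P (rs @ [c]) (ls @ [b]))
        = (\<Oplus>\<^bsub>H\<^esub>as\<in>I m. W as \<odot>\<^bsub>H\<^esub> P as (ls @ [b]))"
      using H.finsum_multi_indices_snoc[of "\<lambda>as. W as \<odot>\<^bsub>H\<^esub> P as (ls @ [b])" s "m - 1", unfolded m_Suc]
        lsb word_closed[of _ m "ls @ [b]"] by auto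
    also have "\<dots> = W (ls @ [b]) \<odot>\<^bsub>H\<^esub> \<one>\<^bsub>H\<^esub>"
      by (rule relation_W[OF lsb])
    finally have eq: "(\<Oplus>\<^bsub>H\<^esub>c\<in>{0..s}. \<Oplus>\<^bsub>H\<^esub>rs\<in>?J. W (rs @ [c]) \<odot>\<^bsub>H\<^esub> P (rs @ [c]) (ls @ [b]))
      = W (ls @ [b]) \<odot>\<^bsub>H\<^esub> \<one>\<^bsub>H\<^esub>" .
    have "(\<Oplus>\<^bsub>H\<^esub>c\<in>{0..s}. W' (a # ls) \<odot>\<^bsub>H\<^esub> (\<Oplus>\<^bsub>H\<^esub>rs\<in>?J. W (rs @ [c]) \<odot>\<^bsub>H\<^esub> P (rs @ [c]) (ls @ [b])))
        = W' (a # ls) \<odot>\<^bsub>H\<^esub> (\<Oplus>\<^bsub>H\<^esub>c\<in>{0..s}. \<Oplus>\<^bsub>H\<^esub>rs\<in>?J. W (rs @ [c]) \<odot>\<^bsub>H\<^esub> P (rs @ [c]) (ls @ [b]))"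
      by (rule H.smult_finsum[symmetric]) (use ls in \<open>auto intro!: H.finsum_closed simp: word(2)\<close>)
    then show "(\<Oplus>\<^bsub>H\<^esub>c\<in>{0..s}. W' (a # ls) \<odot>\<^bsub>H\<^esub> (\<Oplus>\<^bsub>H\<^esub>rs\<in>?J. W (rs @ [c]) \<odot>\<^bsub>H\<^esub> P (rs @ [c]) (ls @ [b])))
        = (W' (a # ls) * W (ls @ [b])) \<odot>\<^bsub>H\<^esub> \<one>\<^bsub>H\<^esub>"
      unfolding eq by (simp add: H.smult_smult)
  qed auto
  also have "\<dots> = (if a = b then 1 else 0) \<odot>\<^bsub>H\<^esub> \<one>\<^bsub>H\<^esub>" by (rule duality_one[OF assms])
  finally show ?thesis .
qed

text \<open>Now \<open>u a c\<close> completes the word on the left, and its lower index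
  \<open>c # ls\<close> is contracted with \<open>W'\<close>. What is left over is again
  \<open>W'\<close> followed by \<open>W\<close>, so the same duality condition makes
  \<open>v\<close> an inverse on this side too.\<close>

lemma u_v:
  assumes "a \<in> {0..s}" "b \<in> {0..s}"
  shows "(\<Oplus>\<^bsub>H\<^esub>c\<in>{0..s}. u a c \<otimes>\<^bsub>H\<^esub> v c b) = (if a = b then 1 else 0) \<odot>\<^bsub>H\<^esub> \<one>\<^bsub>H\<^esub>"
proof -
  let ?J = "I (m - 1)"
  note closed = word_closed matrix_inD[OF gen_closed]
  have word: "P (a # rs) (c # ls) = u a c \<otimes>\<^bsub>H\<^esub> P rs ls" "P (a # rs) (c # ls) \<in> carrier H"
    if "rs \<in> ?J" "ls \<in> ?J" "c \<in> {0..s}" for rs ls c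
    using that assms by (auto simp: closed)
  have "(\<Oplus>\<^bsub>H\<^esub>c\<in>{0..s}. u a c \<otimes>\<^bsub>H\<^esub> v c b)
      = (\<Oplus>\<^bsub>H\<^esub>c\<in>{0..s}. \<Oplus>\<^bsub>H\<^esub>rs\<in>?J. W (rs @ [b]) \<odot>\<^bsub>H\<^esub> (\<Oplus>\<^bsub>H\<^esub>ls\<in>?J. W' (c # ls) \<odot>\<^bsub>H\<^esub> P (a # rs) (c # ls)))"
  proof (rule H.finsum_cong')
    fix c assume c: "c \<in> {0..s}"
    \<comment> \<open>In the definition of \<open>v\<close> the sum over \<open>rs\<close> is the
      inner one. Here the contraction with \<open>W'\<close> comes first, so \<open>ls\<close> has
      to be innermost.\<close>
    have "v c b = (\<Oplus>\<^bsub>H\<^esub>rs\<in>?J. \<Oplus>\<^bsub>H\<^esub>ls\<in>?J. (W' (c # ls) * W (rs @ [b])) \<odot>\<^bsub>H\<^esub> P rs ls)"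
      unfolding v_def by (rule H.finsum_swap) (auto simp: closed)
    then have "u a c \<otimes>\<^bsub>H\<^esub> v c b = (\<Oplus>\<^bsub>H\<^esub>rs\<in>?J. u a c \<otimes>\<^bsub>H\<^esub> (\<Oplus>\<^bsub>H\<^esub>ls\<in>?J. (W' (c # ls) * W (rs @ [b])) \<odot>\<^bsub>H\<^esub> P rs ls))"
      by (simp only:, intro H.finsum_rdistr)
        (use c assms in \<open>auto intro!: H.finsum_closed simp: closed\<close>)
    also have "\<dots> = (\<Oplus>\<^bsub>H\<^esub>rs\<in>?J. W (rs @ [b]) \<odot>\<^bsub>H\<^esub> (\<Oplus>\<^bsub>H\<^esub>ls\<in>?J. W' (c # ls) \<odot>\<^bsub>H\<^esub> P (a # rs) (c # ls)))"
    proof (rule H.finsum_cong')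
      fix rs assume rs: "rs \<in> ?J"
      have "u a c \<otimes>\<^bsub>H\<^esub> (\<Oplus>\<^bsub>H\<^esub>ls\<in>?J. (W' (c # ls) * W (rs @ [b])) \<odot>\<^bsub>H\<^esub> P rs ls)
          = (\<Oplus>\<^bsub>H\<^esub>ls\<in>?J. u a c \<otimes>\<^bsub>H\<^esub> ((W' (c # ls) * W (rs @ [b])) \<odot>\<^bsub>H\<^esub> P rs ls))"
        by (rule H.finsum_rdistr) (use c rs assms in \<open>auto simp: closed\<close>)
      also have "\<dots> = (\<Oplus>\<^bsub>H\<^esub>ls\<in>?J. W (rs @ [b]) \<odot>\<^bsub>H\<^esub> (W' (c # ls) \<odot>\<^bsub>H\<^esub> P (a # rs) (c # ls)))"
        by (rule H.finsum_cong')
          (use c rs assms in \<open>auto simp: closed H.smult_smult H.smult_mult_right mult.commute\<close>)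
      also have "\<dots> = W (rs @ [b]) \<odot>\<^bsub>H\<^esub> (\<Oplus>\<^bsub>H\<^esub>ls\<in>?J. W' (c # ls) \<odot>\<^bsub>H\<^esub> P (a # rs) (c # ls))"
        by (rule H.smult_finsum[symmetric]) (use c rs word(2) in auto)
      finally show "u a c \<otimes>\<^bsub>H\<^esub> (\<Oplus>\<^bsub>H\<^esub>ls\<in>?J. (W' (c # ls) * W (rs @ [b])) \<odot>\<^bsub>H\<^esub> P rs ls)
        = W (rs @ [b]) \<odot>\<^bsub>H\<^esub> (\<Oplus>\<^bsub>H\<^esub>ls\<in>?J. W' (c # ls) \<odot>\<^bsub>H\<^esub> P (a # rs) (c # ls))" .
    qed (use c word(2) in \<open>auto intro!: H.finsum_closed H.smult_closed simp del: index_word_Cons\<close>)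
    finally show "u a c \<otimes>\<^bsub>H\<^esub> v c b
      = (\<Oplus>\<^bsub>H\<^esub>rs\<in>?J. W (rs @ [b]) \<odot>\<^bsub>H\<^esub> (\<Oplus>\<^bsub>H\<^esub>ls\<in>?J. W' (c # ls) \<odot>\<^bsub>H\<^esub> P (a # rs) (c # ls)))" .
  qed (use word(2) in \<open>auto intro!: H.finsum_closed H.smult_closed simp del: index_word_Cons\<close>)
  also have "\<dots> = (\<Oplus>\<^bsub>H\<^esub>rs\<in>?J. \<Oplus>\<^bsub>H\<^esub>c\<in>{0..s}. W (rs @ [b]) \<odot>\<^bsub>H\<^esub> (\<Oplus>\<^bsub>H\<^esub>ls\<in>?J. W' (c # ls) \<odot>\<^bsub>H\<^esub> P (a # rs) (c # ls)))"
    by (rule H.finsum_swap)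
      (use word(2) in \<open>auto intro!: H.finsum_closed H.smult_closed simp del: index_word_Cons\<close>)
  also have "\<dots> = (\<Oplus>\<^bsub>H\<^esub>rs\<in>?J. (W' (a # rs) * W (rs @ [b])) \<odot>\<^bsub>H\<^esub> \<one>\<^bsub>H\<^esub>)"
  proof (rule H.finsum_cong')
    fix rs assume rs: "rs \<in> ?J"
    have ars: "a # rs \<in> I m" using rs assms(1) Cons_multi_indices[of a rs s "m - 1", unfolded m_Suc] by simp
    have "(\<Oplus>\<^bsub>H\<^esub>c\<in>{0..s}. \<Oplus>\<^bsub>H\<^esub>ls\<in>?J. W' (c # ls) \<odot>\<^bsub>H\<^esub> P (a # rs) (c # ls))
        = (\<Oplus>\<^bsub>H\<^esub>bs\<in>I m. W' bs \<odot>\<^bsub>H\<^esub> P (a # rs) bs)"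
      using H.finsum_multi_indices_Suc[of "\<lambda>bs. W' bs \<odot>\<^bsub>H\<^esub> P (a # rs) bs" s "m - 1", unfolded m_Suc]
        ars word_closed[of "a # rs" m] by (auto simp del: index_word_Cons)
    also have "\<dots> = W' (a # rs) \<odot>\<^bsub>H\<^esub> \<one>\<^bsub>H\<^esub>"
      by (rule relation_W'[OF ars])
    finally have eq: "(\<Oplus>\<^bsub>H\<^esub>c\<in>{0..s}. \<Oplus>\<^bsub>H\<^esub>ls\<in>?J. W' (c # ls) \<odot>\<^bsub>H\<^esub> P (a # rs) (c # ls))
      = W' (a # rs) \<odot>\<^bsub>H\<^esub> \<one>\<^bsub>H\<^esub>" .
    have "(\<Oplus>\<^bsub>H\<^esub>c\<in>{0..s}. W (rs @ [b]) \<odot>\<^bsub>H\<^esub> (\<Oplus>\<^bsub>H\<^esub>ls\<in>?J. W' (c # ls) \<odot>\<^bsub>H\<^esub> P (a # rs) (c # ls)))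
        = W (rs @ [b]) \<odot>\<^bsub>H\<^esub> (\<Oplus>\<^bsub>H\<^esub>c\<in>{0..s}. \<Oplus>\<^bsub>H\<^esub>ls\<in>?J. W' (c # ls) \<odot>\<^bsub>H\<^esub> P (a # rs) (c # ls))"
      by (rule H.smult_finsum[symmetric])
        (use rs word(2) in \<open>auto intro!: H.finsum_closed H.smult_closed simp del: index_word_Cons\<close>)
    then show "(\<Oplus>\<^bsub>H\<^esub>c\<in>{0..s}. W (rs @ [b]) \<odot>\<^bsub>H\<^esub> (\<Oplus>\<^bsub>H\<^esub>ls\<in>?J. W' (c # ls) \<odot>\<^bsub>H\<^esub> P (a # rs) (c # ls)))
        = (W' (a # rs) * W (rs @ [b])) \<odot>\<^bsub>H\<^esub> \<one>\<^bsub>H\<^esub>"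
      unfolding eq by (simp add: H.smult_smult mult.commute)
  qed auto
  also have "\<dots> = (if a = b then 1 else 0) \<odot>\<^bsub>H\<^esub> \<one>\<^bsub>H\<^esub>" by (rule duality_one[OF assms])
  finally show ?thesis .
qed

lemma PQ: "\<lbrakk>as \<in> I n; bs \<in> I n\<rbrakk>
    \<Longrightarrow> (\<Oplus>\<^bsub>H\<^esub>cs\<in>I n. P as cs \<otimes>\<^bsub>H\<^esub> Q cs bs) = (if as = bs then 1 else 0) \<odot>\<^bsub>H\<^esub> \<one>\<^bsub>H\<^esub>"
  by (rule H.word_right_inverse[OF gen_closed v_closed u_v])

lemma QP: "\<lbrakk>as \<in> I n; bs \<in> I n\<rbrakk>
    \<Longrightarrow> (\<Oplus>\<^bsub>H\<^esub>cs\<in>I n. Q as cs \<otimes>\<^bsub>H\<^esub> P cs bs) = (if as = bs then 1 else 0) \<odot>\<^bsub>H\<^esub> \<one>\<^bsub>H\<^esub>"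
  by (rule H.word_left_inverse[OF gen_closed v_closed v_u])

lemma smult_one_mult:
  "x \<in> carrier H \<Longrightarrow> (c \<odot>\<^bsub>H\<^esub> \<one>\<^bsub>H\<^esub>) \<otimes>\<^bsub>H\<^esub> x = c \<odot>\<^bsub>H\<^esub> x"
  "x \<in> carrier H \<Longrightarrow> x \<otimes>\<^bsub>H\<^esub> (c \<odot>\<^bsub>H\<^esub> \<one>\<^bsub>H\<^esub>) = c \<odot>\<^bsub>H\<^esub> x"
  by (simp_all add: H.smult_mult_left H.smult_mult_right)

lemma finsum_delta_one:
  assumes "finite J" "j \<in> J"
  shows "(\<Oplus>\<^bsub>H\<^esub>i\<in>J. c i \<odot>\<^bsub>H\<^esub> ((if i = j then 1 else 0) \<odot>\<^bsub>H\<^esub> \<one>\<^bsub>H\<^esub>)) = c j \<odot>\<^bsub>H\<^esub> \<one>\<^bsub>H\<^esub>"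
proof -
  have "(\<Oplus>\<^bsub>H\<^esub>i\<in>J. c i \<odot>\<^bsub>H\<^esub> ((if i = j then 1 else 0) \<odot>\<^bsub>H\<^esub> \<one>\<^bsub>H\<^esub>))
      = (\<Oplus>\<^bsub>H\<^esub>i\<in>J. (if i = j then 1 else 0) \<odot>\<^bsub>H\<^esub> (c i \<odot>\<^bsub>H\<^esub> \<one>\<^bsub>H\<^esub>))"
    by (rule H.finsum_cong') (auto simp: H.smult_smult)
  then show ?thesis using H.finsum_delta[OF assms, of "\<lambda>i. c i \<odot>\<^bsub>H\<^esub> \<one>\<^bsub>H\<^esub>"] by simp
qed

text \<open>In matrix form: \<open>W = W P\<close> gives \<open>W Q = W P Q = W\<close>, and \<open>P W' = W'\<close> gives \<open>Q W' = Q P W' = W'\<close>.\<close>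

lemma form_relations_opposite: "form_relations s m W W' (opposite_algebra H) v"
  unfolding form_relations_def finsum_opposite opposite_algebra_sel
proof (intro conjI ballI)
  fix gs assume gs: "gs \<in> I m"
  have "(\<Oplus>\<^bsub>H\<^esub>bs\<in>I m. W bs \<odot>\<^bsub>H\<^esub> Q bs gs)
      = (\<Oplus>\<^bsub>H\<^esub>bs\<in>I m. (\<Oplus>\<^bsub>H\<^esub>as\<in>I m. W as \<odot>\<^bsub>H\<^esub> P as bs) \<otimes>\<^bsub>H\<^esub> Q bs gs)"
    by (rule H.finsum_cong') (use gs in \<open>auto simp: relation_W smult_one_mult Q_closed word_closed\<close>)
  also have "\<dots> = (\<Oplus>\<^bsub>H\<^esub>as\<in>I m. W as \<odot>\<^bsub>H\<^esub> (\<Oplus>\<^bsub>H\<^esub>bs\<in>I m. P as bs \<otimes>\<^bsub>H\<^esub> Q bs gs))"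
    by (rule bilinear_sum_left[OF H.k_module H.k_module H.bilinear_mult])
      (use gs in \<open>auto simp: Q_closed word_closed\<close>)
  also have "\<dots> = (\<Oplus>\<^bsub>H\<^esub>as\<in>I m. W as \<odot>\<^bsub>H\<^esub> ((if as = gs then 1 else 0) \<odot>\<^bsub>H\<^esub> \<one>\<^bsub>H\<^esub>))"
    by (rule H.finsum_cong') (use gs PQ in auto)
  also have "\<dots> = W gs \<odot>\<^bsub>H\<^esub> \<one>\<^bsub>H\<^esub>"
    by (rule finsum_delta_one) (use gs in auto)
  finally show "(\<Oplus>\<^bsub>H\<^esub>bs\<in>I m. W bs \<odot>\<^bsub>H\<^esub> Q bs gs) = W gs \<odot>\<^bsub>H\<^esub> \<one>\<^bsub>H\<^esub>" .
  have "(\<Oplus>\<^bsub>H\<^esub>bs\<in>I m. W' bs \<odot>\<^bsub>H\<^esub> Q gs bs)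
      = (\<Oplus>\<^bsub>H\<^esub>bs\<in>I m. Q gs bs \<otimes>\<^bsub>H\<^esub> (\<Oplus>\<^bsub>H\<^esub>as\<in>I m. W' as \<odot>\<^bsub>H\<^esub> P bs as))"
    by (rule H.finsum_cong') (use gs in \<open>auto simp: relation_W' smult_one_mult Q_closed word_closed\<close>)
  also have "\<dots> = (\<Oplus>\<^bsub>H\<^esub>as\<in>I m. W' as \<odot>\<^bsub>H\<^esub> (\<Oplus>\<^bsub>H\<^esub>bs\<in>I m. Q gs bs \<otimes>\<^bsub>H\<^esub> P bs as))"
    by (rule bilinear_sum_right[OF H.k_module H.k_module H.bilinear_mult])
      (use gs in \<open>auto simp: Q_closed word_closed\<close>)
  also have "\<dots> = (\<Oplus>\<^bsub>H\<^esub>as\<in>I m. W' as \<odot>\<^bsub>H\<^esub> ((if as = gs then 1 else 0) \<odot>\<^bsub>H\<^esub> \<one>\<^bsub>H\<^esub>))"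
    by (rule H.finsum_cong') (use gs QP in auto)
  also have "\<dots> = W' gs \<odot>\<^bsub>H\<^esub> \<one>\<^bsub>H\<^esub>"
    by (rule finsum_delta_one) (use gs in auto)
  finally show "(\<Oplus>\<^bsub>H\<^esub>bs\<in>I m. W' bs \<odot>\<^bsub>H\<^esub> Q gs bs) = W' gs \<odot>\<^bsub>H\<^esub> \<one>\<^bsub>H\<^esub>" .
qed

section \<open>The relations for the coproduct and the counit\<close>

abbreviation "\<Delta>gen a b \<equiv> \<Oplus>\<^bsub>T\<^esub>l\<in>{0..s}. pure_tensor H H (u a l) (u l b)"

lemma \<Delta>gen_closed: "matrix_in s (carrier T) (\<lambda>a b. \<Delta>gen a b)"
  unfolding matrix_in_def
  by (auto intro!: T.finsum_closed HH.pure_tensor_closed simp: matrix_inD[OF gen_closed])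

text \<open>Word matrices over the tensor square are P (x) P. Contraction with \<open>W\<close> is
  absorbed by the first leg and then, carried over, by the second; contraction with
  \<open>W'\<close> passes through the legs in the opposite order.\<close>

lemma form_relations_coproduct: "form_relations s m W W' T (\<lambda>a b. \<Delta>gen a b)"
  unfolding form_relations_def
proof (intro conjI ballI)
  let ?p = "pure_tensor H H"
  note word = H.coproduct_word[OF gen_closed]
  note closed = word_closed HH.pure_tensor_closed
  note bil = HH.bilinear_pure_tensor
  have scal: "?p (c \<odot>\<^bsub>H\<^esub> \<one>\<^bsub>H\<^esub>) x = c \<odot>\<^bsub>T\<^esub> ?p \<one>\<^bsub>H\<^esub> x" "?p x (c \<odot>\<^bsub>H\<^esub> \<one>\<^bsub>H\<^esub>) = c \<odot>\<^bsub>T\<^esub> ?p x \<one>\<^bsub>H\<^esub>"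
    if "x \<in> carrier H" for c x
    using lin_hom_smult[OF bilinear_map_left[OF bil that]] lin_hom_smult[OF bilinear_map_right[OF bil that]]
    by simp_all
  fix gs assume gs: "gs \<in> I m"
  have "(\<Oplus>\<^bsub>T\<^esub>as\<in>I m. W as \<odot>\<^bsub>T\<^esub> index_word T (\<lambda>a b. \<Delta>gen a b) as gs)
      = (\<Oplus>\<^bsub>T\<^esub>as\<in>I m. W as \<odot>\<^bsub>T\<^esub> (\<Oplus>\<^bsub>T\<^esub>cs\<in>I m. ?p (P as cs) (P cs gs)))"
    by (rule T.finsum_cong') (use gs in \<open>auto intro!: T.finsum_closed simp: word closed\<close>)
  also have "\<dots> = (\<Oplus>\<^bsub>T\<^esub>cs\<in>I m. ?p (\<Oplus>\<^bsub>H\<^esub>as\<in>I m. W as \<odot>\<^bsub>H\<^esub> P as cs) (P cs gs))"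
    by (rule bilinear_sum_left[OF H.k_module T.k_module bil, symmetric]) (use gs in \<open>auto simp: closed\<close>)
  \<comment> \<open>The scalar \<open>W cs\<close> left by the first leg moves to the second, where
    it again forms the sum in the relation of \<open>W\<close>.\<close>
  also have "\<dots> = (\<Oplus>\<^bsub>T\<^esub>cs\<in>I m. ?p \<one>\<^bsub>H\<^esub> (W cs \<odot>\<^bsub>H\<^esub> P cs gs))"
    by (rule T.finsum_cong')
      (use gs lin_hom_smult[OF bilinear_map_right[OF bil H.one_closed]] in \<open>auto simp: relation_W scal closed\<close>)
  also have "\<dots> = ?p \<one>\<^bsub>H\<^esub> (\<Oplus>\<^bsub>H\<^esub>cs\<in>I m. W cs \<odot>\<^bsub>H\<^esub> P cs gs)"
    by (rule lin_hom_finsum[OF H.k_module T.k_module bilinear_map_right[OF bil H.one_closed], symmetric])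
      (use gs in \<open>auto simp: closed\<close>)
  also have "\<dots> = W gs \<odot>\<^bsub>T\<^esub> \<one>\<^bsub>T\<^esub>"
    using gs by (simp add: relation_W scal HH.tensor_one)
  finally show "(\<Oplus>\<^bsub>T\<^esub>as\<in>I m. W as \<odot>\<^bsub>T\<^esub> index_word T (\<lambda>a b. \<Delta>gen a b) as gs) = W gs \<odot>\<^bsub>T\<^esub> \<one>\<^bsub>T\<^esub>" .
  have "(\<Oplus>\<^bsub>T\<^esub>as\<in>I m. W' as \<odot>\<^bsub>T\<^esub> index_word T (\<lambda>a b. \<Delta>gen a b) gs as)
      = (\<Oplus>\<^bsub>T\<^esub>as\<in>I m. W' as \<odot>\<^bsub>T\<^esub> (\<Oplus>\<^bsub>T\<^esub>cs\<in>I m. ?p (P gs cs) (P cs as)))"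
    by (rule T.finsum_cong') (use gs in \<open>auto intro!: T.finsum_closed simp: word closed\<close>)
  also have "\<dots> = (\<Oplus>\<^bsub>T\<^esub>cs\<in>I m. ?p (P gs cs) (\<Oplus>\<^bsub>H\<^esub>as\<in>I m. W' as \<odot>\<^bsub>H\<^esub> P cs as))"
    by (rule bilinear_sum_right[OF H.k_module T.k_module bil, symmetric]) (use gs in \<open>auto simp: closed\<close>)
  also have "\<dots> = (\<Oplus>\<^bsub>T\<^esub>cs\<in>I m. ?p (W' cs \<odot>\<^bsub>H\<^esub> P gs cs) \<one>\<^bsub>H\<^esub>)"
    by (rule T.finsum_cong')
      (use gs lin_hom_smult[OF bilinear_map_left[OF bil H.one_closed]] in \<open>auto simp: relation_W' scal closed\<close>)
  also have "\<dots> = ?p (\<Oplus>\<^bsub>H\<^esub>cs\<in>I m. W' cs \<odot>\<^bsub>H\<^esub> P gs cs) \<one>\<^bsub>H\<^esub>"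
    by (rule lin_hom_finsum[OF H.k_module T.k_module bilinear_map_left[OF bil H.one_closed], symmetric])
      (use gs in \<open>auto simp: closed\<close>)
  also have "\<dots> = W' gs \<odot>\<^bsub>T\<^esub> \<one>\<^bsub>T\<^esub>"
    using gs by (simp add: relation_W' scal HH.tensor_one)
  finally show "(\<Oplus>\<^bsub>T\<^esub>as\<in>I m. W' as \<odot>\<^bsub>T\<^esub> index_word T (\<lambda>a b. \<Delta>gen a b) gs as) = W' gs \<odot>\<^bsub>T\<^esub> \<one>\<^bsub>T\<^esub>" .
qed

lemma form_relations_counit:
  "form_relations s m W W' ground_algebra (\<lambda>a b. if a = b then 1 else 0)"
  unfolding form_relations_def finsum_ground
  by (simp add: index_word_ground if_distrib[where f = "(*) _"] sum.delta sum.delta' cong: if_cong)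

end

section \<open>The axioms, verified on word matrices\<close>

context form_pair
begin

lemma word_image:
  assumes "assoc_algebra B" "h \<in> algebra_hom H B" "\<And>a b. \<lbrakk>a \<in> {0..s}; b \<in> {0..s}\<rbrakk> \<Longrightarrow> h (u a b) = y a b"
    and "as \<in> I n" "bs \<in> I n"
  shows "h (P as bs) = index_word B y as bs"
  using algebra_hom_index_word[OF H.assoc_algebra_axioms assms(2) gen_closed assms(4,5)]
    index_word_cong[OF assms(4,5,3)] by simp

lemma lin_hom_counit_unit: "f \<in> lin_hom H ground_algebra \<Longrightarrow> (\<lambda>x. f x \<odot>\<^bsub>H\<^esub> \<one>\<^bsub>H\<^esub>) \<in> lin_hom H H"
  by (rule lin_homI) (simp_all add: lin_hom_add lin_hom_smult H.smult_l_distr H.smult_smult)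

text \<open>The maps are arbitrary algebra homomorphisms with the prescribed values on generators,
  so the facts below apply both to the constructed structure and to any competing one.\<close>

context
  fixes \<Delta> \<epsilon>
  assumes \<Delta>: "\<Delta> \<in> algebra_hom H T" and \<epsilon>: "\<epsilon> \<in> algebra_hom H ground_algebra"
    and \<Delta>_gen: "\<And>a b. \<lbrakk>a \<in> {0..s}; b \<in> {0..s}\<rbrakk> \<Longrightarrow> \<Delta> (u a b) = \<Delta>gen a b"
    and \<epsilon>_gen: "\<And>a b. \<lbrakk>a \<in> {0..s}; b \<in> {0..s}\<rbrakk> \<Longrightarrow> \<epsilon> (u a b) = (if a = b then 1 else 0)"
begin

lemma \<Delta>_word:
  assumes "as \<in> I n" "bs \<in> I n"
  shows "\<Delta> (P as bs) = (\<Oplus>\<^bsub>T\<^esub>cs\<in>I n. pure_tensor H H (P as cs) (P cs bs))"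
  using word_image[OF T.assoc_algebra_axioms \<Delta> \<Delta>_gen assms] H.coproduct_word[OF gen_closed assms] by simp

lemma \<epsilon>_word: "\<lbrakk>as \<in> I n; bs \<in> I n\<rbrakk> \<Longrightarrow> \<epsilon> (P as bs) = (if as = bs then 1 else 0)"
  using word_image[OF assoc_algebra_ground \<epsilon> \<epsilon>_gen] index_word_ground by metis

lemmas \<Delta>_lin = algebra_hom_lin[OF \<Delta>] and \<epsilon>_lin = algebra_hom_lin[OF \<epsilon>]

text \<open>The matrix counterpart of Sweedler notation: a linear function of the coproduct of a
  word is a sum over the middle multi-index.\<close>

lemma lin_\<Delta>_word:
  assumes "k_module C" "f \<in> lin_hom T C" "as \<in> I n" "bs \<in> I n"
  shows "f (\<Delta> (P as bs)) = (\<Oplus>\<^bsub>C\<^esub>cs\<in>I n. f (pure_tensor H H (P as cs) (P cs bs)))"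
  unfolding \<Delta>_word[OF assms(3,4)]
  by (rule lin_hom_finsum[OF T.k_module assms(1,2)])
    (use assms in \<open>auto simp: word_closed HH.pure_tensor_closed\<close>)

text \<open>On \<open>P\<close> both sides are the double sum of the terms P (x) (P (x) P); only the
  order of the two summations differs.\<close>

lemma form_coassoc:
  assumes "x \<in> carrier H"
  shows "tensor_assoc H H H (tensor_map T H \<Delta> (\<lambda>a. a) (\<Delta> x)) = tensor_map H T (\<lambda>a. a) \<Delta> (\<Delta> x)"
proof -
  interpret TH: tensor_pair T H by unfold_locales
  interpret HT: tensor_pair H T by unfold_locales
  interpret C: assoc_algebra "tensor_algebra H T" by (rule HT.assoc_algebra_tensor)
  note as_lin = tensor_assoc_lin_hom[OF H.assoc_algebra_axioms H.assoc_algebra_axioms H.assoc_algebra_axioms]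
  note as_pure = tensor_assoc_pure[OF H.assoc_algebra_axioms H.assoc_algebra_axioms H.assoc_algebra_axioms]
  note l_lin = tensor_map_lin_hom[OF HH.tensor_pair_axioms TH.tensor_pair_axioms \<Delta>_lin lin_hom_id]
  note l_pure = tensor_map_pure[OF HH.tensor_pair_axioms TH.tensor_pair_axioms \<Delta>_lin lin_hom_id]
  note r_lin = tensor_map_lin_hom[OF HH.tensor_pair_axioms HT.tensor_pair_axioms lin_hom_id \<Delta>_lin]
  note r_pure = tensor_map_pure[OF HH.tensor_pair_axioms HT.tensor_pair_axioms lin_hom_id \<Delta>_lin]
  note lhs = lin_hom_comp[OF as_lin l_lin]
  note closed = word_closed HH.pure_tensor_closed HT.pure_tensor_closed
  show ?thesis
  proof (rule lin_hom_form_eqI[OF C.k_module lin_hom_comp[OF lhs \<Delta>_lin] lin_hom_comp[OF r_lin \<Delta>_lin] _ assms])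
    fix n as bs assume ab: "as \<in> I n" "bs \<in> I n"
    let ?t = "\<lambda>cs ds. pure_tensor H T (P as cs) (pure_tensor H H (P cs ds) (P ds bs))"
    have "tensor_assoc H H H (tensor_map T H \<Delta> (\<lambda>a. a) (\<Delta> (P as bs)))
        = (\<Oplus>\<^bsub>tensor_algebra H T\<^esub>ds\<in>I n. tensor_assoc H H H (pure_tensor T H (\<Delta> (P as ds)) (P ds bs)))"
      unfolding lin_\<Delta>_word[OF C.k_module lhs ab]
      by (rule C.finsum_cong')
        (use ab in \<open>auto simp: l_pure closed
          intro!: lin_hom_closed[OF as_lin] TH.pure_tensor_closed lin_hom_closed[OF \<Delta>_lin]\<close>)
    also have "\<dots> = (\<Oplus>\<^bsub>tensor_algebra H T\<^esub>ds\<in>I n. \<Oplus>\<^bsub>tensor_algebra H T\<^esub>cs\<in>I n. ?t cs ds)"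
    proof (rule C.finsum_cong')
      fix ds assume ds: "ds \<in> I n"
      note lin = lin_hom_comp[OF as_lin bilinear_map_left[OF TH.bilinear_pure_tensor word_closed[OF ds ab(2)]]]
      show "tensor_assoc H H H (pure_tensor T H (\<Delta> (P as ds)) (P ds bs))
          = (\<Oplus>\<^bsub>tensor_algebra H T\<^esub>cs\<in>I n. ?t cs ds)"
        unfolding lin_\<Delta>_word[OF C.k_module lin ab(1) ds]
        by (rule C.finsum_cong') (use ab ds in \<open>auto simp: as_pure closed\<close>)
    qed (use ab in \<open>auto intro!: C.finsum_closed simp: closed\<close>)
    also have "\<dots> = (\<Oplus>\<^bsub>tensor_algebra H T\<^esub>cs\<in>I n. \<Oplus>\<^bsub>tensor_algebra H T\<^esub>ds\<in>I n. ?t cs ds)"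
      by (rule C.finsum_swap) (use ab in \<open>auto simp: closed\<close>)
    also have "\<dots> = (\<Oplus>\<^bsub>tensor_algebra H T\<^esub>cs\<in>I n. tensor_map H T (\<lambda>a. a) \<Delta> (pure_tensor H H (P as cs) (P cs bs)))"
    proof (rule C.finsum_cong')
      fix cs assume cs: "cs \<in> I n"
      note lin = bilinear_map_right[OF HT.bilinear_pure_tensor word_closed[OF ab(1) cs]]
      show "(\<Oplus>\<^bsub>tensor_algebra H T\<^esub>ds\<in>I n. ?t cs ds)
          = tensor_map H T (\<lambda>a. a) \<Delta> (pure_tensor H H (P as cs) (P cs bs))"
        using ab cs by (simp add: r_pure closed lin_\<Delta>_word[OF C.k_module lin cs ab(2)])
    qed (use ab in \<open>auto intro!: lin_hom_closed[OF r_lin] simp: closed\<close>)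
    also have "\<dots> = tensor_map H T (\<lambda>a. a) \<Delta> (\<Delta> (P as bs))"
      by (rule lin_\<Delta>_word[OF C.k_module r_lin ab, symmetric])
    finally show "tensor_assoc H H H (tensor_map T H \<Delta> (\<lambda>a. a) (\<Delta> (P as bs)))
      = tensor_map H T (\<lambda>a. a) \<Delta> (\<Delta> (P as bs))" .
  qed
qed

lemma form_counit_left:
  assumes "x \<in> carrier H"
  shows "tensor_map ground_algebra H \<epsilon> (\<lambda>a. a) (\<Delta> x) = pure_tensor ground_algebra H 1 x"
proof -
  interpret k: assoc_algebra "ground_algebra :: ('k, 'k) module" by (rule assoc_algebra_ground)
  interpret kH: tensor_pair "ground_algebra :: ('k, 'k) module" H by unfold_locales
  interpret C: assoc_algebra "tensor_algebra ground_algebra H" by (rule kH.assoc_algebra_tensor)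
  note lin = tensor_map_lin_hom[OF HH.tensor_pair_axioms kH.tensor_pair_axioms \<epsilon>_lin lin_hom_id]
  note pure = tensor_map_pure[OF HH.tensor_pair_axioms kH.tensor_pair_axioms \<epsilon>_lin lin_hom_id]
  have unit: "(\<lambda>x. pure_tensor ground_algebra H 1 x) \<in> lin_hom H (tensor_algebra ground_algebra H)"
    by (rule bilinear_map_right[OF kH.bilinear_pure_tensor]) simp
  \<comment> \<open>The counit leaves a scalar in the ground field leg, where c is c times 1 and can
    be taken out of the tensor.\<close>
  have scal: "pure_tensor ground_algebra H c y = c \<odot>\<^bsub>tensor_algebra ground_algebra H\<^esub> pure_tensor ground_algebra H 1 y"
    if "y \<in> carrier H" for c y
    using lin_hom_smult[OF bilinear_map_left[OF kH.bilinear_pure_tensor that], of 1 c] by simp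
  show ?thesis
  proof (rule lin_hom_form_eqI[OF C.k_module lin_hom_comp[OF lin \<Delta>_lin] unit _ assms])
    fix n as bs assume ab: "as \<in> I n" "bs \<in> I n"
    have "tensor_map ground_algebra H \<epsilon> (\<lambda>a. a) (\<Delta> (P as bs))
        = (\<Oplus>\<^bsub>tensor_algebra ground_algebra H\<^esub>cs\<in>I n.
            (if cs = as then 1 else 0) \<odot>\<^bsub>tensor_algebra ground_algebra H\<^esub> pure_tensor ground_algebra H 1 (P cs bs))"
      unfolding lin_\<Delta>_word[OF C.k_module lin ab]
    proof (rule C.finsum_cong')
      fix cs assume cs: "cs \<in> I n"
      then show "tensor_map ground_algebra H \<epsilon> (\<lambda>a. a) (pure_tensor H H (P as cs) (P cs bs))
        = (if cs = as then 1 else 0) \<odot>\<^bsub>tensor_algebra ground_algebra H\<^esub> pure_tensor ground_algebra H 1 (P cs bs)"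
        using ab scal[OF word_closed[OF cs ab(2)], of "if cs = as then 1 else 0"]
        by (simp only: pure word_closed \<epsilon>_word eq_commute[of as])
    qed (use ab in \<open>auto intro!: kH.pure_tensor_closed C.smult_closed simp: word_closed\<close>)
    also have "\<dots> = pure_tensor ground_algebra H 1 (P as bs)"
      by (rule C.finsum_delta) (use ab in \<open>auto intro!: kH.pure_tensor_closed simp: word_closed\<close>)
    finally show "tensor_map ground_algebra H \<epsilon> (\<lambda>a. a) (\<Delta> (P as bs)) = pure_tensor ground_algebra H 1 (P as bs)" .
  qed
qed

lemma form_counit_right:
  assumes "x \<in> carrier H"
  shows "tensor_map H ground_algebra (\<lambda>a. a) \<epsilon> (\<Delta> x) = pure_tensor H ground_algebra x 1"
proof -
  interpret k: assoc_algebra "ground_algebra :: ('k, 'k) module" by (rule assoc_algebra_ground)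
  interpret Hk: tensor_pair H "ground_algebra :: ('k, 'k) module" by unfold_locales
  interpret C: assoc_algebra "tensor_algebra H ground_algebra" by (rule Hk.assoc_algebra_tensor)
  note lin = tensor_map_lin_hom[OF HH.tensor_pair_axioms Hk.tensor_pair_axioms lin_hom_id \<epsilon>_lin]
  note pure = tensor_map_pure[OF HH.tensor_pair_axioms Hk.tensor_pair_axioms lin_hom_id \<epsilon>_lin]
  have unit: "(\<lambda>x. pure_tensor H ground_algebra x 1) \<in> lin_hom H (tensor_algebra H ground_algebra)"
    by (rule bilinear_map_left[OF Hk.bilinear_pure_tensor]) simp
  have scal: "pure_tensor H ground_algebra y c = c \<odot>\<^bsub>tensor_algebra H ground_algebra\<^esub> pure_tensor H ground_algebra y 1"
    if "y \<in> carrier H" for c y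
    using lin_hom_smult[OF bilinear_map_right[OF Hk.bilinear_pure_tensor that], of 1 c] by simp
  show ?thesis
  proof (rule lin_hom_form_eqI[OF C.k_module lin_hom_comp[OF lin \<Delta>_lin] unit _ assms])
    fix n as bs assume ab: "as \<in> I n" "bs \<in> I n"
    have "tensor_map H ground_algebra (\<lambda>a. a) \<epsilon> (\<Delta> (P as bs))
        = (\<Oplus>\<^bsub>tensor_algebra H ground_algebra\<^esub>cs\<in>I n.
            (if cs = bs then 1 else 0) \<odot>\<^bsub>tensor_algebra H ground_algebra\<^esub> pure_tensor H ground_algebra (P as cs) 1)"
      unfolding lin_\<Delta>_word[OF C.k_module lin ab]
    proof (rule C.finsum_cong')
      fix cs assume cs: "cs \<in> I n"
      then show "tensor_map H ground_algebra (\<lambda>a. a) \<epsilon> (pure_tensor H H (P as cs) (P cs bs))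
        = (if cs = bs then 1 else 0) \<odot>\<^bsub>tensor_algebra H ground_algebra\<^esub> pure_tensor H ground_algebra (P as cs) 1"
        using ab scal[OF word_closed[OF ab(1) cs], of "if cs = bs then 1 else 0"]
        by (simp only: pure word_closed \<epsilon>_word)
    qed (use ab in \<open>auto intro!: Hk.pure_tensor_closed C.smult_closed simp: word_closed\<close>)
    also have "\<dots> = pure_tensor H ground_algebra (P as bs) 1"
      by (rule C.finsum_delta) (use ab in \<open>auto intro!: Hk.pure_tensor_closed simp: word_closed\<close>)
    finally show "tensor_map H ground_algebra (\<lambda>a. a) \<epsilon> (\<Delta> (P as bs)) = pure_tensor H ground_algebra (P as bs) 1" .
  qed
qed

lemma form_bialgebra: "bialgebra H \<Delta> \<epsilon>"
  unfolding bialgebra_def coalgebra_def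
  using H.assoc_algebra_axioms \<Delta> \<epsilon> \<Delta>_lin \<epsilon>_lin form_coassoc form_counit_left form_counit_right by blast

text \<open>On word matrices, convolution is matrix multiplication. \<open>S\<close> is any linear
  map, so the formulas hold for the constructed antipode and for every other candidate.\<close>

lemma convolution_word:
  assumes S: "S \<in> lin_hom H H" and ab: "as \<in> I n" "bs \<in> I n"
  shows "tensor_lift H (\<otimes>\<^bsub>H\<^esub>) (tensor_map H H S (\<lambda>a. a) (\<Delta> (P as bs)))
      = (\<Oplus>\<^bsub>H\<^esub>cs\<in>I n. S (P as cs) \<otimes>\<^bsub>H\<^esub> P cs bs)"
    and "tensor_lift H (\<otimes>\<^bsub>H\<^esub>) (tensor_map H H (\<lambda>a. a) S (\<Delta> (P as bs)))
      = (\<Oplus>\<^bsub>H\<^esub>cs\<in>I n. P as cs \<otimes>\<^bsub>H\<^esub> S (P cs bs))"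
proof -
  note HH = HH.tensor_pair_axioms
  note mult = HH.tensor_lift_lin_hom[OF H.k_module H.bilinear_mult]
    HH.tensor_lift_pure[OF H.k_module H.bilinear_mult]
  note closed = word_closed lin_hom_closed[OF S]
  note l = tensor_map_lin_hom[OF HH HH S lin_hom_id] tensor_map_pure[OF HH HH S lin_hom_id]
  note r = tensor_map_lin_hom[OF HH HH lin_hom_id S] tensor_map_pure[OF HH HH lin_hom_id S]
  show "tensor_lift H (\<otimes>\<^bsub>H\<^esub>) (tensor_map H H S (\<lambda>a. a) (\<Delta> (P as bs)))
      = (\<Oplus>\<^bsub>H\<^esub>cs\<in>I n. S (P as cs) \<otimes>\<^bsub>H\<^esub> P cs bs)"
    unfolding lin_\<Delta>_word[OF H.k_module lin_hom_comp[OF mult(1) l(1)] ab]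
    by (rule H.finsum_cong') (use ab in \<open>auto simp: l(2) mult(2) closed\<close>)
  show "tensor_lift H (\<otimes>\<^bsub>H\<^esub>) (tensor_map H H (\<lambda>a. a) S (\<Delta> (P as bs)))
      = (\<Oplus>\<^bsub>H\<^esub>cs\<in>I n. P as cs \<otimes>\<^bsub>H\<^esub> S (P cs bs))"
    unfolding lin_\<Delta>_word[OF H.k_module lin_hom_comp[OF mult(1) r(1)] ab]
    by (rule H.finsum_cong') (use ab in \<open>auto simp: r(2) mult(2) closed\<close>)
qed

text \<open>Multiplicativity into the opposite algebra gives \<open>S (P as bs) = Q as bs\<close>,
  and the two antipode axioms become \<open>QP\<close> and \<open>PQ\<close>.\<close>

lemma form_hopf_algebra:
  assumes S: "S \<in> algebra_hom H (opposite_algebra H)"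
    and S_gen: "\<And>a b. \<lbrakk>a \<in> {0..s}; b \<in> {0..s}\<rbrakk> \<Longrightarrow> S (u a b) = v a b"
  shows "hopf_algebra H \<Delta> \<epsilon> S"
proof -
  have S_lin: "S \<in> lin_hom H H" using algebra_hom_lin[OF S] by simp
  have S_word: "S (P as bs) = Q as bs" if "as \<in> I n" "bs \<in> I n" for n as bs
    by (rule word_image[OF opp S S_gen that])
  note HH = HH.tensor_pair_axioms
  note mult = HH.tensor_lift_lin_hom[OF H.k_module H.bilinear_mult]
  note l = lin_hom_comp[OF lin_hom_comp[OF mult tensor_map_lin_hom[OF HH HH S_lin lin_hom_id]] \<Delta>_lin]
  note r = lin_hom_comp[OF lin_hom_comp[OF mult tensor_map_lin_hom[OF HH HH lin_hom_id S_lin]] \<Delta>_lin]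
  note unit = lin_hom_counit_unit[OF \<epsilon>_lin]
  have "tensor_lift H (\<otimes>\<^bsub>H\<^esub>) (tensor_map H H S (\<lambda>a. a) (\<Delta> x)) = \<epsilon> x \<odot>\<^bsub>H\<^esub> \<one>\<^bsub>H\<^esub>"
    if "x \<in> carrier H" for x
  proof (rule lin_hom_form_eqI[OF H.k_module l unit _ that])
    fix n as bs assume ab: "as \<in> I n" "bs \<in> I n"
    have "(\<Oplus>\<^bsub>H\<^esub>cs\<in>I n. S (P as cs) \<otimes>\<^bsub>H\<^esub> P cs bs) = (\<Oplus>\<^bsub>H\<^esub>cs\<in>I n. Q as cs \<otimes>\<^bsub>H\<^esub> P cs bs)"
      by (rule H.finsum_cong') (use ab in \<open>auto simp: S_word Q_closed word_closed\<close>)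
    then show "tensor_lift H (\<otimes>\<^bsub>H\<^esub>) (tensor_map H H S (\<lambda>a. a) (\<Delta> (P as bs))) = \<epsilon> (P as bs) \<odot>\<^bsub>H\<^esub> \<one>\<^bsub>H\<^esub>"
      by (simp only: convolution_word[OF S_lin ab] \<epsilon>_word[OF ab] QP[OF ab])
  qed
  moreover have "tensor_lift H (\<otimes>\<^bsub>H\<^esub>) (tensor_map H H (\<lambda>a. a) S (\<Delta> x)) = \<epsilon> x \<odot>\<^bsub>H\<^esub> \<one>\<^bsub>H\<^esub>"
    if "x \<in> carrier H" for x
  proof (rule lin_hom_form_eqI[OF H.k_module r unit _ that])
    fix n as bs assume ab: "as \<in> I n" "bs \<in> I n"
    have "(\<Oplus>\<^bsub>H\<^esub>cs\<in>I n. P as cs \<otimes>\<^bsub>H\<^esub> S (P cs bs)) = (\<Oplus>\<^bsub>H\<^esub>cs\<in>I n. P as cs \<otimes>\<^bsub>H\<^esub> Q cs bs)"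
      by (rule H.finsum_cong') (use ab in \<open>auto simp: S_word Q_closed word_closed\<close>)
    then show "tensor_lift H (\<otimes>\<^bsub>H\<^esub>) (tensor_map H H (\<lambda>a. a) S (\<Delta> (P as bs))) = \<epsilon> (P as bs) \<odot>\<^bsub>H\<^esub> \<one>\<^bsub>H\<^esub>"
      by (simp only: convolution_word[OF S_lin ab] \<epsilon>_word[OF ab] PQ[OF ab])
  qed
  ultimately show ?thesis
    unfolding hopf_algebra_def using form_bialgebra S_lin by blast
qed

text \<open>No multiplicativity of \<open>S\<close> is available. The computation S(P) = S(P) (P Q)
  = (S(P) P) Q = Q is carried out for each word length, with the convolution identity for S(P)
  P.\<close>

lemma antipode_word:
  assumes "hopf_algebra H \<Delta> \<epsilon> S" and ab: "as \<in> I n" "bs \<in> I n"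
  shows "S (P as bs) = Q as bs"
proof -
  have S: "S \<in> lin_hom H H" using assms(1) by (simp add: hopf_algebra_def)
  note closed = word_closed Q_closed lin_hom_closed[OF S]
  have inv: "(\<Oplus>\<^bsub>H\<^esub>cs\<in>I n. S (P as cs) \<otimes>\<^bsub>H\<^esub> P cs ds) = (if as = ds then 1 else 0) \<odot>\<^bsub>H\<^esub> \<one>\<^bsub>H\<^esub>" if ds: "ds \<in> I n" for ds
    using assms(1) word_closed[OF ab(1) ds] convolution_word(1)[OF S ab(1) ds] \<epsilon>_word[OF ab(1) ds]
    by (simp add: hopf_algebra_def)
  \<comment> \<open>An identity matrix is inserted on the right so that it can be rewritten as the
    product of \<open>P\<close> and \<open>Q\<close>.\<close>
  have "S (P as bs) = (\<Oplus>\<^bsub>H\<^esub>cs\<in>I n. (if cs = bs then 1 else 0) \<odot>\<^bsub>H\<^esub> S (P as cs))"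
    by (rule H.finsum_delta[symmetric]) (use ab in \<open>auto simp: closed\<close>)
  also have "\<dots> = (\<Oplus>\<^bsub>H\<^esub>cs\<in>I n. \<Oplus>\<^bsub>H\<^esub>ds\<in>I n. S (P as cs) \<otimes>\<^bsub>H\<^esub> (P cs ds \<otimes>\<^bsub>H\<^esub> Q ds bs))"
  proof (rule H.finsum_cong')
    fix cs assume cs: "cs \<in> I n"
    have "(\<Oplus>\<^bsub>H\<^esub>ds\<in>I n. S (P as cs) \<otimes>\<^bsub>H\<^esub> (P cs ds \<otimes>\<^bsub>H\<^esub> Q ds bs))
        = S (P as cs) \<otimes>\<^bsub>H\<^esub> (\<Oplus>\<^bsub>H\<^esub>ds\<in>I n. P cs ds \<otimes>\<^bsub>H\<^esub> Q ds bs)"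
      by (rule H.finsum_rdistr[symmetric]) (use ab cs in \<open>auto simp: closed\<close>)
    then show "(if cs = bs then 1 else 0) \<odot>\<^bsub>H\<^esub> S (P as cs)
        = (\<Oplus>\<^bsub>H\<^esub>ds\<in>I n. S (P as cs) \<otimes>\<^bsub>H\<^esub> (P cs ds \<otimes>\<^bsub>H\<^esub> Q ds bs))"
      using ab cs by (simp only: PQ[OF cs ab(2)] smult_one_mult(2) closed)
  qed (use ab in \<open>auto intro!: H.finsum_closed simp: closed\<close>)
  also have "\<dots> = (\<Oplus>\<^bsub>H\<^esub>ds\<in>I n. \<Oplus>\<^bsub>H\<^esub>cs\<in>I n. S (P as cs) \<otimes>\<^bsub>H\<^esub> (P cs ds \<otimes>\<^bsub>H\<^esub> Q ds bs))"
    by (rule H.finsum_swap) (use ab in \<open>auto simp: closed\<close>)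
  also have "\<dots> = (\<Oplus>\<^bsub>H\<^esub>ds\<in>I n. (if ds = as then 1 else 0) \<odot>\<^bsub>H\<^esub> Q ds bs)"
  proof (rule H.finsum_cong')
    fix ds assume ds: "ds \<in> I n"
    have "(\<Oplus>\<^bsub>H\<^esub>cs\<in>I n. S (P as cs) \<otimes>\<^bsub>H\<^esub> (P cs ds \<otimes>\<^bsub>H\<^esub> Q ds bs))
        = (\<Oplus>\<^bsub>H\<^esub>cs\<in>I n. (S (P as cs) \<otimes>\<^bsub>H\<^esub> P cs ds) \<otimes>\<^bsub>H\<^esub> Q ds bs)"
      by (rule H.finsum_cong') (use ab ds in \<open>auto simp: closed H.m_assoc\<close>)
    also have "\<dots> = (\<Oplus>\<^bsub>H\<^esub>cs\<in>I n. S (P as cs) \<otimes>\<^bsub>H\<^esub> P cs ds) \<otimes>\<^bsub>H\<^esub> Q ds bs"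
      by (rule H.finsum_ldistr[symmetric]) (use ab ds in \<open>auto simp: closed\<close>)
    also have "\<dots> = (if ds = as then 1 else 0) \<odot>\<^bsub>H\<^esub> Q ds bs"
      using ab ds by (simp only: inv[OF ds] smult_one_mult(1) closed eq_commute[of as])
    finally show "(\<Oplus>\<^bsub>H\<^esub>cs\<in>I n. S (P as cs) \<otimes>\<^bsub>H\<^esub> (P cs ds \<otimes>\<^bsub>H\<^esub> Q ds bs))
      = (if ds = as then 1 else 0) \<odot>\<^bsub>H\<^esub> Q ds bs" .
  qed (use ab in \<open>auto simp: closed\<close>)
  also have "\<dots> = Q as bs"
    by (rule H.finsum_delta) (use ab in \<open>auto simp: closed\<close>)
  finally show ?thesis .
qed

end

section \<open>Existence and uniqueness of the structure\<close>

lemma hopf_exists: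
  obtains \<Delta> \<epsilon> S where "\<Delta> \<in> extensional (carrier H)" "\<epsilon> \<in> extensional (carrier H)" "S \<in> extensional (carrier H)"
    "hopf_algebra H \<Delta> \<epsilon> S"
    "\<And>a b. \<lbrakk>a \<in> {0..s}; b \<in> {0..s}\<rbrakk> \<Longrightarrow> \<Delta> (u a b) = \<Delta>gen a b"
    "\<And>a b. \<lbrakk>a \<in> {0..s}; b \<in> {0..s}\<rbrakk> \<Longrightarrow> \<epsilon> (u a b) = (if a = b then 1 else 0)"
    "\<And>a b. \<lbrakk>a \<in> {0..s}; b \<in> {0..s}\<rbrakk> \<Longrightarrow> S (u a b) = v a b"
proof -
  have counit: "matrix_in s (carrier (ground_algebra :: ('k, 'k) module)) (\<lambda>a b. if a = b then 1 else 0)"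
    by (simp add: matrix_in_def)
  obtain \<Delta> where \<Delta>: "\<Delta> \<in> algebra_hom H T" "\<And>a b. \<lbrakk>a \<in> {0..s}; b \<in> {0..s}\<rbrakk> \<Longrightarrow> \<Delta> (u a b) = \<Delta>gen a b"
    by (rule form_hom_exists[OF T.assoc_algebra_axioms \<Delta>gen_closed form_relations_coproduct]) blast
  obtain \<epsilon> where \<epsilon>: "\<epsilon> \<in> algebra_hom H (ground_algebra :: ('k, 'k) module)"
    "\<And>a b. \<lbrakk>a \<in> {0..s}; b \<in> {0..s}\<rbrakk> \<Longrightarrow> \<epsilon> (u a b) = (if a = b then 1 else 0)"
    by (rule form_hom_exists[OF assoc_algebra_ground counit form_relations_counit]) blast
  obtain S where S: "S \<in> algebra_hom H (opposite_algebra H)" "\<And>a b. \<lbrakk>a \<in> {0..s}; b \<in> {0..s}\<rbrakk> \<Longrightarrow> S (u a b) = v a b"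
    by (rule form_hom_exists[OF opp v_closed_opp form_relations_opposite]) blast
  \<comment> \<open>The universal property says nothing about values off the carrier. Restriction
    makes the maps extensional and, by congruence on the carrier, keeps them homomorphisms.\<close>
  note rhom = algebra_hom_cong[OF H.assoc_algebra_axioms]
  have hom: "restrict \<Delta> (carrier H) \<in> algebra_hom H T" "restrict \<epsilon> (carrier H) \<in> algebra_hom H ground_algebra" "restrict S (carrier H) \<in> algebra_hom H (opposite_algebra H)"
    using rhom[OF \<Delta>(1), of "restrict \<Delta> (carrier H)"] rhom[OF \<epsilon>(1), of "restrict \<epsilon> (carrier H)"] rhom[OF S(1), of "restrict S (carrier H)"] by simp_all
  have gen: "restrict \<Delta> (carrier H) (u a b) = \<Delta>gen a b" "restrict \<epsilon> (carrier H) (u a b) = (if a = b then 1 else 0)" "restrict S (carrier H) (u a b) = v a b"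
    if "a \<in> {0..s}" "b \<in> {0..s}" for a b
    using matrix_inD[OF gen_closed that] \<Delta>(2)[OF that] \<epsilon>(2)[OF that] S(2)[OF that] by simp_all
  show thesis
    by (rule that[OF restrict_extensional restrict_extensional restrict_extensional
          form_hopf_algebra[OF hom(1,2) gen(1,2) hom(3) gen(3)] gen])
qed

text \<open>Coproduct and counit are algebra homomorphisms, so their values on generators decide.
  The antipodes are only linear and are compared on all words, where both are given by
  \<open>Q\<close>.\<close>

lemma hopf_unique:
  assumes "hopf_algebra H \<Delta> \<epsilon> S" "hopf_algebra H \<Delta>' \<epsilon>' S'"
    and "\<And>a b. \<lbrakk>a \<in> {0..s}; b \<in> {0..s}\<rbrakk> \<Longrightarrow> \<Delta> (u a b) = \<Delta>gen a b"
    and "\<And>a b. \<lbrakk>a \<in> {0..s}; b \<in> {0..s}\<rbrakk> \<Longrightarrow> \<epsilon> (u a b) = (if a = b then 1 else 0)"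
    and "\<And>a b. \<lbrakk>a \<in> {0..s}; b \<in> {0..s}\<rbrakk> \<Longrightarrow> \<Delta>' (u a b) = \<Delta>gen a b"
    and "\<And>a b. \<lbrakk>a \<in> {0..s}; b \<in> {0..s}\<rbrakk> \<Longrightarrow> \<epsilon>' (u a b) = (if a = b then 1 else 0)"
    and x: "x \<in> carrier H"
  shows "\<Delta> x = \<Delta>' x" "\<epsilon> x = \<epsilon>' x" "S x = S' x"
proof -
  have hom: "\<Delta> \<in> algebra_hom H T" "\<epsilon> \<in> algebra_hom H ground_algebra" "S \<in> lin_hom H H"
    "\<Delta>' \<in> algebra_hom H T" "\<epsilon>' \<in> algebra_hom H ground_algebra" "S' \<in> lin_hom H H"
    using assms(1,2) by (simp_all add: hopf_algebra_def bialgebra_def)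
  show "\<Delta> x = \<Delta>' x"
    by (rule algebra_hom_form_eqI[OF T.assoc_algebra_axioms hom(1,4) _ x]) (simp only: assms(3,5))
  show "\<epsilon> x = \<epsilon>' x"
    by (rule algebra_hom_form_eqI[OF assoc_algebra_ground hom(2,5) _ x]) (simp only: assms(4,6))
  show "S x = S' x"
    by (rule lin_hom_form_eqI[OF H.k_module hom(3,6) _ x])
      (use antipode_word[OF hom(1,2) assms(3,4,1)] antipode_word[OF hom(4,5) assms(5,6,2)] in simp)
qed

end

theorem theorem14:
  fixes m s :: nat
    and w :: "'k::{alg_closed_field, field_char_0} vec list \<Rightarrow> 'k"
    and w' :: "('k vec \<Rightarrow> 'k) list \<Rightarrow> 'k"
  defines "W \<equiv> \<lambda>is. w (map (unit_vec (s + 1)) is)"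
    and "W' \<equiv> \<lambda>is. w' (map (dual_unit_vec (s + 1)) is)"
  defines "H \<equiv> form_algebra s m W W'"
    and "u \<equiv> form_gen s m W W'"
  assumes "m \<ge> 2" and "s \<ge> 1"
    and "preregular m (module_vec TYPE('k) (s + 1)) w"
    and "multilinear_form m (dual_space (module_vec TYPE('k) (s + 1))) w'"
    and "\<And>\<alpha> \<beta>. \<lbrakk>\<alpha> \<in> {0..s}; \<beta> \<in> {0..s}\<rbrakk> \<Longrightarrow>
           (\<Sum>\<gamma>s\<in>multi_indices s (m - 1). W' (\<alpha> # \<gamma>s) * W (\<gamma>s @ [\<beta>])) = (if \<alpha> = \<beta> then 1 else 0)"
  shows "\<exists>!(\<Delta>, \<epsilon>, S).
    \<Delta> \<in> extensional (carrier H) \<and> \<epsilon> \<in> extensional (carrier H) \<and> S \<in> extensional (carrier H) \<and>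
    hopf_algebra H \<Delta> \<epsilon> S \<and>
    (\<forall>\<mu>\<in>{0..s}. \<forall>\<nu>\<in>{0..s}.
       \<Delta> (u \<mu> \<nu>) = (\<Oplus>\<^bsub>tensor_algebra H H\<^esub>l\<in>{0..s}. pure_tensor H H (u \<mu> l) (u l \<nu>)) \<and>
       \<epsilon> (u \<mu> \<nu>) = (if \<mu> = \<nu> then 1 else 0) \<and>
       S (u \<mu> \<nu>) =
         (\<Oplus>\<^bsub>H\<^esub>ls\<in>multi_indices s (m - 1). \<Oplus>\<^bsub>H\<^esub>rs\<in>multi_indices s (m - 1).
            (W' (\<mu> # ls) * W (rs @ [\<nu>])) \<odot>\<^bsub>H\<^esub> index_word H u rs ls))"
proof -
  interpret form_pair s m W W'
    by unfold_locales (use assms(5,9) in auto)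
  obtain \<Delta> \<epsilon> S where ext: "\<Delta> \<in> extensional (carrier H)" "\<epsilon> \<in> extensional (carrier H)" "S \<in> extensional (carrier H)"
    and hopf: "hopf_algebra H \<Delta> \<epsilon> S"
    and gen: "\<And>\<mu> \<nu>. \<lbrakk>\<mu> \<in> {0..s}; \<nu> \<in> {0..s}\<rbrakk> \<Longrightarrow>
        \<Delta> (u \<mu> \<nu>) = (\<Oplus>\<^bsub>tensor_algebra H H\<^esub>l\<in>{0..s}. pure_tensor H H (u \<mu> l) (u l \<nu>))"
      "\<And>\<mu> \<nu>. \<lbrakk>\<mu> \<in> {0..s}; \<nu> \<in> {0..s}\<rbrakk> \<Longrightarrow> \<epsilon> (u \<mu> \<nu>) = (if \<mu> = \<nu> then 1 else 0)"
      "\<And>\<mu> \<nu>. \<lbrakk>\<mu> \<in> {0..s}; \<nu> \<in> {0..s}\<rbrakk> \<Longrightarrow> S (u \<mu> \<nu>) =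
         (\<Oplus>\<^bsub>H\<^esub>ls\<in>multi_indices s (m - 1). \<Oplus>\<^bsub>H\<^esub>rs\<in>multi_indices s (m - 1).
            (W' (\<mu> # ls) * W (rs @ [\<nu>])) \<odot>\<^bsub>H\<^esub> index_word H u rs ls)"
    unfolding H_def u_def by (rule hopf_exists[unfolded v_def]) blast
  show ?thesis
  proof (rule ex1I[of _ "(\<Delta>, \<epsilon>, S)"], goal_cases)
    case 1
    show ?case unfolding prod.case by (intro conjI ballI ext hopf gen)
  next
    case (2 x)
    obtain \<Delta>' \<epsilon>' S' where x: "x = (\<Delta>', \<epsilon>', S')" by (cases x)
    note * = 2[unfolded x prod.case]
    have "\<Delta>' y = \<Delta> y" "\<epsilon>' y = \<epsilon> y" "S' y = S y" if "y \<in> carrier H" for y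
      using hopf_unique[of \<Delta>' \<epsilon>' S' \<Delta> \<epsilon> S y] * hopf gen that
      unfolding H_def u_def by simp_all
    \<comment> \<open>Agreement on the carrier becomes equality of functions because all six maps
      are extensional.\<close>
    then show ?case
      using * ext unfolding x by (auto intro: extensionalityI)
  qed
qed

end
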